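(* A GBS group $G$ is large if and only if there are no coprime nonzero integers $m,n$ such that $G$ is a quotient of $BS(m,n)$.
   Context: For nonzero integers $m,n$, $BS(m,n)=\langle a,t\mid ta^mt^{-1}=a^n\rangle$. A generalized Baumslag-Solitar (GBS) group is a finitely generated group acting on a tree (without inversions) with all vertex and edge stabilizers infinite cyclic. A group is large if some finite index subgroup has a nonabelian free quotient. *)

theory Defs
  imports "HOL-Algebra.Algebra"
begin

section \<open>Group presentations and free groups\<close>

text \<open>The letter \<open>(x, True)\<close> stands for the generator \<open>x\<close>, and \<open>(x, False)\<close> for its inverse.\<close>

type_synonym 's word = "('s \<times> bool) list"

definition words :: "'s set \<Rightarrow> 's word set"
  where "words S = lists (S \<times> UNIV)"

text \<open>
  The congruence on words over \<open>S\<close> generated by free cancellation and by the relations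
  \<open>r = s\<close> for \<open>(r, s) \<in> R\<close>.
\<close>

inductive_set word_cong :: "'s set \<Rightarrow> ('s word \<times> 's word) set \<Rightarrow> ('s word \<times> 's word) set"
  for S :: "'s set" and R :: "('s word \<times> 's word) set"
where
  refl: "w \<in> words S \<Longrightarrow> (w, w) \<in> word_cong S R"
| sym: "(u, v) \<in> word_cong S R \<Longrightarrow> (v, u) \<in> word_cong S R"
| trans: "\<lbrakk>(u, v) \<in> word_cong S R; (v, w) \<in> word_cong S R\<rbrakk> \<Longrightarrow> (u, w) \<in> word_cong S R"
| cancel: "\<lbrakk>u \<in> words S; v \<in> words S; x \<in> S\<rbrakk>
    \<Longrightarrow> (u @ [(x, b), (x, \<not> b)] @ v, u @ v) \<in> word_cong S R"
| relation: "\<lbrakk>u \<in> words S; v \<in> words S; (r, s) \<in> R; r \<in> words S; s \<in> words S\<rbrakk>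
    \<Longrightarrow> (u @ r @ v, u @ s @ v) \<in> word_cong S R"

definition presented_group :: "'s set \<Rightarrow> ('s word \<times> 's word) set \<Rightarrow> 's word set monoid"
  where "presented_group S R =
    \<lparr>carrier = words S // word_cong S R,
     monoid.mult = (\<lambda>A B. \<Union>p\<in>A. \<Union>q\<in>B. word_cong S R `` {p @ q}),
     one = word_cong S R `` {[]}\<rparr>"

definition free_group :: "'s set \<Rightarrow> 's word set monoid"
  where "free_group S = presented_group S {}"

text \<open>
  A basis of \<open>K\<close> is a subset of \<open>carrier K\<close>, so it is no restriction to take the
  generating set in the element type of \<open>K\<close>.
\<close>

definition is_free_group :: "('a, 'b) monoid_scheme \<Rightarrow> bool"
  where "is_free_group K \<longleftrightarrow> (\<exists>S :: 'a set. free_group S \<cong> K)"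

lemma words_simps [simp]:
  "[] \<in> words S"
  "a # w \<in> words S \<longleftrightarrow> fst a \<in> S \<and> w \<in> words S"
  "u @ v \<in> words S \<longleftrightarrow> u \<in> words S \<and> v \<in> words S"
  by (cases a; auto simp: words_def)+

lemma word_cong_words:
  "(u, v) \<in> word_cong S R \<Longrightarrow> u \<in> words S \<and> v \<in> words S"
  by (induction rule: word_cong.induct) auto

lemma equiv_word_cong: "equiv (words S) (word_cong S R)"
proof (rule equivI)
  show "word_cong S R \<subseteq> words S \<times> words S" using word_cong_words by auto
  show "refl_on (words S) (word_cong S R)" by (auto intro: refl_onI word_cong.refl)
  show "sym (word_cong S R)" by (rule symI) (rule word_cong.sym)
  show "trans (word_cong S R)" by (rule transI) (rule word_cong.trans)
qed

lemma word_cong_ctxt: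
  assumes "(u, v) \<in> word_cong S R" "p \<in> words S" "q \<in> words S"
  shows "(p @ u @ q, p @ v @ q) \<in> word_cong S R"
  using assms
proof (induction rule: word_cong.induct)
  case (cancel u v x b)
  then show ?case
    using word_cong.cancel[of "p @ u" S "v @ q" x b R] by simp
next
  case (relation u v r s)
  then show ?case
    using word_cong.relation[of "p @ u" S "v @ q" r s R] by simp
next
  case (trans u v w)
  then show ?case by (meson word_cong.trans)
qed (auto intro: word_cong.refl word_cong.sym)

lemma word_cong_append:
  assumes "(u, u') \<in> word_cong S R" "(v, v') \<in> word_cong S R"
  shows "(u @ v, u' @ v') \<in> word_cong S R"
proof (rule word_cong.trans)
  show "(u @ v, u' @ v) \<in> word_cong S R"
    using word_cong_ctxt[OF assms(1), of "[]" v] word_cong_words[OF assms(2)] by simp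
  show "(u' @ v, u' @ v') \<in> word_cong S R"
    using word_cong_ctxt[OF assms(2), of u' "[]"] word_cong_words[OF assms(1)] by simp
qed

lemma word_cong_class_eq:
  "\<lbrakk>u \<in> words S; v \<in> words S\<rbrakk>
    \<Longrightarrow> word_cong S R `` {u} = word_cong S R `` {v} \<longleftrightarrow> (u, v) \<in> word_cong S R"
  by (rule eq_equiv_class_iff[OF equiv_word_cong])

lemma presented_group_mult:
  assumes "u \<in> words S" "v \<in> words S"
  shows "word_cong S R `` {u} \<otimes>\<^bsub>presented_group S R\<^esub> word_cong S R `` {v}
    = word_cong S R `` {u @ v}"
proof -
  have "word_cong S R `` {p @ q} = word_cong S R `` {u @ v}"
    if "p \<in> word_cong S R `` {u}" "q \<in> word_cong S R `` {v}" for p q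
    using that by (intro equiv_class_eq[OF equiv_word_cong] word_cong.sym[OF word_cong_append]) auto
  moreover have "u \<in> word_cong S R `` {u}" "v \<in> word_cong S R `` {v}"
    using assms by (auto intro: word_cong.refl)
  ultimately have "(\<Union>p\<in>word_cong S R `` {u}. \<Union>q\<in>word_cong S R `` {v}. word_cong S R `` {p @ q})
    = word_cong S R `` {u @ v}"
    by blast
  then show ?thesis
    by (simp add: presented_group_def)
qed

lemma word_cong_inverse:
  "w \<in> words S \<Longrightarrow> (rev (map (\<lambda>(x, b). (x, \<not> b)) w) @ w, []) \<in> word_cong S R
    \<and> rev (map (\<lambda>(x, b). (x, \<not> b)) w) \<in> words S"
proof (induction w)
  case Nil
  then show ?case by (simp add: word_cong.refl)
next
  case (Cons a w)
  obtain x b where a: "a = (x, b)" by force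
  let ?i = "rev (map (\<lambda>(x, b). (x, \<not> b)) w)"
  have w: "w \<in> words S" "x \<in> S" using Cons.prems a by auto
  then have i: "(?i @ w, []) \<in> word_cong S R" "?i \<in> words S" using Cons.IH by blast+
  have "(?i @ [(x, \<not> b), (x, \<not> \<not> b)] @ w, ?i @ w) \<in> word_cong S R"
    by (rule word_cong.cancel) (use w i in blast)+
  then have "(?i @ [(x, \<not> b), (x, \<not> \<not> b)] @ w, []) \<in> word_cong S R"
    using i(1) by (rule word_cong.trans)
  moreover have "[(x, \<not> b)] \<in> words S" using w by simp
  ultimately show ?case
    using i(2) by (simp add: a)
qed

theorem group_presented_group: "group (presented_group S R)"
proof -
  let ?P = "presented_group S R"
  let ?c = "\<lambda>u. word_cong S R `` {u}"
  have carr: "A \<in> carrier ?P \<longleftrightarrow> (\<exists>w\<in>words S. A = ?c w)" for A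
    by (simp add: presented_group_def quotient_def Bex_def)
  have one: "\<one>\<^bsub>?P\<^esub> = ?c []" by (simp add: presented_group_def)
  have inv: "\<exists>B\<in>carrier ?P. B \<otimes>\<^bsub>?P\<^esub> A = \<one>\<^bsub>?P\<^esub>" if A: "A \<in> carrier ?P" for A
  proof -
    obtain w where w: "w \<in> words S" "A = ?c w" using A unfolding carr by blast
    let ?i = "rev (map (\<lambda>(x, b). (x, \<not> b)) w)"
    have i: "(?i @ w, []) \<in> word_cong S R" "?i \<in> words S"
      using word_cong_inverse[OF w(1)] by blast+
    have "?c ?i \<otimes>\<^bsub>?P\<^esub> A = ?c (?i @ w)"
      unfolding w(2) by (rule presented_group_mult[OF i(2) w(1)])
    also have "\<dots> = \<one>\<^bsub>?P\<^esub>"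
      unfolding one by (rule equiv_class_eq[OF equiv_word_cong i(1)])
    finally have "?c ?i \<otimes>\<^bsub>?P\<^esub> A = \<one>\<^bsub>?P\<^esub>" .
    moreover have "?c ?i \<in> carrier ?P" unfolding carr by (rule bexI[OF HOL.refl i(2)])
    ultimately show ?thesis by (rule bexI)
  qed
  show ?thesis
  proof (rule groupI)
    fix A B assume "A \<in> carrier ?P" "B \<in> carrier ?P"
    then obtain u v where uv: "u \<in> words S" "A = ?c u" "v \<in> words S" "B = ?c v"
      unfolding carr by blast
    have "A \<otimes>\<^bsub>?P\<^esub> B = ?c (u @ v)"
      unfolding uv by (rule presented_group_mult[OF uv(1,3)])
    moreover have "u @ v \<in> words S" using uv(1,3) by simp
    ultimately show "A \<otimes>\<^bsub>?P\<^esub> B \<in> carrier ?P" unfolding carr by (rule bexI)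
  next
    show "\<one>\<^bsub>?P\<^esub> \<in> carrier ?P" unfolding carr one by (rule bexI[OF HOL.refl words_simps(1)])
  next
    fix A B C assume "A \<in> carrier ?P" "B \<in> carrier ?P" "C \<in> carrier ?P"
    then obtain u v w where uvw: "u \<in> words S" "A = ?c u" "v \<in> words S" "B = ?c v"
        "w \<in> words S" "C = ?c w"
      unfolding carr by blast
    show "A \<otimes>\<^bsub>?P\<^esub> B \<otimes>\<^bsub>?P\<^esub> C = A \<otimes>\<^bsub>?P\<^esub> (B \<otimes>\<^bsub>?P\<^esub> C)"
      unfolding uvw(2,4,6) using uvw(1,3,5) by (simp only: presented_group_mult words_simps append_assoc)
  next
    fix A assume "A \<in> carrier ?P"
    then obtain u where u: "u \<in> words S" "A = ?c u"
      unfolding carr by blast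
    show "\<one>\<^bsub>?P\<^esub> \<otimes>\<^bsub>?P\<^esub> A = A"
      unfolding u(2) one using u(1) by (simp only: presented_group_mult words_simps append_Nil)
  qed (rule inv)
qed


section \<open>Baumslag--Solitar groups\<close>

datatype bs_gen = BS_a | BS_t

definition gen_pow :: "'s \<Rightarrow> int \<Rightarrow> 's word"
  where "gen_pow x k = replicate (nat \<bar>k\<bar>) (x, 0 \<le> k)"

definition BS :: "int \<Rightarrow> int \<Rightarrow> bs_gen word set monoid"
  where "BS m n = presented_group {BS_a, BS_t}
    {(gen_pow BS_t 1 @ gen_pow BS_a m @ gen_pow BS_t (- 1), gen_pow BS_a n)}"


section \<open>Quotients and large groups\<close>

definition is_quotient_of :: "('a, 'b) monoid_scheme \<Rightarrow> ('c, 'd) monoid_scheme \<Rightarrow> bool"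
  where "is_quotient_of Q K \<longleftrightarrow> (\<exists>N. N \<lhd> K \<and> K Mod N \<cong> Q)"

definition large_group :: "('a, 'b) monoid_scheme \<Rightarrow> bool"
  where "large_group G \<longleftrightarrow>
    (\<exists>H. subgroup H G \<and> finite (rcosets\<^bsub>G\<^esub> H) \<and>
      (\<exists>N. N \<lhd> G\<lparr>carrier := H\<rparr> \<and>
        is_free_group (G\<lparr>carrier := H\<rparr> Mod N) \<and>
        \<not> comm_group (G\<lparr>carrier := H\<rparr> Mod N)))"


section \<open>Trees and generalized Baumslag--Solitar groups\<close>

text \<open>
  Undirected graphs with vertex set \<open>V\<close>, an edge being the set of its two endpoints.
  Loops and multiple edges, which are cycles, cannot occur in a tree.
\<close>

definition is_tree :: "'v set \<Rightarrow> 'v set set \<Rightarrow> bool"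
  where "is_tree V E \<longleftrightarrow>
    V \<noteq> {} \<and>
    E \<subseteq> {{x, y} | x y. x \<in> V \<and> y \<in> V \<and> x \<noteq> y} \<and>
    (\<forall>x\<in>V. \<forall>y\<in>V. (x, y) \<in> {(u, v). {u, v} \<in> E}\<^sup>*) \<and>
    \<not> (\<exists>c. 3 \<le> length c \<and> distinct c \<and>
        (\<forall>i<length c. {c ! i, c ! (Suc i mod length c)} \<in> E))"

definition acts_on_tree_without_inversions ::
    "('a, 'b) monoid_scheme \<Rightarrow> 'v set \<Rightarrow> 'v set set \<Rightarrow> ('a \<Rightarrow> 'v \<Rightarrow> 'v) \<Rightarrow> bool"
  where "acts_on_tree_without_inversions G V E \<phi> \<longleftrightarrow>
    is_tree V E \<and> group_action G V \<phi> \<and>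
    (\<forall>g\<in>carrier G. \<forall>e\<in>E. \<phi> g ` e \<in> E) \<and>
    \<not> (\<exists>g\<in>carrier G. \<exists>x y. {x, y} \<in> E \<and> \<phi> g x = y \<and> \<phi> g y = x)"

definition infinite_cyclic_subgroup :: "'a set \<Rightarrow> ('a, 'b) monoid_scheme \<Rightarrow> bool"
  where "infinite_cyclic_subgroup H G \<longleftrightarrow>
    subgroup H G \<and> G\<lparr>carrier := H\<rparr> \<cong> integer_group"

definition finitely_generated_group :: "('a, 'b) monoid_scheme \<Rightarrow> bool"
  where "finitely_generated_group G \<longleftrightarrow>
    group G \<and> (\<exists>A. finite A \<and> A \<subseteq> carrier G \<and> generate G A = carrier G)"

text \<open>
  The type argument is the vertex type of the tree, since a definition cannot quantify over
  types. It is unconstrained, so a theorem about \<open>GBS_group TYPE('v) G\<close> with \<open>'v\<close> a type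
  variable covers all trees.
\<close>

definition GBS_group :: "'v itself \<Rightarrow> ('a, 'b) monoid_scheme \<Rightarrow> bool"
  where "GBS_group _ G \<longleftrightarrow>
    finitely_generated_group G \<and>
    (\<exists>(V :: 'v set) E \<phi>.
      acts_on_tree_without_inversions G V E \<phi> \<and>
      (\<forall>x\<in>V. infinite_cyclic_subgroup (stabilizer G \<phi> x) G) \<and>
      (\<forall>e\<in>E. infinite_cyclic_subgroup (stabilizer G (\<lambda>g. image (\<phi> g)) e) G))"

end

theory Submission
  imports Defs "HOL-Algebra.Sym_Groups"
begin

text \<open>
  If \<open>m\<close> and \<open>n\<close> are coprime, then in every finite quotient of \<open>BS m n\<close> the cyclic group generated by
  \<open>a\<close> is normal. So all finite quotients of a quotient of \<open>BS m n\<close> are metabelian, whereas a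
  nonabelian free group has finite quotients that are not.

  Conversely, let \<open>G\<close> act on a tree with infinite cyclic stabilizers and finite quotient graph. The
  kernel \<open>H\<close> of a homomorphism from \<open>G\<close> onto a finite cyclic group maps onto the free fundamental
  group of the quotient graph of the tree by \<open>H\<close>, so \<open>G\<close> is large as soon as this graph has more edges
  than vertices. The homomorphisms that are trivial on stable letters are the solutions of linear
  congruences between the edge labels, and the edge and vertex orbits of \<open>H\<close> are counted by gcds. If
  no such homomorphism exists, then the quotient graph of \<open>G\<close> has first Betti number at most one. If
  it is a tree, adding one leaf after another shows that \<open>G\<close> is cyclic or a quotient of the Klein
  bottle group. If it contains a circuit, then \<open>G\<close> is generated by the stabilizer of a vertex on the
  circuit and a stable letter, and going around the circuit gives the coprime relation.
\<close>

section \<open>Evaluation of words\<close>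

text \<open>The metabelian law of the first half holds only modulo finite index subgroups:
  \<open>BS 2 3\<close> contains nonabelian free subgroups and is not residually finite, so no such
  law can be proved in the group itself. On the free side the test group is S4, because S3 is still
  metabelian.

  The second half does not use the presentation of \<open>G\<close> as the fundamental group of a
  graph of groups. Its place is taken by the simple connectivity of a tree: a labelling of the
  oriented edges is the coboundary of a function on the vertices. This is applied twice, to map a
  group onto a free group and to build homomorphisms to the integers modulo N from values on vertex
  stabilizers.

  A free group of rank two is enough for largeness, so the search is for a modulus whose kernel has
  more edge orbits than vertex orbits. With one circuit, prime moduli suffice. In a tree, two
  generators with x^l = y^k behave as in a torus knot group and call for the modulus |l k|; among
  labels of absolute value at least 2 only |l| = |k| = 2 escapes, and this is where the Klein bottle
  group comes from.\<close>

fun word_eval :: "('a, 'b) monoid_scheme \<Rightarrow> ('s \<Rightarrow> 'a) \<Rightarrow> 's word \<Rightarrow> 'a" where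
  "word_eval K f [] = \<one>\<^bsub>K\<^esub>"
| "word_eval K f ((x, b) # w) = (if b then f x else inv\<^bsub>K\<^esub> f x) \<otimes>\<^bsub>K\<^esub> word_eval K f w"

lemma word_eval_closed:
  assumes "group K" "f \<in> S \<rightarrow> carrier K" "w \<in> words S"
  shows "word_eval K f w \<in> carrier K"
  using assms(3)
proof (induction w)
  case (Cons a w)
  interpret group K by (rule assms(1))
  show ?case using Cons assms(2) by (cases a) (auto dest: funcset_mem)
qed (simp add: assms(1) group.is_monoid)

lemma word_eval_append:
  assumes "group K" "f \<in> S \<rightarrow> carrier K" "u \<in> words S" "v \<in> words S"
  shows "word_eval K f (u @ v) = word_eval K f u \<otimes>\<^bsub>K\<^esub> word_eval K f v"
  using assms(3)
proof (induction u)
  case Nil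
  interpret group K by (rule assms(1))
  show ?case using word_eval_closed[OF assms(1,2,4)] by simp
next
  case (Cons a u)
  interpret group K by (rule assms(1))
  obtain x b where a: "a = (x, b)" by force
  then have x: "f x \<in> carrier K" "u \<in> words S" using Cons.prems assms(2) by auto
  have u: "word_eval K f u \<in> carrier K" by (rule word_eval_closed[OF assms(1,2) x(2)])
  have v: "word_eval K f v \<in> carrier K" by (rule word_eval_closed[OF assms(1,2,4)])
  show ?case using Cons.IH[OF x(2)] x(1) u v by (simp add: a m_assoc)
qed

lemma word_eval_word_cong:
  assumes "group K" "f \<in> S \<rightarrow> carrier K"
    and "\<forall>(r, s)\<in>R. word_eval K f r = word_eval K f s"
    and "(u, v) \<in> word_cong S R"
  shows "word_eval K f u = word_eval K f v"
  using assms(4)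
proof (induction rule: word_cong.induct)
  case (cancel u v x b)
  interpret group K by (rule assms(1))
  have x: "f x \<in> carrier K" by (rule funcset_mem[OF assms(2) cancel(3)])
  have "word_eval K f (u @ [(x, b), (x, \<not> b)] @ v) = word_eval K f u \<otimes>\<^bsub>K\<^esub> word_eval K f ([(x, b), (x, \<not> b)] @ v)"
    by (rule word_eval_append[OF assms(1,2)]) (use cancel in auto)
  also have "word_eval K f ([(x, b), (x, \<not> b)] @ v) = word_eval K f v"
    using x word_eval_closed[OF assms(1,2) cancel(2)] by (auto simp: m_assoc[symmetric])
  also have "word_eval K f u \<otimes>\<^bsub>K\<^esub> word_eval K f v = word_eval K f (u @ v)"
    by (rule word_eval_append[OF assms(1,2) cancel(1,2), symmetric])
  finally show ?case .
next
  case (relation u v r s)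
  have "word_eval K f r = word_eval K f s" using assms(3) relation(3) by blast
  then show ?case
    using relation by (simp add: word_eval_append[OF assms(1,2)])
qed simp_all

definition word_class :: "'s set \<Rightarrow> ('s word \<times> 's word) set \<Rightarrow> 's word \<Rightarrow> 's word set"
  where "word_class S R w = word_cong S R `` {w}"

lemma carrier_presented_group: "carrier (presented_group S R) = word_class S R ` words S"
  by (auto simp: presented_group_def quotient_def word_class_def)

lemma word_class_mult:
  "u \<in> words S \<Longrightarrow> v \<in> words S \<Longrightarrow>
    word_class S R u \<otimes>\<^bsub>presented_group S R\<^esub> word_class S R v = word_class S R (u @ v)"
  by (simp add: word_class_def presented_group_mult)

lemma word_class_Nil: "word_class S R [] = \<one>\<^bsub>presented_group S R\<^esub>"
  by (simp add: word_class_def presented_group_def)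

lemma word_class_eq_iff:
  "u \<in> words S \<Longrightarrow> v \<in> words S \<Longrightarrow> word_class S R u = word_class S R v \<longleftrightarrow> (u, v) \<in> word_cong S R"
  by (simp add: word_class_def word_cong_class_eq)

text \<open>Von Dyck's theorem. Evaluation is constant on congruence classes, so the word chosen by
  \<open>SOME\<close> in each class does not matter.\<close>

lemma presented_group_universal:
  assumes "group K" "f \<in> S \<rightarrow> carrier K"
    and "\<forall>(r, s)\<in>R. word_eval K f r = word_eval K f s"
  obtains h where "h \<in> hom (presented_group S R) K"
    "\<And>w. w \<in> words S \<Longrightarrow> h (word_class S R w) = word_eval K f w"
proof -
  define h where "h A = word_eval K f (SOME w. w \<in> words S \<and> A = word_class S R w)" for A
  have h: "h (word_class S R w) = word_eval K f w" if w: "w \<in> words S" for w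
  proof -
    let ?v = "SOME v. v \<in> words S \<and> word_class S R w = word_class S R v"
    have "?v \<in> words S \<and> word_class S R w = word_class S R ?v"
      by (rule someI[of _ w]) (use w in simp)
    then have "(w, ?v) \<in> word_cong S R" using word_class_eq_iff w by blast
    then have "word_eval K f w = word_eval K f ?v"
      by (rule word_eval_word_cong[OF assms(1,2) assms(3)])
    then show ?thesis unfolding h_def by (rule HOL.sym)
  qed
  show ?thesis
  proof (rule that[OF _ h])
    show "h \<in> hom (presented_group S R) K"
    proof (rule homI)
      fix A assume "A \<in> carrier (presented_group S R)"
      then obtain u where u: "u \<in> words S" "A = word_class S R u"
        unfolding carrier_presented_group by blast
      then show "h A \<in> carrier K" using h word_eval_closed[OF assms(1,2)] by simp
      fix B assume "B \<in> carrier (presented_group S R)"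
      then obtain v where v: "v \<in> words S" "B = word_class S R v"
        unfolding carrier_presented_group by blast
      show "h (A \<otimes>\<^bsub>presented_group S R\<^esub> B) = h A \<otimes>\<^bsub>K\<^esub> h B"
        unfolding u(2) v(2) word_class_mult[OF u(1) v(1)]
        using u(1) v(1) by (simp add: h word_eval_append[OF assms(1,2)])
    qed
  qed
qed

text \<open>Together with \<open>word_eval_in_subgroup\<close> this says that the classes of the
  single letters generate the presented group.\<close>

lemma word_eval_cls_generators:
  assumes "w \<in> words S"
  shows "word_eval (presented_group S R) (\<lambda>x. word_class S R [(x, True)]) w = word_class S R w"
proof -
  let ?P = "presented_group S R"
  interpret group ?P by (rule group_presented_group)
  have gen: "word_class S R [(x, True)] \<in> carrier ?P" if "x \<in> S" for x
    using that by (auto simp: carrier_presented_group)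
  have inv: "inv\<^bsub>?P\<^esub> word_class S R [(x, True)] = word_class S R [(x, False)]" if "x \<in> S" for x
  proof (rule inv_equality)
    have "([] @ [(x, False), (x, \<not> False)] @ [], [] @ []) \<in> word_cong S R"
      by (rule word_cong.cancel) (use that in auto)
    then have "word_class S R [(x, False), (x, True)] = word_class S R []"
      using that by (subst word_class_eq_iff) auto
    then show "word_class S R [(x, False)] \<otimes>\<^bsub>?P\<^esub> word_class S R [(x, True)] = \<one>\<^bsub>?P\<^esub>"
      using that by (simp add: word_class_mult word_class_Nil)
  qed (use that in \<open>auto simp: carrier_presented_group\<close>)
  show ?thesis using assms
  proof (induction w)
    case (Cons a w)
    obtain x b where a: "a = (x, b)" by force
    with Cons show ?case by (cases b) (auto simp: inv word_class_mult)
  qed (simp add: word_class_Nil)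
qed

lemma word_eval_in_subgroup:
  assumes "group K" "subgroup J K" "f \<in> S \<rightarrow> J" "w \<in> words S"
  shows "word_eval K f w \<in> J"
  using assms(4)
proof (induction w)
  case (Cons a w)
  obtain x b where a: "a = (x, b)" by force
  have "f x \<in> J" using Cons.prems funcset_mem[OF assms(3)] a by simp
  then have "inv\<^bsub>K\<^esub> f x \<in> J" by (rule subgroup.m_inv_closed[OF assms(2)])
  with \<open>f x \<in> J\<close> show ?case
    using Cons subgroup.m_closed[OF assms(2)] by (simp add: a)
qed (simp add: assms subgroup.one_closed)

lemma word_eval_gen_pow:
  assumes "group K" "f x \<in> carrier K"
  shows "word_eval K f (gen_pow x k) = f x [^]\<^bsub>K\<^esub> k"
proof -
  interpret group K by (rule assms(1))
  have c: "word_eval K f (replicate n (x, b)) = (if b then f x else inv\<^bsub>K\<^esub> f x) [^]\<^bsub>K\<^esub> n" for n b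
  proof (induction n)
    case (Suc n)
    then show ?case
      using assms(2) nat_pow_Suc2[of "f x" n] nat_pow_Suc2[of "inv\<^bsub>K\<^esub> f x" n] by simp
  qed simp
  show ?thesis
  proof (cases "0 \<le> k")
    case True
    then show ?thesis by (simp add: gen_pow_def c)
  next
    case False
    then show ?thesis using assms(2) by (simp add: gen_pow_def c int_pow_def2 nat_pow_inv del: pow_nat)
  qed
qed

lemma gen_pow_words: "x \<in> S \<Longrightarrow> gen_pow x k \<in> words S"
  by (auto simp: gen_pow_def words_def)

section \<open>Quotients as surjective images, and quotients of Baumslag-Solitar groups as pairs of
  generators\<close>

lemma is_quotient_of_iff_surj_hom:
  assumes "group Q" "group K"
  shows "is_quotient_of Q K \<longleftrightarrow> (\<exists>h\<in>hom K Q. h ` carrier K = carrier Q)"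
proof
  assume "is_quotient_of Q K"
  then obtain N \<psi> where N: "N \<lhd> K" and \<psi>: "\<psi> \<in> iso (K Mod N) Q"
    by (auto simp: is_quotient_of_def is_iso_def)
  have "(\<lambda>a. N #>\<^bsub>K\<^esub> a) \<in> hom K (K Mod N)"
    using N by (rule normal.r_coset_hom_Mod)
  then have "\<psi> \<circ> (\<lambda>a. N #>\<^bsub>K\<^esub> a) \<in> hom K Q"
    using \<psi> by (intro hom_compose) (auto simp: iso_def)
  moreover have "(\<psi> \<circ> (\<lambda>a. N #>\<^bsub>K\<^esub> a)) ` carrier K = carrier Q"
    using \<psi> by (auto simp: iso_def bij_betw_def carrier_FactGroup image_comp)
  ultimately show "\<exists>h\<in>hom K Q. h ` carrier K = carrier Q" by blast
next
  assume "\<exists>h\<in>hom K Q. h ` carrier K = carrier Q"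
  then obtain h where h: "h \<in> hom K Q" "h ` carrier K = carrier Q" by blast
  interpret group_hom K Q h using assms h by (simp add: group_hom_def group_hom_axioms_def)
  show "is_quotient_of Q K"
    unfolding is_quotient_of_def using normal_kernel FactGroup_iso[OF h(2)] by blast
qed

text \<open>One direction takes the images of the two letters, the other is von Dyck's theorem. From
  here on \<open>BS m n\<close> enters only through such a pair of generators.\<close>

lemma (in group) quotient_of_BS_iff:
  "is_quotient_of G (BS m n) \<longleftrightarrow>
    (\<exists>a\<in>carrier G. \<exists>t\<in>carrier G. generate G {a, t} = carrier G \<and>
      t \<otimes> a [^] m \<otimes> inv t = a [^] n)"
proof -
  let ?S = "{BS_a, BS_t}"
  let ?r = "gen_pow BS_t 1 @ gen_pow BS_a m @ gen_pow BS_t (- 1)"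
  let ?R = "{(?r, gen_pow BS_a n)}"
  have r: "?r \<in> words ?S" "gen_pow BS_a n \<in> words ?S" by (auto simp: gen_pow_words)
  have word_eval_r: "word_eval K f ?r = f BS_t \<otimes>\<^bsub>K\<^esub> f BS_a [^]\<^bsub>K\<^esub> m \<otimes>\<^bsub>K\<^esub> inv\<^bsub>K\<^esub> f BS_t"
    if K: "group K" and f: "f \<in> ?S \<rightarrow> carrier K" for f and K :: "('k, 'l) monoid_scheme"
  proof -
    interpret K: group K by (rule K)
    have f': "f BS_a \<in> carrier K" "f BS_t \<in> carrier K" using f by auto
    show ?thesis
      using f' by (simp add: word_eval_append[OF K f] gen_pow_words word_eval_gen_pow[OF K] K.m_assoc K.int_pow_neg)
  qed
  have BS: "BS m n = presented_group ?S ?R" by (simp add: BS_def)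
  have gBS: "group (BS m n)" unfolding BS by (rule group_presented_group)
  have grp: "group G" by unfold_locales
  show ?thesis
    unfolding is_quotient_of_iff_surj_hom[OF grp gBS]
  proof
    assume "\<exists>h\<in>hom (BS m n) G. h ` carrier (BS m n) = carrier G"
    then obtain h where h: "h \<in> hom (BS m n) G" "h ` carrier (BS m n) = carrier G" by blast
    interpret h: group_hom "BS m n" G h
      using gBS grp h by (simp add: group_hom_def group_hom_axioms_def)
    let ?g = "\<lambda>x. word_class ?S ?R [(x, True)]"
    let ?a = "?g BS_a" and ?t = "?g BS_t"
    have g: "?g \<in> ?S \<rightarrow> carrier (BS m n)"
      unfolding BS carrier_presented_group by auto
    have ac: "?a \<in> carrier (BS m n)" "?t \<in> carrier (BS m n)" using g by auto
    have "(?r, gen_pow BS_a n) \<in> word_cong ?S ?R"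
      using word_cong.relation[of "[]" ?S "[]" ?r "gen_pow BS_a n" ?R] r by simp
    then have "word_class ?S ?R ?r = word_class ?S ?R (gen_pow BS_a n)" using r word_class_eq_iff by blast
    then have "word_eval (BS m n) ?g ?r = word_eval (BS m n) ?g (gen_pow BS_a n)"
      unfolding BS using r by (simp only: word_eval_cls_generators)
    then have "?t \<otimes>\<^bsub>BS m n\<^esub> ?a [^]\<^bsub>BS m n\<^esub> m \<otimes>\<^bsub>BS m n\<^esub> inv\<^bsub>BS m n\<^esub> ?t = ?a [^]\<^bsub>BS m n\<^esub> n"
      using ac by (simp only: word_eval_r[OF gBS g] word_eval_gen_pow[OF gBS])
    then have "h (?t \<otimes>\<^bsub>BS m n\<^esub> ?a [^]\<^bsub>BS m n\<^esub> m \<otimes>\<^bsub>BS m n\<^esub> inv\<^bsub>BS m n\<^esub> ?t) = h (?a [^]\<^bsub>BS m n\<^esub> n)" by simp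
    then have rel: "h ?t \<otimes> h ?a [^] m \<otimes> inv h ?t = h ?a [^] n"
      using ac by (simp add: h.hom_int_pow)
    have gen: "carrier G \<subseteq> generate G {h ?a, h ?t}"
    proof
      fix x assume "x \<in> carrier G"
      then obtain w where w: "w \<in> words ?S" "x = h (word_class ?S ?R w)"
        using h(2) unfolding BS carrier_presented_group by auto
      have "word_class ?S ?R w \<in> generate (BS m n) {?a, ?t}"
        unfolding word_eval_cls_generators[OF w(1), symmetric, of ?R] BS[symmetric]
        by (rule word_eval_in_subgroup[OF gBS group.generate_is_subgroup[OF gBS] _ w(1)])
          (use ac in \<open>auto intro: generate.incl\<close>)
      then show "x \<in> generate G {h ?a, h ?t}"
        using h.generate_img[of "{?a, ?t}"] ac w(2) by auto
    qed
    have hac: "h ?a \<in> carrier G" "h ?t \<in> carrier G" using ac by simp_all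
    have "generate G {h ?a, h ?t} = carrier G"
      using gen generate_incl[of "{h ?a, h ?t}"] hac by blast
    then show "\<exists>a\<in>carrier G. \<exists>t\<in>carrier G. generate G {a, t} = carrier G \<and>
      t \<otimes> a [^] m \<otimes> inv t = a [^] n" using rel hac by blast
  next
    assume "\<exists>a\<in>carrier G. \<exists>t\<in>carrier G. generate G {a, t} = carrier G \<and>
      t \<otimes> a [^] m \<otimes> inv t = a [^] n"
    then obtain a t where at: "a \<in> carrier G" "t \<in> carrier G" "generate G {a, t} = carrier G"
      "t \<otimes> a [^] m \<otimes> inv t = a [^] n" by blast
    define f where "f x = (case x of BS_a \<Rightarrow> a | BS_t \<Rightarrow> t)" for x
    have f: "f \<in> ?S \<rightarrow> carrier G" "f BS_a = a" "f BS_t = t" using at by (auto simp: f_def)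
    obtain h where h: "h \<in> hom (presented_group ?S ?R) G"
      "\<And>w. w \<in> words ?S \<Longrightarrow> h (word_class ?S ?R w) = word_eval G f w"
    proof (rule presented_group_universal[OF grp f(1), of ?R])
      show "\<forall>(r, s)\<in>?R. word_eval G f r = word_eval G f s"
        using word_eval_r[OF grp f(1)] word_eval_gen_pow[OF grp, of f BS_a n] at f by simp
    qed (rule that)
    interpret h: group_hom "BS m n" G h
      using gBS grp h(1) by (simp add: BS group_hom_def group_hom_axioms_def)
    have "h ` carrier (BS m n) = carrier G"
    proof
      have "h (word_class ?S ?R [(x, True)]) = f x" if "x \<in> ?S" for x
        using h(2)[of "[(x, True)]"] that f at by auto
      then have "a = h (word_class ?S ?R [(BS_a, True)])" "t = h (word_class ?S ?R [(BS_t, True)])"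
        using f by simp_all
      moreover have "word_class ?S ?R [(x, True)] \<in> carrier (BS m n)" if "x \<in> ?S" for x
        using that unfolding BS carrier_presented_group by auto
      ultimately have "{a, t} \<subseteq> h ` carrier (BS m n)" by blast
      then show "carrier G \<subseteq> h ` carrier (BS m n)"
        using generate_subgroup_incl[OF _ h.img_is_subgroup] at(3) by blast
    qed auto
    then show "\<exists>h\<in>hom (BS m n) G. h ` carrier (BS m n) = carrier G"
      using h(1) unfolding BS by blast
  qed
qed

lemma (in group) quotient_of_BSI:
  fixes m n :: int
  assumes "u \<in> carrier G" "t \<in> carrier G" "generate G {u, t} = carrier G"
    and "t \<otimes> u [^] m \<otimes> inv t = u [^] n"
  shows "is_quotient_of G (BS m n)"
  unfolding quotient_of_BS_iff using assms by blast

section \<open>Finite quotients of Baumslag--Solitar groups\<close>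

definition commutator :: "('a, 'b) monoid_scheme \<Rightarrow> 'a \<Rightarrow> 'a \<Rightarrow> 'a"
  where "commutator G x y = x \<otimes>\<^bsub>G\<^esub> y \<otimes>\<^bsub>G\<^esub> inv\<^bsub>G\<^esub> x \<otimes>\<^bsub>G\<^esub> inv\<^bsub>G\<^esub> y"

lemma (in group) mult_inv_cancel:
  assumes "x \<in> carrier G" "y \<in> carrier G"
  shows "x \<otimes> (inv x \<otimes> y) = y" "inv x \<otimes> (x \<otimes> y) = y"
  using assms by (simp_all add: m_assoc[symmetric])

lemma (in group) commutator_closed:
  "x \<in> carrier G \<Longrightarrow> y \<in> carrier G \<Longrightarrow> commutator G x y \<in> carrier G"
  by (simp add: commutator_def)

lemma (in group_hom) hom_commutator:
  "x \<in> carrier G \<Longrightarrow> y \<in> carrier G \<Longrightarrow> h (commutator G x y) = commutator H (h x) (h y)"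
  by (simp add: commutator_def)

lemma (in group) commutator_eq_one_iff:
  assumes "x \<in> carrier G" "y \<in> carrier G"
  shows "commutator G x y = \<one> \<longleftrightarrow> x \<otimes> y = y \<otimes> x"
proof -
  have "commutator G x y = (x \<otimes> y) \<otimes> inv (y \<otimes> x)"
    using assms by (simp add: commutator_def inv_mult_group m_assoc)
  then show ?thesis using assms
    by (metis inv_closed m_closed inv_equality inv_inv r_inv)
qed

lemma (in group) centralizer_subgroup:
  assumes "A \<subseteq> carrier G"
  shows "subgroup {g \<in> carrier G. \<forall>a\<in>A. g \<otimes> a = a \<otimes> g} G"
proof (rule subgroupI)
  fix g assume g: "g \<in> {g \<in> carrier G. \<forall>a\<in>A. g \<otimes> a = a \<otimes> g}"
  have "inv g \<otimes> a = a \<otimes> inv g" if "a \<in> A" for a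
  proof -
    have a: "a \<in> carrier G" "g \<otimes> a = a \<otimes> g" "g \<in> carrier G" using that assms g by auto
    have "inv g \<otimes> (g \<otimes> a) \<otimes> inv g = inv g \<otimes> (a \<otimes> g) \<otimes> inv g" using a by simp
    then show ?thesis using a(1,3) by (simp add: m_assoc mult_inv_cancel)
  qed
  with g show "inv g \<in> {g \<in> carrier G. \<forall>a\<in>A. g \<otimes> a = a \<otimes> g}" by auto
next
  fix g h assume gh: "g \<in> {g \<in> carrier G. \<forall>a\<in>A. g \<otimes> a = a \<otimes> g}"
    "h \<in> {g \<in> carrier G. \<forall>a\<in>A. g \<otimes> a = a \<otimes> g}"
  have "g \<otimes> h \<otimes> a = a \<otimes> (g \<otimes> h)" if "a \<in> A" for a
  proof -
    have a: "a \<in> carrier G" "g \<otimes> a = a \<otimes> g" "g \<in> carrier G" "h \<otimes> a = a \<otimes> h" "h \<in> carrier G"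
      using that assms gh by auto
    have "g \<otimes> h \<otimes> a = g \<otimes> a \<otimes> h" using a(1,3,5) by (simp add: m_assoc a(4))
    also have "\<dots> = a \<otimes> (g \<otimes> h)" unfolding a(2) using a(1,3,5) by (simp add: m_assoc)
    finally show ?thesis .
  qed
  with gh show "g \<otimes> h \<in> {g \<in> carrier G. \<forall>a\<in>A. g \<otimes> a = a \<otimes> g}" by auto
qed (use assms in \<open>auto intro!: exI[of _ \<one>]\<close>)

lemma (in group) comm_if_generators_comm:
  assumes gen: "generate G A = carrier G" and A: "A \<subseteq> carrier G"
    and comm: "\<And>a b. a \<in> A \<Longrightarrow> b \<in> A \<Longrightarrow> a \<otimes> b = b \<otimes> a"
    and g: "g \<in> carrier G" and h: "h \<in> carrier G"
  shows "g \<otimes> h = h \<otimes> g"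
proof -
  have "A \<subseteq> {g \<in> carrier G. \<forall>a\<in>A. g \<otimes> a = a \<otimes> g}" using A comm by blast
  from generate_subgroup_incl[OF this centralizer_subgroup[OF A]]
  have 1: "g \<otimes> a = a \<otimes> g" if "g \<in> carrier G" "a \<in> A" for g a
    using gen that by blast
  have "A \<subseteq> {g \<in> carrier G. \<forall>a\<in>carrier G. g \<otimes> a = a \<otimes> g}"
    using A 1[symmetric] by blast
  from generate_subgroup_incl[OF this centralizer_subgroup[OF order.refl]]
  show ?thesis using gen g h by blast
qed

lemma (in group) conj_int_pow:
  assumes "x \<in> carrier G" "t \<in> carrier G"
  shows "t \<otimes> x [^] (k::int) \<otimes> inv t = (t \<otimes> x \<otimes> inv t) [^] k"
proof -
  have "(\<lambda>x. t \<otimes> x \<otimes> inv t) \<in> hom G G"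
    using assms by (intro homI) (auto simp: m_assoc mult_inv_cancel)
  then interpret h: group_hom G G "\<lambda>x. t \<otimes> x \<otimes> inv t"
    by (unfold_locales)
  show ?thesis using h.hom_int_pow[OF assms(1), of k] by simp
qed

text \<open>
  In a finite group, conjugate elements \<open>a\<^sup>m\<close> and \<open>a\<^sup>n\<close> have the same order, so coprimality of
  \<open>m\<close> and \<open>n\<close> forces both powers to generate the cyclic group of \<open>a\<close>.
\<close>

lemma (in group) BS_relation_coprime_ord:
  assumes a: "a \<in> carrier G" and t: "t \<in> carrier G" and r: "r > 0" "a [^] (r::nat) = \<one>"
    and rel: "t \<otimes> a [^] (m::int) \<otimes> inv t = a [^] (n::int)" and mn: "coprime m n"
  shows "coprime m (int (ord a))"
proof -
  have r': "ord a > 0" using r a by (metis dvd_0_left_iff not_gr_zero pow_eq_id)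
  \<comment> \<open>The exponent \<open>s = ord a / d\<close> makes \<open>a [^] (m * s)\<close>
    trivial, hence also its conjugate \<open>a [^] (n * s)\<close>. So \<open>d * s\<close> divides
    \<open>n * s\<close>, and \<open>d\<close> is a common divisor of \<open>m\<close> and
    \<open>n\<close>.\<close>
  define d where "d = gcd m (int (ord a))"
  obtain s where s: "int (ord a) = d * s" using gcd_dvd2 unfolding d_def by (rule dvdE)
  have s0: "s \<noteq> 0" using s r' by auto
  obtain m' where m': "m = d * m'" using gcd_dvd1 unfolding d_def by (rule dvdE)
  have "m * s = int (ord a) * m'" unfolding s using m' by (metis mult.assoc mult.commute)
  then have "int (ord a) dvd m * s" by simp
  then have "a [^] (m * s) = \<one>" using a by (simp add: int_pow_eq_id)
  moreover have "a [^] (n * s) = t \<otimes> a [^] (m * s) \<otimes> inv t"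
    using a t by (simp flip: int_pow_pow rel add: conj_int_pow)
  ultimately have "a [^] (n * s) = \<one>" using t by simp
  then have "d * s dvd n * s" using a by (simp add: int_pow_eq_id flip: s)
  then have "d dvd n" using s0 by simp
  moreover have "d dvd m" by (simp add: d_def)
  ultimately have "is_unit d" using mn by (metis coprime_common_divisor)
  then show ?thesis unfolding d_def is_unit_gcd .
qed

text \<open>Modulo the normal cyclic subgroup \<open>J\<close> generated by \<open>a\<close>, the
  group is generated by the image of \<open>t\<close> and hence abelian. All commutators therefore
  lie in \<open>J\<close>, which is itself abelian.\<close>

lemma (in group) metabelian_if_BS_relation:
  assumes a: "a \<in> carrier G" and t: "t \<in> carrier G" and gen: "generate G {a, t} = carrier G"
    and rel: "t \<otimes> a [^] (m::int) \<otimes> inv t = a [^] (n::int)" and mn: "coprime m n"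
    and r: "r > 0" "a [^] (r::nat) = \<one>"
    and ABCD: "A \<in> carrier G" "B \<in> carrier G" "C \<in> carrier G" "D \<in> carrier G"
  shows "commutator G (commutator G A B) (commutator G C D) = \<one>"
proof -
  define J where "J = {a [^] (k::int) | k. True}"
  have J: "J = generate G {a}" using generate_pow[OF a] by (auto simp: J_def)
  have sJ: "subgroup J G" unfolding J using a by (intro generate_is_subgroup) auto
  \<comment> \<open>An exponent prime to the order of \<open>a\<close> is invertible modulo that
    order, so \<open>a\<close> is a power of \<open>a [^] k\<close>.\<close>
  have root: "\<exists>u. a [^] (k * u) = a" if k: "coprime k (int (ord a))" for k :: int
  proof -
    obtain u v where uv: "u * k + v * int (ord a) = 1"
      using bezout_int[of k "int (ord a)"] coprime_imp_gcd_eq_1[OF k] by auto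
    have "a [^] (k * u) \<otimes> a [^] (v * int (ord a)) = a"
      using uv a by (simp add: mult.commute flip: int_pow_mult)
    moreover have "a [^] (v * int (ord a)) = \<one>" using a by (simp add: int_pow_eq_id)
    ultimately show ?thesis using a by auto
  qed
  \<comment> \<open>The same relation read from the other side: \<open>m\<close> and
    \<open>n\<close> trade places when \<open>t\<close> is replaced by its inverse. It yields the
    second coprimality and the closure of \<open>J\<close> under conjugation by
    \<open>inv t\<close>.\<close>
  have rel': "inv t \<otimes> a [^] n \<otimes> inv (inv t) = a [^] m"
    using a t by (simp flip: rel add: m_assoc mult_inv_cancel)
  obtain u where u: "a [^] (m * u) = a"
    using root BS_relation_coprime_ord[OF a t r rel mn] by blast
  obtain v where v: "a [^] (n * v) = a"
    using root BS_relation_coprime_ord[OF a _ r rel'] mn t by (auto simp: coprime_commute)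
  have tJ: "t \<otimes> a [^] k \<otimes> inv t \<in> J" for k :: int
  proof -
    have "t \<otimes> a [^] k \<otimes> inv t = t \<otimes> (a [^] m) [^] (u * k) \<otimes> inv t"
      using u a by (metis int_pow_pow mult.assoc)
    also have "\<dots> = (t \<otimes> a [^] m \<otimes> inv t) [^] (u * k)"
      using a t by (subst conj_int_pow) auto
    also have "\<dots> = a [^] (n * (u * k))" unfolding rel using a by (rule int_pow_pow)
    finally show ?thesis by (auto simp: J_def)
  qed
  have tJ': "inv t \<otimes> a [^] k \<otimes> inv (inv t) \<in> J" for k :: int
  proof -
    have "inv t \<otimes> a [^] k \<otimes> inv (inv t) = inv t \<otimes> (a [^] n) [^] (v * k) \<otimes> inv (inv t)"
      using v a by (metis int_pow_pow mult.assoc)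
    also have "\<dots> = (inv t \<otimes> a [^] n \<otimes> inv (inv t)) [^] (v * k)"
      using a t by (subst conj_int_pow) auto
    also have "\<dots> = a [^] (m * (v * k))" unfolding rel' using a by (rule int_pow_pow)
    finally show ?thesis by (auto simp: J_def)
  qed
  \<comment> \<open>Asking for both conjugations makes the normalizer of \<open>J\<close> visibly
    closed under inverses.\<close>
  define M where "M = {g \<in> carrier G. \<forall>x\<in>J. g \<otimes> x \<otimes> inv g \<in> J \<and> inv g \<otimes> x \<otimes> g \<in> J}"
  have JG: "J \<subseteq> carrier G" using subgroup.subset[OF sJ] .
  have "subgroup M G"
  proof (rule subgroupI)
    fix g h assume g: "g \<in> M" and h: "h \<in> M"
    then have gc: "g \<in> carrier G" "h \<in> carrier G" by (auto simp: M_def)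
    have "(g \<otimes> h) \<otimes> x \<otimes> inv (g \<otimes> h) \<in> J \<and> inv (g \<otimes> h) \<otimes> x \<otimes> (g \<otimes> h) \<in> J" if x: "x \<in> J" for x
    proof -
      have "g \<otimes> (h \<otimes> x \<otimes> inv h) \<otimes> inv g \<in> J" "inv h \<otimes> (inv g \<otimes> x \<otimes> g) \<otimes> h \<in> J"
        using g h x by (auto simp: M_def)
      then show ?thesis using gc x JG by (simp add: inv_mult_group m_assoc subset_iff)
    qed
    then show "g \<otimes> h \<in> M" using gc by (auto simp: M_def)
  next
    fix g assume "g \<in> M" then show "inv g \<in> M" by (auto simp: M_def)
  next
    have "\<one> \<in> M" using JG by (auto simp: M_def subset_iff)
    then show "M \<noteq> {}" by blast
  qed (auto simp: M_def)
  moreover have "a \<in> M"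
  proof -
    have "a \<in> J" unfolding J by (simp add: generate.incl)
    then show ?thesis
      using a by (simp add: M_def subgroup.m_closed[OF sJ] subgroup.m_inv_closed[OF sJ])
  qed
  moreover have "t \<in> M"
  proof -
    have "t \<otimes> x \<otimes> inv t \<in> J" "inv t \<otimes> x \<otimes> t \<in> J" if "x \<in> J" for x
      using that tJ tJ' t unfolding J_def by auto
    then show ?thesis using t by (simp add: M_def)
  qed
  ultimately have M: "M = carrier G"
    using generate_subgroup_incl[of "{a, t}" M] gen subgroup.subset by blast
  have nJ: "J \<lhd> G"
    using sJ M by (intro normal_invI) (auto simp: M_def)
  interpret N: normal J G by fact
  interpret Q: group "G Mod J" by (rule N.factorgroup_is_group)
  interpret \<pi>: group_hom G "G Mod J" "\<lambda>g. J #> g"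
    using N.r_coset_hom_Mod by unfold_locales
  have one: "J #> g = \<one>\<^bsub>G Mod J\<^esub> \<longleftrightarrow> g \<in> J" if "g \<in> carrier G" for g
    using that sJ by (metis coset_join1 coset_join2 one_FactGroup)
  have "a \<in> J" using J generate.incl[of a "{a}" G] by auto
  then have pa: "J #> a = \<one>\<^bsub>G Mod J\<^esub>" using one a by blast
  have surj: "(\<lambda>g. J #> g) ` carrier G = carrier (G Mod J)" by (simp add: carrier_FactGroup)
  have genQ: "generate (G Mod J) {J #> a, J #> t} = carrier (G Mod J)"
    using \<pi>.generate_img[of "{a, t}"] a t gen surj by simp
  have Qcomm: "x \<otimes>\<^bsub>G Mod J\<^esub> y = y \<otimes>\<^bsub>G Mod J\<^esub> x"
    if "x \<in> carrier (G Mod J)" "y \<in> carrier (G Mod J)" for x y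
  proof (rule Q.comm_if_generators_comm[OF genQ _ _ that])
    show "{J #> a, J #> t} \<subseteq> carrier (G Mod J)"
      using a t \<pi>.hom_closed by blast
    then show "\<And>x y. x \<in> {J #> a, J #> t} \<Longrightarrow> y \<in> {J #> a, J #> t} \<Longrightarrow>
      x \<otimes>\<^bsub>G Mod J\<^esub> y = y \<otimes>\<^bsub>G Mod J\<^esub> x"
      unfolding pa using Q.l_one Q.r_one by (metis insert_iff insert_subset singletonD)
  qed
  have inJ: "commutator G x y \<in> J" if "x \<in> carrier G" "y \<in> carrier G" for x y
  proof -
    have "commutator (G Mod J) (J #> x) (J #> y) = \<one>\<^bsub>G Mod J\<^esub>"
      using that \<pi>.hom_closed Qcomm by (subst Q.commutator_eq_one_iff) blast+
    then show ?thesis using that \<pi>.hom_commutator one commutator_closed by metis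
  qed
  obtain k l :: int where kl: "commutator G A B = a [^] k" "commutator G C D = a [^] l"
    using inJ[OF ABCD(1,2)] inJ[OF ABCD(3,4)] by (auto simp: J_def)
  have "a [^] k \<otimes> a [^] l = a [^] l \<otimes> a [^] k"
    using a by (simp flip: int_pow_mult add: add.commute)
  then show ?thesis unfolding kl using a by (subst commutator_eq_one_iff) auto
qed

text \<open>Right multiplication by the inverse permutes the right cosets as a left action. An
  element acting trivially fixes the coset \<open>L\<close> itself, so it lies in
  \<open>L\<close>.\<close>

lemma (in group) coset_action_hom:
  assumes "subgroup L G"
  obtains \<gamma> where "\<gamma> \<in> hom G (BijGroup (rcosets L))" "\<And>g. g \<in> carrier G \<Longrightarrow> \<gamma> g = \<one>\<^bsub>BijGroup (rcosets L)\<^esub> \<Longrightarrow> g \<in> L"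
proof -
  let ?R = "rcosets L"
  define \<gamma> where "\<gamma> g = (\<lambda>C\<in>?R. C #> inv g)" for g
  have LG: "L \<subseteq> carrier G" by (rule subgroup.subset[OF assms])
  have cl: "C #> g \<in> ?R" "C \<subseteq> carrier G" if C: "C \<in> ?R" and g: "g \<in> carrier G" for C g
  proof -
    obtain x where x: "x \<in> carrier G" "C = L #> x" using C by (auto simp: RCOSETS_def)
    then show "C #> g \<in> ?R" using g LG by (auto simp: coset_mult_assoc RCOSETS_def)
    show "C \<subseteq> carrier G" using x LG r_coset_subset_G by auto
  qed
  have m: "\<gamma> (g \<otimes> h) C = \<gamma> g (\<gamma> h C)" if "g \<in> carrier G" "h \<in> carrier G" "C \<in> ?R" for g h C
    using that cl by (simp add: \<gamma>_def inv_mult_group coset_mult_assoc)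
  have o: "\<gamma> \<one> C = C" if "C \<in> ?R" for C using that cl[OF that, of \<one>] by (simp add: \<gamma>_def)
  have bij: "\<gamma> g \<in> carrier (BijGroup ?R)" if g: "g \<in> carrier G" for g
  proof -
    have "bij_betw (\<gamma> g) ?R ?R"
    proof (rule bij_betw_byWitness[of _ "\<gamma> (inv g)"])
      show "\<forall>C\<in>?R. \<gamma> (inv g) (\<gamma> g C) = C" "\<forall>C\<in>?R. \<gamma> g (\<gamma> (inv g) C) = C"
        using g o by (simp_all flip: m)
    qed (use g cl in \<open>auto simp: \<gamma>_def\<close>)
    then show ?thesis by (auto simp: BijGroup_def Bij_def \<gamma>_def)
  qed
  have "\<gamma> \<in> hom G (BijGroup ?R)"
  proof (rule homI[OF bij])
    fix g h assume gh: "g \<in> carrier G" "h \<in> carrier G"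
    then have "\<gamma> (g \<otimes> h) = compose ?R (\<gamma> g) (\<gamma> h)"
      by (intro ext) (metis (no_types, lifting) \<gamma>_def compose_def m restrict_apply)
    then show "\<gamma> (g \<otimes> h) = \<gamma> g \<otimes>\<^bsub>BijGroup ?R\<^esub> \<gamma> h"
      using bij gh by (simp add: BijGroup_def)
  qed
  moreover have "g \<in> L" if g: "g \<in> carrier G" "\<gamma> g = \<one>\<^bsub>BijGroup ?R\<^esub>" for g
  proof -
    have L: "L \<in> ?R" using assms by (metis coset_mult_one one_closed rcosetsI LG)
    then have "\<gamma> g L = L" using g by (simp add: BijGroup_def)
    then have "L #> inv g = L" using L by (simp add: \<gamma>_def)
    then have "inv g \<in> L" using coset_join1[OF _ _ assms] g by auto
    then show ?thesis using subgroup.m_inv_closed[OF assms] g by fastforce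
  qed
  ultimately show ?thesis using that by blast
qed

text \<open>The permutation image on the cosets of \<open>L\<close> is a finite group inheriting
  generators and relation, so it is metabelian; the kernel of the action is contained in
  \<open>L\<close>.\<close>

lemma (in group) finite_index_metabelian_law:
  assumes a: "a \<in> carrier G" and t: "t \<in> carrier G" and gen: "generate G {a, t} = carrier G"
    and rel: "t \<otimes> a [^] (m::int) \<otimes> inv t = a [^] (n::int)" and mn: "coprime m n"
    and L: "subgroup L G" "finite (rcosets L)"
    and ABCD: "A \<in> carrier G" "B \<in> carrier G" "C \<in> carrier G" "D \<in> carrier G"
  shows "commutator G (commutator G A B) (commutator G C D) \<in> L"
proof -
  let ?K = "BijGroup (rcosets L)"
  obtain \<gamma> where \<gamma>: "\<gamma> \<in> hom G ?K" "\<And>g. g \<in> carrier G \<Longrightarrow> \<gamma> g = \<one>\<^bsub>?K\<^esub> \<Longrightarrow> g \<in> L"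
    using coset_action_hom[OF L(1)] by blast
  interpret K: group ?K by (rule group_BijGroup)
  have ghom: "group_hom G ?K \<gamma>" using \<gamma>(1) by unfold_locales
  have fin: "finite (carrier ?K)"
    by (rule finite_subset[OF _ finite_PiE[OF L(2), of "\<lambda>_. rcosets L"]])
      (auto simp: BijGroup_def Bij_def bij_betw_def PiE_def L(2))
  \<comment> \<open>The symmetric group is cut down to the image of \<open>\<gamma>\<close>, because
    \<open>metabelian_if_BS_relation\<close> needs a group generated by the images of
    \<open>a\<close> and \<open>t\<close>.\<close>
  define I where "I = ?K\<lparr>carrier := \<gamma> ` carrier G\<rparr>"
  have sub: "subgroup (\<gamma> ` carrier G) ?K" by (rule group_hom.img_is_subgroup[OF ghom])
  interpret I: group I unfolding I_def by (rule K.subgroup_imp_group[OF sub])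
  have hI: "\<gamma> \<in> hom G I" using \<gamma>(1) by (auto simp: hom_def I_def)
  interpret gI: group_hom G I \<gamma> using hI by unfold_locales
  have genI: "generate I {\<gamma> a, \<gamma> t} = carrier I"
    using gI.generate_img[of "{a, t}"] a t gen by (simp add: I_def)
  have "\<gamma> ` carrier G \<subseteq> carrier ?K" using group_hom.hom_closed[OF ghom] by blast
  then have "finite (carrier I)" using fin by (auto simp: I_def intro: finite_subset)
  then have pos: "order I > 0" by (simp add: I.order_gt_0_iff_finite)
  have "commutator I (commutator I (\<gamma> A) (\<gamma> B)) (commutator I (\<gamma> C) (\<gamma> D)) = \<one>\<^bsub>I\<^esub>"
  proof (rule I.metabelian_if_BS_relation[OF _ _ genI _ mn pos])
    show "\<gamma> a [^]\<^bsub>I\<^esub> order I = \<one>\<^bsub>I\<^esub>"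
      using a by (intro I.pow_order_eq_1) auto
    show "\<gamma> t \<otimes>\<^bsub>I\<^esub> \<gamma> a [^]\<^bsub>I\<^esub> m \<otimes>\<^bsub>I\<^esub> inv\<^bsub>I\<^esub> \<gamma> t = \<gamma> a [^]\<^bsub>I\<^esub> n"
      using a t arg_cong[OF rel, of \<gamma>] by (simp add: gI.hom_int_pow)
  qed (use a t ABCD in auto)
  then have "\<gamma> (commutator G (commutator G A B) (commutator G C D)) = \<one>\<^bsub>?K\<^esub>"
    using ABCD by (simp add: gI.hom_commutator commutator_closed I_def)
  then show ?thesis by (rule \<gamma>(2)[rotated]) (use ABCD in \<open>simp add: commutator_closed\<close>)
qed

section \<open>Free groups of rank at least two violate the metabelian law in a finite
  quotient\<close>

lemma free_group_cyclic_comm: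
  assumes "S \<subseteq> {x}"
  shows "comm_group (free_group S)"
proof -
  let ?P = "presented_group S {}"
  interpret group ?P by (rule group_presented_group)
  let ?f = "\<lambda>x. word_class S {} [(x, True)]"
  define g where "g = (if x \<in> S then ?f x else \<one>\<^bsub>?P\<^esub>)"
  have "?f x \<in> carrier ?P" if "x \<in> S" using that by (auto simp: carrier_presented_group)
  then have g: "g \<in> carrier ?P" by (simp add: g_def)
  have "carrier ?P \<subseteq> generate ?P {g}"
  proof
    fix A assume "A \<in> carrier ?P"
    then obtain w where w: "w \<in> words S" "A = word_class S {} w"
      by (auto simp: carrier_presented_group)
    have "word_eval ?P ?f w \<in> generate ?P {g}"
    proof (rule word_eval_in_subgroup[OF group_presented_group _ _ w(1)])
      show "subgroup (generate ?P {g}) ?P" using g by (intro generate_is_subgroup) simp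
      show "?f \<in> S \<rightarrow> generate ?P {g}"
        using assms by (auto simp: g_def intro: generate.incl)
    qed
    then show "A \<in> generate ?P {g}" by (simp add: word_eval_cls_generators w)
  qed
  then have gen: "generate ?P {g} = carrier ?P" using generate_incl[of "{g}"] g by blast
  show ?thesis unfolding free_group_def
  proof (rule group_comm_groupI)
    fix a b assume ab: "a \<in> carrier ?P" "b \<in> carrier ?P"
    show "a \<otimes>\<^bsub>?P\<^esub> b = b \<otimes>\<^bsub>?P\<^esub> a"
      by (rule comm_if_generators_comm[OF gen _ _ ab]) (use g in auto)
  qed
qed

lemma comm_group_iso:
  assumes "f \<in> iso G K" "comm_group G" "group K"
  shows "comm_group K"
proof -
  interpret G: comm_group G by fact
  interpret K: group K by fact
  interpret group_hom G K f using assms(1) by unfold_locales (simp add: iso_def)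
  show ?thesis
  proof (rule K.group_comm_groupI)
    fix x y assume "x \<in> carrier K" "y \<in> carrier K"
    moreover have "carrier K = f ` carrier G" using assms(1) by (simp add: iso_def bij_betw_def)
    ultimately obtain a b where ab: "a \<in> carrier G" "b \<in> carrier G" "x = f a" "y = f b" by auto
    then show "x \<otimes>\<^bsub>K\<^esub> y = y \<otimes>\<^bsub>K\<^esub> x" by (simp flip: hom_mult add: G.m_comm)
  qed
qed

text \<open>A coset of \<open>L\<close> in the whole group is a coset of \<open>L\<close> in
  \<open>H\<close>, translated by the representative of a coset of \<open>H\<close>; there are
  finitely many choices of both.\<close>

lemma (in group) finite_rcosets_trans:
  assumes H: "subgroup H G" "finite (rcosets H)"
    and L: "subgroup L (G\<lparr>carrier := H\<rparr>)" "finite (rcosets\<^bsub>G\<lparr>carrier := H\<rparr>\<^esub> L)"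
  shows "subgroup L G" "finite (rcosets L)"
proof -
  show LG: "subgroup L G" by (rule incl_subgroup[OF H(1) L(1)])
  let ?H = "G\<lparr>carrier := H\<rparr>"
  define rep where "rep C = (SOME g. g \<in> C)" for C :: "'a set"
  have "rcosets L \<subseteq> (\<lambda>(D, g). D #> g) ` ((rcosets\<^bsub>?H\<^esub> L) \<times> rep ` (rcosets H))"
  proof
    fix C assume "C \<in> rcosets L"
    then obtain g where g: "g \<in> carrier G" "C = L #> g" by (auto simp: RCOSETS_def)
    have "g \<in> H #> g" using rcos_self[OF g(1) H(1)] .
    then have "rep (H #> g) \<in> H #> g" unfolding rep_def by (rule someI)
    then obtain h where h: "h \<in> H" "rep (H #> g) = h \<otimes> g" by (auto simp: r_coset_def)
    have hc: "h \<in> carrier G" using subgroup.subset[OF H(1)] h by auto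
    have hi: "inv h \<in> H" using subgroup.m_inv_closed[OF H(1) h(1)] .
    have "C = L #> inv h #> (h \<otimes> g)"
      using g hc subgroup.subset[OF LG] by (simp add: coset_mult_assoc mult_inv_cancel)
    moreover have "L #> inv h \<in> rcosets\<^bsub>?H\<^esub> L"
      using hi by (auto simp: RCOSETS_def r_coset_def)
    moreover have "rep (H #> g) \<in> rep ` (rcosets H)" using g by (auto simp: RCOSETS_def)
    ultimately show "C \<in> (\<lambda>(D, g). D #> g) ` ((rcosets\<^bsub>?H\<^esub> L) \<times> rep ` (rcosets H))"
      using h(2) by (intro image_eqI[of _ _ "(L #> inv h, rep (H #> g))"]) auto
  qed
  then show "finite (rcosets L)" by (rule finite_subset) (use H L in auto)
qed

lemma (in group_hom) finite_rcosets_kernel: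
  assumes "finite (carrier H)"
  shows "finite (rcosets\<^bsub>G\<^esub> kernel G H h)"
proof -
  have "rcosets\<^bsub>G\<^esub> kernel G H h \<subseteq> (\<lambda>y. {x \<in> carrier G. h x = y}) ` carrier H"
  proof
    fix C assume "C \<in> rcosets\<^bsub>G\<^esub> kernel G H h"
    then obtain g where g: "g \<in> carrier G" "C = kernel G H h #> g" by (auto simp: RCOSETS_def)
    have "x \<in> kernel G H h #> g \<longleftrightarrow> x \<in> carrier G \<and> h x = h g" for x
    proof
      assume "x \<in> kernel G H h #> g"
      then show "x \<in> carrier G \<and> h x = h g" using g by (auto simp: r_coset_def kernel_def)
    next
      assume x: "x \<in> carrier G \<and> h x = h g"
      then have "x \<otimes> inv g \<in> kernel G H h" using g by (simp add: kernel_def)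
      moreover have "(x \<otimes> inv g) \<otimes> g = x" using x g(1) by (simp add: G.m_assoc)
      ultimately show "x \<in> kernel G H h #> g" unfolding r_coset_def by blast
    qed
    then show "C \<in> (\<lambda>y. {x \<in> carrier G. h x = y}) ` carrier H" using g by auto
  qed
  then show ?thesis by (rule finite_subset) (use assms in simp)
qed

text \<open>A nonabelian free quotient of \<open>H\<close> has two distinct basis elements, which
  can be sent to a transposition and a 4-cycle in S4. The kernel of the resulting map on
  \<open>H\<close> has finite index in the group, so \<open>finite_index_metabelian_law\<close>
  applies to it, but the image S4 has derived length three.\<close>

lemma (in group) BS_quotient_not_large:
  assumes a: "a \<in> carrier G" and t: "t \<in> carrier G" and gen: "generate G {a, t} = carrier G"
    and rel: "t \<otimes> a [^] (m::int) \<otimes> inv t = a [^] (n::int)" and mn: "coprime m n"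
  shows "\<not> large_group G"
proof
  assume "large_group G"
  then obtain H N where H: "subgroup H G" "finite (rcosets H)" and N: "N \<lhd> G\<lparr>carrier := H\<rparr>"
    and fr: "is_free_group (G\<lparr>carrier := H\<rparr> Mod N)"
    and nc: "\<not> comm_group (G\<lparr>carrier := H\<rparr> Mod N)"
    by (auto simp: large_group_def)
  define H' where "H' = G\<lparr>carrier := H\<rparr>"
  define Q where "Q = H' Mod N"
  interpret H': group H' unfolding H'_def by (rule subgroup_imp_group[OF H(1)])
  interpret N: normal N H' using N by (simp add: H'_def)
  interpret Q: group Q unfolding Q_def by (rule N.factorgroup_is_group)
  obtain S :: "'a set set" and \<phi> where \<phi>: "\<phi> \<in> iso (free_group S) Q"
    using fr by (auto simp: is_free_group_def is_iso_def Q_def H'_def)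
  have gF: "group (free_group S)" unfolding free_group_def by (rule group_presented_group)
  have "\<not> comm_group (free_group S)"
    using nc comm_group_iso[OF \<phi> _ Q.group_axioms] by (auto simp: Q_def H'_def)
  then have nS: "\<not> S \<subseteq> {x}" for x using free_group_cyclic_comm[of S x] by blast
  obtain x where x: "x \<in> S" using nS by blast
  obtain y where y: "y \<in> S" "y \<noteq> x" using nS[of x] by blast
  define p :: "nat \<Rightarrow> nat" where "p = transpose 1 2"
  define q :: "nat \<Rightarrow> nat" where "q = transpose 1 2 \<circ> transpose 2 3 \<circ> transpose 3 4"
  let ?K = "sym_group 4"
  interpret K: group ?K by (rule sym_group_is_group)
  have pK: "p \<in> carrier ?K" by (simp add: sym_group_def p_def permutes_swap_id)
  have qK: "q \<in> carrier ?K" unfolding q_def sym_group_carrier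
    by (intro permutes_compose permutes_swap_id) auto
  \<comment> \<open>The basis may be infinite; every basis element other than \<open>x\<close> goes
    to the 4-cycle.\<close>
  define f where "f z = (if z = x then p else q)" for z
  have f: "f \<in> S \<rightarrow> carrier ?K" using pK qK by (simp add: f_def)
  obtain h where h: "h \<in> hom (free_group S) ?K" "\<And>w. w \<in> words S \<Longrightarrow> h (word_class S {} w) = word_eval ?K f w"
    using presented_group_universal[OF sym_group_is_group f, of "{}"] unfolding free_group_def
    by blast
  define \<psi> where "\<psi> = inv_into (carrier (free_group S)) \<phi>"
  have \<psi>: "\<psi> \<in> iso Q (free_group S)"
    unfolding \<psi>_def by (rule group.iso_set_sym[OF gF \<phi>])
  have \<psi>\<phi>: "\<psi> (\<phi> u) = u" if "u \<in> carrier (free_group S)" for u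
    using that \<phi> by (simp add: \<psi>_def iso_def bij_betw_def)
  define \<theta> where "\<theta> = h \<circ> (\<psi> \<circ> (\<lambda>a. N #>\<^bsub>H'\<^esub> a))"
  have "\<psi> \<in> hom Q (free_group S)" using \<psi> by (simp add: iso_def)
  then have "\<theta> \<in> hom H' ?K"
    unfolding \<theta>_def by (rule Group.hom_compose[OF Group.hom_compose[OF N.r_coset_hom_Mod[folded Q_def]] h(1)])
  then interpret \<theta>: group_hom H' ?K \<theta> by unfold_locales
  have surj: "\<exists>A\<in>H. \<theta> A = f z" if z: "z \<in> S" for z
  proof -
    have c: "word_class S {} [(z, True)] \<in> carrier (free_group S)"
      using z by (auto simp: free_group_def carrier_presented_group)
    then have "\<phi> (word_class S {} [(z, True)]) \<in> carrier Q" using \<phi> by (auto simp: iso_def hom_def)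
    then obtain A where A: "A \<in> carrier H'" "\<phi> (word_class S {} [(z, True)]) = N #>\<^bsub>H'\<^esub> A"
      by (auto simp: Q_def carrier_FactGroup)
    have "f z \<in> carrier ?K" using f z by blast
    then have "h (word_class S {} [(z, True)]) = f z"
      using h(2)[of "[(z, True)]"] z by (simp add: sym_group_one sym_group_mult)
    then have "\<theta> A = f z" by (simp add: \<theta>_def A(2)[symmetric] \<psi>\<phi>[OF c])
    then show ?thesis using A(1) by (auto simp: H'_def)
  qed
  obtain A where A: "A \<in> H" "\<theta> A = p" using surj[OF x] by (auto simp: f_def)
  obtain T where T: "T \<in> H" "\<theta> T = q" using surj[OF y(1)] y(2) by (auto simp: f_def)
  have Hc: "carrier H' = H" by (simp add: H'_def)
  define L where "L = kernel H' ?K \<theta>"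
  have finK: "finite (carrier ?K)" by (simp add: sym_group_def finite_permutations)
  have L: "subgroup L G" "finite (rcosets L)"
    using finite_rcosets_trans[OF H, of L] \<theta>.subgroup_kernel \<theta>.finite_rcosets_kernel[OF finK]
    by (auto simp: L_def H'_def)
  \<comment> \<open>Conjugation by the 4-cycle shifts (1 2) to (2 3) and then to (3 4), so
    \<open>A\<close>, \<open>B\<close>, \<open>D\<close> are preimages of the three adjacent
    transpositions.\<close>
  define B where "B = T \<otimes>\<^bsub>H'\<^esub> A \<otimes>\<^bsub>H'\<^esub> inv\<^bsub>H'\<^esub> T"
  define D where "D = T \<otimes>\<^bsub>H'\<^esub> B \<otimes>\<^bsub>H'\<^esub> inv\<^bsub>H'\<^esub> T"
  have BH: "B \<in> H" "D \<in> H"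
    using A(1) T(1) H'.m_closed H'.inv_closed unfolding B_def D_def Hc by simp_all
  have conj: "q \<otimes>\<^bsub>?K\<^esub> v \<otimes>\<^bsub>?K\<^esub> inv\<^bsub>?K\<^esub> q = u"
    if "u \<circ> q = q \<circ> v" "u \<in> carrier ?K" "v \<in> carrier ?K" for u v
    using that qK K.inv_solve_right[of u "q \<circ> v" q] K.m_closed[of q v]
    by (simp add: sym_group_mult)
  have swapK: "transpose i j \<in> carrier ?K" if "i \<in> {1..4}" "j \<in> {1..4}" for i j :: nat
    using that by (simp add: sym_group_carrier permutes_swap_id)
  have cH: "A \<in> carrier H'" "T \<in> carrier H'" "B \<in> carrier H'" using A T BH by (simp_all add: Hc)
  have tB: "\<theta> B = transpose 2 3"
  proof -
    have "transpose 2 3 \<circ> q = q \<circ> p" by (auto simp: q_def p_def fun_eq_iff transpose_def)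
    then show ?thesis
      using conj[of "transpose 2 3" p] pK swapK A(2) T(2) cH by (simp add: B_def)
  qed
  have tD: "\<theta> D = transpose 3 4"
  proof -
    have "transpose 3 4 \<circ> q = q \<circ> transpose 2 3" by (auto simp: q_def p_def fun_eq_iff transpose_def)
    then show ?thesis
      using conj[of "transpose 3 4" "transpose 2 3"] swapK T(2) cH by (simp add: D_def tB)
  qed
  have "commutator G (commutator G A B) (commutator G B D) \<in> L"
    using A(1) BH subgroup.subset[OF H(1)]
    by (intro finite_index_metabelian_law[OF a t gen rel mn L]) auto
  moreover have "commutator H' u v = commutator G u v" if "u \<in> H" "v \<in> H" for u v
    using that H(1) by (simp add: commutator_def H'_def)
  ultimately have "\<theta> (commutator H' (commutator H' A B) (commutator H' B D)) = \<one>\<^bsub>?K\<^esub>"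
    using A(1) BH H'.commutator_closed Hc by (simp add: L_def kernel_def)
  then have "commutator ?K (commutator ?K p (transpose 2 3)) (commutator ?K (transpose 2 3) (transpose 3 4)) = \<one>\<^bsub>?K\<^esub>"
    using A(2) cH BH(2)[folded Hc] H'.commutator_closed by (simp add: \<theta>.hom_commutator tB tD)
  then have "commutator ?K p (transpose 2 3) \<otimes>\<^bsub>?K\<^esub> commutator ?K (transpose 2 3) (transpose 3 4)
    = commutator ?K (transpose 2 3) (transpose 3 4) \<otimes>\<^bsub>?K\<^esub> commutator ?K p (transpose 2 3)"
    using pK swapK K.commutator_closed by (subst (asm) K.commutator_eq_one_iff) auto
  then have "(p \<circ> transpose 2 3 \<circ> p \<circ> transpose 2 3) \<circ> (transpose 2 3 \<circ> transpose 3 4 \<circ> transpose 2 3 \<circ> transpose 3 4)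
    = (transpose 2 3 \<circ> transpose 3 4 \<circ> transpose 2 3 \<circ> transpose 3 4) \<circ> (p \<circ> transpose 2 3 \<circ> p \<circ> transpose 2 3)"
    using pK swapK by (simp add: commutator_def sym_group_mult p_def)
  \<comment> \<open>The two commutators are 3-cycles on {1,2,3} and on {2,3,4}; their products in
    the two orders already differ at the point 1.\<close>
  from fun_cong[OF this, of 1] show False by (simp add: p_def transpose_def)
qed

section \<open>Labelled graphs and homomorphisms to finite cyclic groups\<close>

type_synonym 'v lab_edge = "'v \<times> int \<times> 'v \<times> int"

text \<open>
  An entry \<open>(u, l, w, m)\<close> is an edge of a graph of infinite cyclic groups: it carries the relation
  \<open>a\<^sub>u\<^sup>l = a\<^sub>w\<^sup>m\<close> (up to conjugation by a stable letter).
\<close>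

inductive grow :: "'v \<Rightarrow> 'v set \<Rightarrow> 'v lab_edge list \<Rightarrow> bool" for r where
  grow_root: "grow r {r} []"
| grow_leaf: "grow r V es \<Longrightarrow> u \<notin> V \<Longrightarrow> w \<in> V \<Longrightarrow> l \<noteq> 0 \<Longrightarrow> m \<noteq> 0 \<Longrightarrow>
    grow r (insert u V) ((u, l, w, m) # es)"

definition edges_in :: "'v set \<Rightarrow> 'v lab_edge list \<Rightarrow> bool" where
  "edges_in V es \<longleftrightarrow> (\<forall>(u, l, w, m)\<in>set es. u \<in> V \<and> w \<in> V)"

text \<open>The edge group is generated by \<open>a\<^sub>u\<^sup>l\<close>, whose value is
  \<open>l * q u\<close>. The gcd is the index of the subgroup it generates modulo \<open>N\<close>,
  that is, the number of edge orbits of the kernel above this edge when the homomorphism is onto.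
  For compatible \<open>q\<close> the other end gives the same number.\<close>

definition wt :: "int \<Rightarrow> ('v \<Rightarrow> int) \<Rightarrow> 'v lab_edge \<Rightarrow> int" where
  "wt N q = (\<lambda>(u, l, w, m). gcd (l * q u) N)"

definition compat :: "int \<Rightarrow> ('v \<Rightarrow> int) \<Rightarrow> 'v lab_edge list \<Rightarrow> bool" where
  "compat N q es \<longleftrightarrow> (\<forall>(u, l, w, m)\<in>set es. N dvd l * q u - m * q w)"

text \<open>
  A compatible \<open>q\<close> is a homomorphism to the integers modulo \<open>N\<close> sending \<open>a\<^sub>v\<close> to \<open>q v\<close>. If it is
  onto, its kernel acts on the tree with quotient graph of first Betti number \<open>excess + 1\<close>.
\<close>

definition excess :: "int \<Rightarrow> ('v \<Rightarrow> int) \<Rightarrow> 'v set \<Rightarrow> 'v lab_edge list \<Rightarrow> int" where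
  "excess N q V es = sum_list (map (wt N q) es) - (\<Sum>v\<in>V. gcd (q v) N)"

definition witness :: "'v set \<Rightarrow> 'v lab_edge list \<Rightarrow> bool" where
  "witness V es \<longleftrightarrow> (\<exists>N>0. \<exists>q. compat N q es \<and> excess N q V es > 0)"

text \<open>For a prime modulus every gcd is 1 or \<open>p\<close>, which turns the weight identity
  in \<open>prime_witness_merge\<close> into a case distinction. The circuit case works with these
  only.\<close>

definition prime_witness :: "'v set \<Rightarrow> 'v lab_edge list \<Rightarrow> bool" where
  "prime_witness V es \<longleftrightarrow> (\<exists>p. Factorial_Ring.prime p \<and> (\<exists>q. compat p q es \<and> excess p q V es > 0))"

lemma prime_witness_imp_witness: "prime_witness V es \<Longrightarrow> witness V es"
  unfolding prime_witness_def witness_def using prime_gt_0_int by blast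

lemma compat_Cons [simp]:
  "compat N q ((u, l, w, m) # es) \<longleftrightarrow> N dvd l * q u - m * q w \<and> compat N q es"
  by (auto simp: compat_def)

lemma compat_if_eq:
  "(\<And>u l w m. (u, l, w, m) \<in> set es \<Longrightarrow> l * q u = m * q w) \<Longrightarrow> compat N q es"
  by (auto simp: compat_def)

lemma edges_in_Cons [simp]:
  "edges_in V ((u, l, w, m) # es) \<longleftrightarrow> u \<in> V \<and> w \<in> V \<and> edges_in V es"
  by (auto simp: edges_in_def)

lemma edges_in_mono: "edges_in V es \<Longrightarrow> V \<subseteq> W \<Longrightarrow> edges_in W es"
  by (auto simp: edges_in_def)

lemma compat_Nil [simp]: "compat N q []" by (simp add: compat_def)

lemma edges_in_Nil [simp]: "edges_in V []" by (simp add: edges_in_def)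

lemma wt_Pair [simp]: "wt N q (u, l, w, m) = gcd (l * q u) N"
  by (simp add: wt_def)

section \<open>Compatibility and excess under scaling, attaching a leaf and changing the
  root\<close>

lemma grow_facts:
  assumes "grow r V es"
  shows "finite V" "r \<in> V" "edges_in V es" "length es + 1 = card V"
    "\<forall>(u, l, w, m)\<in>set es. l \<noteq> 0 \<and> m \<noteq> 0"
  using assms by (induction rule: grow.induct) (auto intro: edges_in_mono)

lemma gcd_eq_if_dvd_diff:
  fixes a b N :: int
  assumes "N dvd a - b"
  shows "gcd a N = gcd b N"
proof -
  obtain k where "a - b = N * k" using assms by (rule dvdE)
  then have "a = k * N + b" by (simp add: algebra_simps)
  then show ?thesis by (metis gcd.commute gcd_add_mult)
qed

lemma excess_leaf:
  assumes "finite V" "u \<notin> V" "edges_in V es" "\<And>v. v \<in> V \<Longrightarrow> q' v = q v"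
  shows "excess N q' (insert u V) (e # es) = wt N q' e - gcd (q' u) N + excess N q V es"
proof -
  have "sum_list (map (wt N q') es) = sum_list (map (wt N q) es)"
    by (intro arg_cong[of _ _ sum_list] map_cong)
      (use assms(3,4) in \<open>auto simp: edges_in_def wt_def\<close>)
  moreover have "(\<Sum>v\<in>V. gcd (q' v) N) = (\<Sum>v\<in>V. gcd (q v) N)" using assms(4) by simp
  ultimately show ?thesis using assms(1,2) by (simp add: excess_def)
qed

lemma compat_cong:
  assumes "edges_in V es" "\<And>v. v \<in> V \<Longrightarrow> q' v = q v"
  shows "compat N q' es \<longleftrightarrow> compat N q es"
  using assms by (force simp: compat_def edges_in_def)

lemma gcd_scale:
  fixes c x N :: int
  assumes "N > 0"
  shows "gcd (c * x) N = gcd c N * gcd x (N div gcd c N)"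
proof -
  define d where "d = gcd c N"
  have d0: "d > 0" using assms by (simp add: d_def)
  obtain c' where c': "c = d * c'" using gcd_dvd1 unfolding d_def by (rule dvdE)
  obtain N' where N': "N = d * N'" using gcd_dvd2 unfolding d_def by (rule dvdE)
  have "d = d * gcd c' N'" using d0 unfolding d_def[symmetric]
    by (metis N' abs_of_pos c' d_def gcd_mult_distrib_int)
  then have cop: "coprime c' N'" using d0 by (simp add: coprime_iff_gcd_eq_1)
  have "gcd (c * x) N = d * gcd (c' * x) N'"
    using d0 by (simp add: c' N' mult.assoc flip: gcd_mult_distrib_int[of d])
  also have "gcd (c' * x) N' = gcd x N'" using cop by (simp add: gcd_mult_left_left_cancel coprime_commute)
  moreover have "N div d = N'" using N' d0 by simp
  ultimately show ?thesis unfolding d_def[symmetric] by simp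
qed

text \<open>With \<open>d = gcd c N\<close>, multiplication by \<open>c\<close> embeds the integers
  modulo \<open>N div d\<close> into those modulo \<open>N\<close> with image of index
  \<open>d\<close>, so every orbit count is multiplied by \<open>d\<close>.\<close>

lemma excess_scale:
  assumes "N > 0"
  shows "excess N (\<lambda>v. c * q v) V es = gcd c N * excess (N div gcd c N) q V es"
proof -
  have w: "wt N (\<lambda>v. c * q v) e = gcd c N * wt (N div gcd c N) q e" for e
  proof -
    obtain u l w m where "e = (u, l, w, m)" by (metis prod_cases4)
    then show ?thesis using gcd_scale[OF assms, of c "l * q u"] by (simp add: ac_simps)
  qed
  have "sum_list (map (wt N (\<lambda>v. c * q v)) es) = gcd c N * sum_list (map (wt (N div gcd c N) q) es)"
    unfolding w by (simp add: sum_list_const_mult)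
  moreover have "(\<Sum>v\<in>V. gcd (c * q v) N) = gcd c N * (\<Sum>v\<in>V. gcd (q v) (N div gcd c N))"
    unfolding gcd_scale[OF assms] by (simp add: sum_distrib_left)
  ultimately show ?thesis by (simp add: excess_def algebra_simps)
qed

lemma compat_scale:
  assumes "compat N q es"
  shows "compat (c * N) (\<lambda>v. c * q v) es"
proof -
  have "c * N dvd l * (c * q u) - m * (c * q w)" if "(u, l, w, m) \<in> set es" for u l w m
  proof -
    have "c * N dvd c * (l * q u - m * q w)" using assms that by (auto simp: compat_def)
    then show ?thesis by (simp add: algebra_simps)
  qed
  then show ?thesis by (auto simp: compat_def)
qed

text \<open>The value at the new leaf must solve \<open>l * q u = m * q w\<close>, which becomes
  possible after scaling everything by \<open>\<bar>l\<bar>\<close>. Scaling multiplies the excess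
  by \<open>\<bar>l\<bar>\<close>, and the leaf contributes a nonnegative amount, since the gcd at
  the vertex divides the gcd at the edge.\<close>

lemma witness_leaf:
  assumes "finite V" "u \<notin> V" "w \<in> V" "edges_in V es" "l \<noteq> 0" "witness V es"
  shows "witness (insert u V) ((u, l, w, m) # es)"
proof -
  obtain N q where N: "N > 0" "compat N q es" "excess N q V es > 0"
    using assms(6) by (auto simp: witness_def)
  define N' where "N' = \<bar>l\<bar> * N"
  define q' where "q' = (\<lambda>v. \<bar>l\<bar> * q v)(u := sgn l * m * q w)"
  have N': "N' > 0" using N assms(5) by (simp add: N'_def)
  have q': "q' v = \<bar>l\<bar> * q v" if "v \<in> V" for v using that assms(2) by (auto simp: q'_def)
  have lu: "l * q' u = m * q' w"
    using q'[OF assms(3)] by (simp add: q'_def abs_sgn)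
  have "compat N' q' es"
    using compat_scale[OF N(2), of "\<bar>l\<bar>"] compat_cong[OF assms(4) q'] by (simp add: N'_def)
  then have 1: "compat N' q' ((u, l, w, m) # es)" using lu by simp
  have "gcd (q' u) N' dvd gcd (l * q' u) N'" by (simp add: dvd_mult)
  then have le: "gcd (q' u) N' \<le> gcd (l * q' u) N'" using N' by (intro zdvd_imp_le) auto
  have "excess N' (\<lambda>v. \<bar>l\<bar> * q v) V es = \<bar>l\<bar> * excess N q V es"
    using excess_scale[OF N', of "\<bar>l\<bar>" q] assms(5) N(1) by (simp add: N'_def)
  then have "excess N' (\<lambda>v. \<bar>l\<bar> * q v) V es > 0" using N(3) assms(5) by simp
  then have "excess N' q' (insert u V) ((u, l, w, m) # es) > 0"
    using le excess_leaf[OF assms(1,2,4) q', where N = N' and e = "(u, l, w, m)"] by simp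
  then show ?thesis using 1 N' by (auto simp: witness_def)
qed

text \<open>For a label \<open>l\<close> of absolute value 1 the equation at the leaf is solvable
  without scaling, so the modulus stays prime; edge and vertex contributions cancel.\<close>

lemma prime_witness_leaf:
  assumes "finite V" "u \<notin> V" "w \<in> V" "edges_in V es" "\<bar>l\<bar> = 1" "prime_witness V es"
  shows "prime_witness (insert u V) ((u, l, w, m) # es)"
proof -
  obtain p q where p: "Factorial_Ring.prime p" "compat p q es" "excess p q V es > 0"
    using assms(6) by (auto simp: prime_witness_def)
  define q' where "q' = q(u := l * m * q w)"
  have q': "q' v = q v" if "v \<in> V" for v using that assms(2) by (auto simp: q'_def)
  have ll: "l * l = 1" using assms(5) by (metis abs_mult_self_eq mult.right_neutral)
  have lu: "l * q' u = m * q' w"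
    using q'[OF assms(3)] ll by (simp add: q'_def mult.assoc[symmetric])
  have 1: "compat p q' ((u, l, w, m) # es)"
    using p(2) compat_cong[OF assms(4) q'] lu by simp
  have "gcd (l * q' u) p = gcd (q' u) p" using assms(5) by (cases "l = 1") (auto simp: abs_if split: if_splits)
  then have "excess p q' (insert u V) ((u, l, w, m) # es) > 0"
    using p(3) excess_leaf[OF assms(1,2,4) q', where N = p and e = "(u, l, w, m)"] by simp
  then show ?thesis using 1 p(1) by (auto simp: prime_witness_def)
qed

lemma prime_witness_perm:
  "prime_witness V (e # e' # es) \<longleftrightarrow> prime_witness V (e' # e # es)"
  by (simp add: prime_witness_def excess_def compat_def conj_left_commute add.left_commute)

text \<open>The old root \<open>w\<close> becomes the first leaf attached to the new root
  \<open>u\<close>. Its entry has the ends exchanged and stands at the end of the list, since lists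
  grow at the front.\<close>

lemma grow_graft:
  assumes "grow w V es" "u \<notin> V" "l \<noteq> 0" "m \<noteq> 0"
  shows "grow u (insert u V) (es @ [(w, m, u, l)])"
  using assms
proof (induction rule: grow.induct)
  case grow_root
  then have "grow u (insert w {u}) [(w, m, u, l)]" by (intro grow.intros) auto
  then show ?case by (simp add: insert_commute)
next
  case (grow_leaf V es u' w' l' m')
  then have "grow u (insert u' (insert u V)) ((u', l', w', m') # es @ [(w, m, u, l)])"
    by (intro grow.intros) auto
  then show ?case by (simp add: insert_commute)
qed

text \<open>Changing the root reverses the edges on the path to it. \<open>wt\<close> looks at the
  first end only, so the weights survive a reversal just for compatible \<open>q\<close>; hence the
  shape of the last clause.\<close>

lemma grow_reroot:
  assumes "grow r V es" "x \<in> V"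
  shows "\<exists>es'. grow x V es' \<and>
    (\<forall>(u, l, w, m)\<in>set es'. (u, l, w, m) \<in> set es \<or> (w, m, u, l) \<in> set es) \<and>
    (\<forall>N q. compat N q es' \<longrightarrow> compat N q es \<and>
      sum_list (map (wt N q) es) = sum_list (map (wt N q) es'))"
  using assms
proof (induction arbitrary: x rule: grow.induct)
  case grow_root
  then show ?case by (auto intro!: exI[of _ "[]"] grow.intros)
next
  case (grow_leaf V es u w l m)
  show ?case
  proof (cases "x = u")
    case False
    then obtain es' where es': "grow x V es'"
      "\<forall>(u, l, w, m)\<in>set es'. (u, l, w, m) \<in> set es \<or> (w, m, u, l) \<in> set es"
      "\<forall>N q. compat N q es' \<longrightarrow> compat N q es \<and>
        sum_list (map (wt N q) es) = sum_list (map (wt N q) es')"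
      using grow_leaf.IH[of x] grow_leaf.prems by blast
    have "grow x (insert u V) ((u, l, w, m) # es')"
      using es'(1) grow_leaf.hyps by (intro grow.intros) auto
    then show ?thesis using es'(2,3) by (intro exI[of _ "(u, l, w, m) # es'"]) auto
  next
    case True
    obtain es' where es': "grow w V es'"
      "\<forall>(u, l, w, m)\<in>set es'. (u, l, w, m) \<in> set es \<or> (w, m, u, l) \<in> set es"
      "\<forall>N q. compat N q es' \<longrightarrow> compat N q es \<and>
        sum_list (map (wt N q) es) = sum_list (map (wt N q) es')"
      using grow_leaf.IH[of w] grow_leaf.hyps by blast
    have "compat N q ((u, l, w, m) # es) \<and>
        sum_list (map (wt N q) ((u, l, w, m) # es)) = sum_list (map (wt N q) (es' @ [(w, m, u, l)]))"
      if "compat N q (es' @ [(w, m, u, l)])" for N q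
    proof -
      have c: "compat N q es'" "N dvd m * q w - l * q u" using that by (auto simp: compat_def)
      then show ?thesis
        using es'(3) gcd_eq_if_dvd_diff[OF c(2)] by (simp add: dvd_diff_commute)
    qed
    moreover have "grow x (insert u V) (es' @ [(w, m, u, l)])"
      unfolding True using es'(1) grow_leaf.hyps by (intro grow_graft) auto
    ultimately show ?thesis using es'(2) by (intro exI[of _ "es' @ [(w, m, u, l)]"]) auto
  qed
qed

text \<open>Sending a single generator of order \<open>p\<close> to a nonzero element and all others to \<open>0\<close>.\<close>

lemma prime_witness_indicator:
  assumes "Factorial_Ring.prime p" "finite V" "u \<in> V" "length es \<ge> card V"
    and "\<forall>(v, l, w, m)\<in>set es. (v = u \<longrightarrow> p dvd l) \<and> (w = u \<longrightarrow> p dvd m)"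
  shows "prime_witness V es"
proof -
  define q :: "_ \<Rightarrow> int" where "q v = (if v = u then 1 else 0)" for v
  have p: "p > 1" using assms(1) prime_gt_1_int by blast
  have d: "p dvd l * q v \<and> p dvd m * q w" if "(v, l, w, m) \<in> set es" for v l w m
    using that assms(5) by (force simp: q_def)
  then have "compat p q es" by (auto simp: compat_def)
  have "sum_list (map (wt p q) es) = sum_list (map (\<lambda>_. p) es)"
    by (intro arg_cong[of _ _ sum_list] map_cong)
      (use d p in \<open>auto simp: wt_def gcd_proj2_iff\<close>)
  then have "sum_list (map (wt p q) es) = p * int (length es)"
    by (simp add: sum_list_triv mult.commute)
  moreover have "(\<Sum>v\<in>V. gcd (q v) p) = (\<Sum>v\<in>V - {u}. p) + 1"
    using assms(2,3) p by (subst sum.remove[of V u]) (auto simp: q_def)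
  \<comment> \<open>All edges and all vertices except \<open>u\<close> count \<open>p\<close>, while
    \<open>u\<close> counts 1. With at least \<open>card V\<close> edges the excess is at least
    \<open>p - 1\<close>.\<close>
  ultimately have "excess p q V es = p * int (length es) - p * int (card V - 1) - 1"
    using assms(2,3) by (simp add: excess_def)
  moreover have "p * int (card V) \<le> p * int (length es)" using assms(4) p by simp
  moreover have "card V \<ge> 1" using assms(2,3) by (metis One_nat_def Suc_leI card_gt_0_iff empty_iff)
  then have "p * int (card V - 1) = p * int (card V) - p" by (simp add: of_nat_diff algebra_simps)
  ultimately have "excess p q V es > 0" using p by linarith
  with \<open>compat p q es\<close> assms(1) show ?thesis by (auto simp: prime_witness_def)
qed

lemma gcd_prime_int: "Factorial_Ring.prime p \<Longrightarrow> gcd x p = (if p dvd x then p else 1)" for p x :: int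
  by (auto simp: gcd_proj2_iff prime_ge_0_int coprime_iff_gcd_eq_1[symmetric] prime_imp_coprime coprime_commute)

lemma ex_prime_dvd:
  fixes a b :: int
  assumes "a \<noteq> 0" "\<not> coprime a b"
  obtains p where "Factorial_Ring.prime p" "p dvd a" "p dvd b"
proof -
  have "gcd a b \<noteq> 0" "\<not> is_unit (gcd a b)" using assms by (auto simp: is_unit_gcd)
  then obtain p where "Factorial_Ring.prime p" "p dvd gcd a b" by (metis prime_divisor_exists)
  then show ?thesis using that by auto
qed

text \<open>The degree two vertex \<open>u\<close> is contracted and has to be restored. As its two
  labels are coprime, the Bezout combination \<open>\<alpha> * l * q r + \<beta> * m' * q w\<close>
  solves both congruences at \<open>u\<close> at once.\<close>

lemma prime_witness_merge:
  assumes V: "finite V" "u \<notin> V" "r \<in> V" "w \<in> V" "edges_in V es" and cop: "coprime m l'"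
    and wit: "prime_witness V ((r, l * l', w, m * m') # es)"
  shows "prime_witness (insert u V) ((r, l, u, m) # (u, l', w, m') # es)"
proof -
  obtain p q where p: "Factorial_Ring.prime p" and c: "p dvd l * l' * q r - m * m' * q w" "compat p q es"
    and ex: "excess p q V ((r, l * l', w, m * m') # es) > 0"
    using wit by (auto simp: prime_witness_def)
  obtain \<alpha> \<beta> where "\<alpha> * m + \<beta> * l' = gcd m l'" using bezout_int by blast
  then have \<alpha>\<beta>: "\<alpha> * m + \<beta> * l' = 1" using cop by simp
  define q' where "q' = q(u := \<alpha> * l * q r + \<beta> * m' * q w)"
  have q': "q' v = q v" if "v \<in> V" for v using that V(2) by (auto simp: q'_def)
  have qu: "q' u = \<alpha> * l * q r + \<beta> * m' * q w" by (simp add: q'_def)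
  have "l * q r - m * q' u = (\<alpha> * m + \<beta> * l') * l * q r - m * q' u" using \<alpha>\<beta> by simp
  also have "\<dots> = \<beta> * (l * l' * q r - m * m' * q w)" unfolding qu by (simp add: algebra_simps)
  finally have c1: "p dvd l * q' r - m * q' u" using c(1) q'[OF V(3)] by simp
  have "l' * q' u - m' * q w = l' * q' u - (\<alpha> * m + \<beta> * l') * m' * q w" using \<alpha>\<beta> by simp
  also have "\<dots> = \<alpha> * (l * l' * q r - m * m' * q w)" unfolding qu by (simp add: algebra_simps)
  finally have c2: "p dvd l' * q' u - m' * q' w" using c(1) q'[OF V(4)] by simp
  have comp: "compat p q' ((r, l, u, m) # (u, l', w, m') # es)"
    using c1 c2 c(2) compat_cong[OF V(5) q'] by simp
  have g1: "gcd (l * q' r) p = gcd (m * q' u) p" using c1 by (rule gcd_eq_if_dvd_diff)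
  have "p dvd l' * (l * q' r - m * q' u)" using c1 by simp
  then have "p dvd l * l' * q r - l' * m * q' u" using q'[OF V(3)] by (simp add: algebra_simps)
  then have g2: "gcd (l * l' * q r) p = gcd (l' * m * q' u) p" by (rule gcd_eq_if_dvd_diff)
  have "\<not> (p dvd m \<and> p dvd l')" using cop p by (meson coprime_common_divisor not_prime_unit)
  \<comment> \<open>Since \<open>p\<close> divides at most one of \<open>m\<close> and
    \<open>l'\<close>, one of the two edge weights equals the vertex weight and cancels it; the
    other is the weight of the merged edge.\<close>
  then have "gcd (m * q' u) p + gcd (l' * q' u) p - gcd (q' u) p = gcd (l' * m * q' u) p"
    using p by (auto simp: gcd_prime_int prime_dvd_mult_iff)
  then have "wt p q' (r, l, u, m) + wt p q' (u, l', w, m') - gcd (q' u) p = wt p q (r, l * l', w, m * m')"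
    using g1 g2 by simp
  moreover have "excess p q' (insert u V) ((r, l, u, m) # (u, l', w, m') # es)
      = wt p q' (r, l, u, m) + excess p q' (insert u V) ((u, l', w, m') # es)"
    by (simp add: excess_def)
  moreover have "excess p q V ((r, l * l', w, m * m') # es) = wt p q (r, l * l', w, m * m') + excess p q V es"
    by (simp add: excess_def)
  ultimately have "excess p q' (insert u V) ((r, l, u, m) # (u, l', w, m') # es) > 0"
    using ex excess_leaf[OF V(1,2,5) q', where N = p and e = "(u, l', w, m')"] by simp
  then show ?thesis using comp p by (auto simp: prime_witness_def)
qed

section \<open>Consequences of having no witness, for a spanning tree with at most one extra
  edge\<close>

context group
begin

lemma int_pow_unit_root:
  assumes "x \<in> carrier G" "y \<in> carrier G" "x [^] l = y [^] (m::int)" "\<bar>l::int\<bar> = 1"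
  shows "x = y [^] (l * m)"
proof -
  have ll: "l * l = 1" using assms(4) by (metis abs_mult_self_eq mult.right_neutral)
  have "x = x [^] (l * l)" using assms(1) ll by simp
  also have "\<dots> = (y [^] m) [^] l" using assms by (simp flip: int_pow_pow)
  also have "\<dots> = y [^] (l * m)" using assms(2) by (simp add: int_pow_pow mult.commute)
  finally show ?thesis .
qed

lemma coprime_powers_in_subgroup:
  assumes "subgroup K G" "x \<in> carrier G" "x [^] (m::int) \<in> K" "x [^] (l::int) \<in> K" "coprime m l"
  shows "x \<in> K"
proof -
  obtain \<alpha> \<beta> where "\<alpha> * m + \<beta> * l = gcd m l" using bezout_int by blast
  then have "x = x [^] (\<alpha> * m + \<beta> * l)" using assms(2,5) by simp
  also have "\<dots> = (x [^] m) [^] \<alpha> \<otimes> (x [^] l) [^] \<beta>"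
    using assms(2) by (simp add: int_pow_mult int_pow_pow mult.commute)
  also have "\<dots> \<in> K"
    using assms subgroup_int_pow_closed subgroup.m_closed by metis
  finally show ?thesis .
qed

text \<open>
  Induction on the spanning tree: when the leaf \<open>u\<close> carries the end of the extra edge, the extra edge
  is replaced by its composite with the tree edge at \<open>u\<close>. The absence of a witness at \<open>u\<close> makes the
  two labels at \<open>u\<close> coprime, which puts \<open>a u\<close> into the subgroup generated by \<open>a r\<close> and \<open>t\<close>.
\<close>

lemma circuit_cases:
  assumes "grow r V es" and "\<And>v. a v \<in> carrier G" and t: "t \<in> carrier G"
    and "\<forall>(u, l, w, m)\<in>set es. a u [^] l = a w [^] m"
    and "y \<in> V" "l \<noteq> 0" "m \<noteq> 0" "t \<otimes> a r [^] l \<otimes> inv t = a y [^] m"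
    and "\<not> prime_witness V ((r, l, y, m) # es)"
  shows "\<exists>L M. L \<noteq> 0 \<and> M \<noteq> 0 \<and> coprime L M \<and> t \<otimes> a r [^] (L::int) \<otimes> inv t = a r [^] (M::int) \<and>
    a ` V \<subseteq> generate G {a r, t}"
  using assms(1,4-)
proof (induction arbitrary: y l m rule: grow.induct)
  case grow_root
  \<comment> \<open>Here the extra edge is a loop at \<open>r\<close>. A prime dividing both of its
    labels would allow the indicator of \<open>r\<close> as a witness.\<close>
  have "coprime l m"
  proof (rule ccontr)
    assume "\<not> coprime l m"
    then obtain p where p: "Factorial_Ring.prime p" "p dvd l" "p dvd m"
      using ex_prime_dvd grow_root by blast
    have "prime_witness {r} [(r, l, y, m)]"
      using p by (intro prime_witness_indicator[of p _ r]) auto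
    then show False using grow_root by simp
  qed
  then show ?case using grow_root by (auto intro: generate.incl)
next
  case (grow_leaf V es u w l' m')
  note gf = grow_facts[OF grow_leaf.hyps(1)]
  have ac: "a v \<in> carrier G" for v by (rule assms(2))
  have rV: "r \<noteq> u" using gf(2) grow_leaf.hyps(2) by auto
  have rel': "\<forall>(u, l, w, m)\<in>set es. a u [^] l = a w [^] m" and relu: "a u [^] l' = a w [^] m'"
    using grow_leaf.prems(1) by auto
  let ?K = "generate G {a r, t}"
  have sK: "subgroup ?K G" using ac t by (intro generate_is_subgroup) auto
  have arK: "a r \<in> ?K" "t \<in> ?K" by (auto intro: generate.incl)
  have noth: "\<forall>(v, k, z, n)\<in>set es. (v = u \<longrightarrow> p dvd k) \<and> (z = u \<longrightarrow> p dvd n)" for p :: int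
    using gf(3) grow_leaf.hyps(2) by (force simp: edges_in_def)
  have len: "length ((r, l, y, m) # (u, l', w, m') # es) \<ge> card (insert u V)"
    using gf(1,4) grow_leaf.hyps(2) by simp
  have wu: "w \<noteq> u" using grow_leaf.hyps(2,3) by auto
  show ?case
  proof (cases "y = u")
    case True
    have cop: "coprime m l'"
    proof (rule ccontr)
      assume "\<not> coprime m l'"
      then obtain p where p: "Factorial_Ring.prime p" "p dvd m" "p dvd l'"
        using ex_prime_dvd grow_leaf.prems by blast
      have "prime_witness (insert u V) ((r, l, y, m) # (u, l', w, m') # es)"
        using p gf(1) len rV wu noth[of p] by (intro prime_witness_indicator[of p _ u]) auto
      then show False using grow_leaf.prems by simp
    qed
    have "t \<otimes> a r [^] (l * l') \<otimes> inv t = (t \<otimes> a r [^] l \<otimes> inv t) [^] l'"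
      using ac t by (simp add: conj_int_pow[symmetric] int_pow_pow)
    also have "\<dots> = (a u [^] l') [^] m"
      using grow_leaf.prems(5) True ac by (simp add: int_pow_pow mult.commute)
    also have "\<dots> = a w [^] (m * m')" unfolding relu using ac by (simp add: int_pow_pow mult.commute)
    finally have rel2: "t \<otimes> a r [^] (l * l') \<otimes> inv t = a w [^] (m * m')" .
    have npw: "\<not> prime_witness V ((r, l * l', w, m * m') # es)"
      using prime_witness_merge[OF gf(1) grow_leaf.hyps(2) gf(2) grow_leaf.hyps(3) gf(3) cop, of l m']
        grow_leaf.prems(6) True by blast
    have ne: "l * l' \<noteq> 0" "m * m' \<noteq> 0" using grow_leaf.prems(3,4) grow_leaf.hyps(4,5) by auto
    obtain L M :: int where LM: "L \<noteq> 0" "M \<noteq> 0" "coprime L M"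
      "t \<otimes> a r [^] L \<otimes> inv t = a r [^] M" "a ` V \<subseteq> ?K"
      using grow_leaf.IH[OF rel' grow_leaf.hyps(3) ne rel2 npw] by blast
    have "a u [^] m \<in> ?K"
      using grow_leaf.prems(5)[symmetric] True arK subgroup_int_pow_closed[OF sK arK(1), of l]
      by (simp add: subgroup.m_closed[OF sK] subgroup.m_inv_closed[OF sK])
    moreover have "a u [^] l' \<in> ?K"
      unfolding relu using LM(5) grow_leaf.hyps(3) by (intro subgroup_int_pow_closed[OF sK]) auto
    ultimately have "a u \<in> ?K" using coprime_powers_in_subgroup[OF sK ac _ _ cop] by blast
    with LM show ?thesis by blast
  next
    case False
    then have yV: "y \<in> V" using grow_leaf.prems by auto
    \<comment> \<open>The extra edge does not touch \<open>u\<close>, so \<open>l'\<close> is the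
      only label there, and a prime dividing it would make the indicator of \<open>u\<close> a
      witness.\<close>
    have l1: "\<bar>l'\<bar> = 1"
    proof (rule ccontr)
      assume "\<bar>l'\<bar> \<noteq> 1"
      then obtain p where p: "Factorial_Ring.prime p" "p dvd l'"
        using prime_divisor_exists[of l'] grow_leaf.hyps(4) by auto
      have "prime_witness (insert u V) ((r, l, y, m) # (u, l', w, m') # es)"
        using p gf(1) len rV wu False noth[of p] by (intro prime_witness_indicator[of p _ u]) auto
      then show False using grow_leaf.prems by simp
    qed
    have npw: "\<not> prime_witness V ((r, l, y, m) # es)"
    proof
      assume "prime_witness V ((r, l, y, m) # es)"
      then have "prime_witness (insert u V) ((u, l', w, m') # (r, l, y, m) # es)"
        using gf yV grow_leaf.hyps l1 by (intro prime_witness_leaf) auto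
      then show False using grow_leaf.prems(6) prime_witness_perm by blast
    qed
    obtain L M :: int where LM: "L \<noteq> 0" "M \<noteq> 0" "coprime L M"
      "t \<otimes> a r [^] L \<otimes> inv t = a r [^] M" "a ` V \<subseteq> ?K"
      using grow_leaf.IH[OF rel' yV grow_leaf.prems(3,4,5) npw] by blast
    have "a u = a w [^] (l' * m')" by (rule int_pow_unit_root[OF ac ac relu l1])
    then have "a u \<in> ?K"
      using LM(5) grow_leaf.hyps(3) subgroup_int_pow_closed[OF sK] by auto
    with LM show ?thesis by blast
  qed
qed

text \<open>The exponents \<open>x\<close> with respect to the generator \<open>a v\<close> form a
  homomorphism to the integers, compatible modulo every \<open>k\<close> and onto because of
  \<open>x v = 1\<close>. The bound \<open>- 1\<close> says that the first Betti number of each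
  resulting quotient graph is nonnegative; it is carried along because the next leaf needs it
  quantitatively.\<close>

definition cyclic_tree :: "('v \<Rightarrow> 'a) \<Rightarrow> 'v set \<Rightarrow> 'v lab_edge list \<Rightarrow> bool" where
  "cyclic_tree a V es \<longleftrightarrow> (\<exists>v\<in>V. \<exists>x. x v = 1 \<and> (\<forall>z\<in>V. x z \<noteq> 0 \<and> a z = a v [^] x z) \<and>
    (\<forall>(u, l, w, m)\<in>set es. l * x u = m * x w) \<and> (\<forall>k>0. excess k x V es \<ge> - 1))"

text \<open>
  Under \<open>klein_tree\<close> the elements \<open>a z\<close> generate a quotient of the Klein bottle group \<open>BS 1 (- 1)\<close>.
\<close>

definition klein_tree :: "('v \<Rightarrow> 'a) \<Rightarrow> 'v set \<Rightarrow> 'v lab_edge list \<Rightarrow> bool" where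
  "klein_tree a V es \<longleftrightarrow> (\<exists>v\<in>V. \<exists>v'\<in>V. \<exists>\<epsilon>\<in>{1, -1::int}. \<exists>x.
    a v [^] (2::int) = a v' [^] (2 * \<epsilon>) \<and>
    (\<forall>z\<in>V. x z \<noteq> 0 \<and> (a z = a v [^] x z \<or> a z = a v' [^] x z)) \<and>
    compat 2 x es \<and> excess 2 x V es \<ge> 0)"

lemma cyclic_treeI:
  assumes "v \<in> V" "x v = 1" "\<And>z. z \<in> V \<Longrightarrow> x z \<noteq> 0" "\<And>z. z \<in> V \<Longrightarrow> a z = a v [^] x z"
    "\<And>u l w m. (u, l, w, m) \<in> set es \<Longrightarrow> l * x u = m * x w"
    "\<And>k. k > 0 \<Longrightarrow> excess k x V es \<ge> - 1"
  shows "cyclic_tree a V es"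
  unfolding cyclic_tree_def
  by (rule bexI[OF _ assms(1)], rule exI[of _ x]) (use assms(2-) in blast)

lemma klein_treeI:
  assumes "v \<in> V" "v' \<in> V" "\<epsilon> \<in> {1, -1::int}" "a v [^] (2::int) = a v' [^] (2 * \<epsilon>)"
    "\<And>z. z \<in> V \<Longrightarrow> x z \<noteq> 0" "\<And>z. z \<in> V \<Longrightarrow> a z = a v [^] x z \<or> a z = a v' [^] x z"
    "compat 2 x es" "excess 2 x V es \<ge> 0"
  shows "klein_tree a V es"
  unfolding klein_tree_def
  by (rule bexI[OF _ assms(1)], rule bexI[OF _ assms(2)], rule bexI[OF _ assms(3)],
      rule exI[of _ x]) (use assms(4-) in blast)

text \<open>Expressed in the generator \<open>a v\<close>, the new relation is
  \<open>a\<^sub>u\<^sup>l = a\<^sub>v\<^sup>k\<close> with \<open>k = m * x w\<close>. A label of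
  absolute value 1 keeps the group cyclic, and two labels of absolute value 2 give the Klein bottle
  relation. Otherwise, sending \<open>a v\<close> to \<open>l\<close> and \<open>a u\<close> to
  \<open>k\<close> modulo \<open>\<bar>l\<bar> * \<bar>k\<bar>\<close> is a witness.\<close>

lemma cyclic_tree_leaf:
  assumes V: "finite V" "u \<notin> V" "w \<in> V" "l \<noteq> 0" "m \<noteq> 0" "edges_in V es"
    and ac: "\<And>v. a v \<in> carrier G" and rel: "a u [^] l = a w [^] m"
    and cyc: "cyclic_tree a V es" and nw: "\<not> witness (insert u V) ((u, l, w, m) # es)"
  shows "cyclic_tree a (insert u V) ((u, l, w, m) # es) \<or> klein_tree a (insert u V) ((u, l, w, m) # es)"
proof -
  obtain v x where v: "v \<in> V" "x v = 1" and x: "\<And>z. z \<in> V \<Longrightarrow> x z \<noteq> 0 \<and> a z = a v [^] x z"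
    and xe: "\<forall>(u, l, w, m)\<in>set es. l * x u = m * x w" and ex: "\<And>k. k > 0 \<Longrightarrow> excess k x V es \<ge> - 1"
    using cyc unfolding cyclic_tree_def by blast
  define k where "k = m * x w"
  have k0: "k \<noteq> 0" using V x by (simp add: k_def)
  have relk: "a u [^] l = a v [^] k"
  proof -
    have "a w [^] m = (a v [^] x w) [^] m" using x[OF V(3)] by simp
    also have "\<dots> = a v [^] k" using ac by (simp add: int_pow_pow k_def mult.commute)
    finally show ?thesis using rel by simp
  qed
  have xe': "l' * x u' = m' * x w' \<and> u' \<noteq> u \<and> w' \<noteq> u" if "(u', l', w', m') \<in> set es" for u' l' w' m'
    using xe V(2,6) that by (auto simp: edges_in_def)
  have upd: "(x(u := b)) z = x z" if "z \<in> V" for z b using that V(2) by auto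
  consider "\<bar>l\<bar> = 1" | "\<bar>k\<bar> = 1" | "\<bar>l\<bar> = 2" "\<bar>k\<bar> = 2" | "\<bar>l\<bar> \<ge> 2" "\<bar>k\<bar> \<ge> 2" "\<bar>l\<bar> + \<bar>k\<bar> > 4"
    using V(4) k0 by linarith
  then show ?thesis
  proof cases
    case 1
    have ll: "l * l = 1" using 1 by (metis abs_mult_self_eq mult.right_neutral)
    let ?x = "x(u := l * k)"
    have "l * ?x u = m * ?x w" using ll V(2,3) by (simp add: k_def mult.assoc[symmetric]) (auto simp: k_def)
    moreover have "a u = a v [^] (l * k)" by (rule int_pow_unit_root[OF ac ac relk 1])
    moreover have "excess j ?x (insert u V) ((u, l, w, m) # es) \<ge> - 1" if j: "j > 0" for j
    proof -
      have "gcd (l * (l * k)) j = gcd (l * k) j" using 1 by (cases "l = 1") (auto simp: abs_if split: if_splits)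
      then show ?thesis
        using excess_leaf[of V u es ?x x j "(u, l, w, m)", OF V(1,2,6) upd] ex[OF j] by simp
    qed
    moreover have "l' * ?x u' = m' * ?x w'" if "(u', l', w', m') \<in> set ((u, l, w, m) # es)" for u' l' w' m'
      using xe'[of u' l' w' m'] that calculation(1) by (auto simp del: fun_upd_apply simp: fun_upd_other)
    moreover have "?x z \<noteq> 0 \<and> a z = a v [^] ?x z" if z: "z \<in> insert u V" for z
    proof (cases "z = u")
      case True
      then show ?thesis using calculation(2) V(4) k0 by simp
    next
      case False
      then show ?thesis using x[of z] z by simp
    qed
    moreover have "?x v = 1" "v \<in> insert u V" using v upd[OF v(1)] by simp_all
    ultimately have "cyclic_tree a (insert u V) ((u, l, w, m) # es)"
      by (intro cyclic_treeI[of v _ ?x]) blast+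
    then show ?thesis ..
  next
    case 2
    have kk: "k * k = 1" using 2 by (metis abs_mult_self_eq mult.right_neutral)
    \<comment> \<open>Now \<open>a v\<close> is the power \<open>k * l\<close> of
      \<open>a u\<close>, so \<open>u\<close> becomes the base vertex and all old exponents are
      multiplied by \<open>l * k\<close>.\<close>
    define y where "y z = (if z = u then 1 else l * k * x z)" for z
    have yV: "y z = l * k * x z" if "z \<in> V" for z using that V(2) by (auto simp: y_def)
    have av: "a v = a u [^] (k * l)" by (rule int_pow_unit_root[OF ac ac relk[symmetric] 2])
    have "a z = a u [^] y z" if "z \<in> V" for z
      using x[OF that] av ac yV[OF that] by (simp add: int_pow_pow mult.commute)
    moreover have "l * y u = m * y w"
      using yV[OF V(3)] kk by (simp add: y_def k_def algebra_simps)
    moreover have "\<forall>(u, l, w, m)\<in>set es. l * y u = m * y w"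
      using xe V(6) yV by (fastforce simp: edges_in_def)
    moreover have "excess j y (insert u V) ((u, l, w, m) # es) \<ge> - 1" if j: "j > 0" for j
    proof -
      \<comment> \<open>The old part scales to at least \<open>- d\<close>, and the new edge minus
        the new vertex contributes \<open>d - 1\<close>; this restores the bound
        \<open>- 1\<close>.\<close>
      define d where "d = gcd (l * k) j"
      have d0: "d > 0" using j by (simp add: d_def)
      have "j div d > 0" using j d0 unfolding d_def by (simp add: pos_imp_zdiv_pos_iff zdvd_imp_le)
      then have "d * excess (j div d) x V es \<ge> d * (- 1)"
        using ex d0 by (intro mult_left_mono) auto
      moreover have "excess j (\<lambda>z. l * k * x z) V es = d * excess (j div d) x V es"
        unfolding d_def by (rule excess_scale[OF j])
      moreover have "gcd l j = d" unfolding d_def using 2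
        by (cases "k = 1") (auto simp: abs_if split: if_splits)
      ultimately show ?thesis
        using excess_leaf[OF V(1,2,6), of y "\<lambda>z. l * k * x z" j "(u, l, w, m)"] yV by (simp add: y_def)
    qed
    moreover have "y z \<noteq> 0" if "z \<in> V" for z
      using x[OF that] yV[OF that] V(4) k0 by simp
    moreover have "y u = 1" "a u = a u [^] y u" "u \<in> insert u V" using ac by (simp_all add: y_def)
    moreover from this have "y u \<noteq> 0" by simp
    moreover have "l' * y u' = m' * y w'" if "(u', l', w', m') \<in> set ((u, l, w, m) # es)" for u' l' w' m'
      using calculation(2,3) that by auto
    ultimately have "cyclic_tree a (insert u V) ((u, l, w, m) # es)"
      by (intro cyclic_treeI[of u _ y]) blast+
    then show ?thesis ..
  next
    case 3
    \<comment> \<open>Both labels are 2 up to sign, and \<open>\<epsilon>\<close> records whether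
      the signs agree.\<close>
    define \<epsilon> where "\<epsilon> = (if l = k then 1 else - 1 :: int)"
    let ?x = "x(u := 1)"
    have av: "a v [^] (2::int) = a u [^] (2 * \<epsilon>)"
    proof -
      have "k = 2 \<and> l = 2 * \<epsilon> \<or> k = -2 \<and> l = - (2 * \<epsilon>)" using 3 by (auto simp: \<epsilon>_def)
      then show ?thesis using relk ac by (metis int_pow_neg int_pow_closed inv_inv)
    qed
    have "compat 2 x es" using xe' by (intro compat_if_eq) blast
    then have c2: "compat 2 ?x es" using compat_cong[of V es ?x x 2, OF V(6) upd] by simp
    have d2: "2 dvd l" "2 dvd k" using 3 by (metis abs_dvd_iff dvd_refl dvd_abs_iff)+
    have "l * ?x u - m * ?x w = l - k" using V(2,3) by (auto simp: k_def)
    then have "2 dvd l * ?x u - m * ?x w" using d2 by (metis dvd_diff)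
    with c2 have "compat 2 ?x ((u, l, w, m) # es)" by (simp only: compat_Cons)
    moreover have "excess 2 ?x (insert u V) ((u, l, w, m) # es) \<ge> 0"
    proof -
      have "gcd l 2 = 2" using gcd_proj2_if_dvd[OF d2(1)] by simp
      then show ?thesis
        using excess_leaf[of V u es ?x x 2 "(u, l, w, m)", OF V(1,2,6) upd] ex[of 2] by simp
    qed
    moreover have "?x z \<noteq> 0 \<and> (a z = a v [^] ?x z \<or> a z = a u [^] ?x z)" if "z \<in> insert u V" for z
    proof (cases "z = u")
      case True
      then show ?thesis using ac by simp
    next
      case False
      then show ?thesis using x[of z] that by simp
    qed
    moreover note av
    moreover have "v \<in> insert u V" "u \<in> insert u V" "\<epsilon> \<in> {1, - 1}" using v by (auto simp: \<epsilon>_def)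
    ultimately have "klein_tree a (insert u V) ((u, l, w, m) # es)"
      by (intro klein_treeI[of v _ u \<epsilon> _ ?x]) blast+
    then show ?thesis ..
  next
    case 4
    \<comment> \<open>These values solve the new relation exactly and not only modulo
      \<open>?N\<close>.\<close>
    define y where "y z = (if z = u then k else l * x z)" for z
    have yV: "y z = l * x z" if "z \<in> V" for z using that V(2) by (auto simp: y_def)
    let ?N = "\<bar>l\<bar> * \<bar>k\<bar>"
    have N0: "?N > 0" using V(4) k0 by simp
    have "compat ?N y ((u, l, w, m) # es)"
    proof -
      have "\<forall>(u, l, w, m)\<in>set es. l * y u = m * y w"
        using xe V(6) yV by (fastforce simp: edges_in_def)
      then have "compat ?N y es" by (intro compat_if_eq) blast
      moreover have "l * y u = m * y w" using yV[OF V(3)] by (simp add: y_def k_def)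
      ultimately show ?thesis by simp
    qed
    moreover have "excess ?N y (insert u V) ((u, l, w, m) # es) > 0"
    proof -
      have "excess ?N (\<lambda>z. l * x z) V es = \<bar>l\<bar> * excess \<bar>k\<bar> x V es"
        using excess_scale[OF N0, of l x] V(4) by (simp add: gcd.commute)
      moreover have "\<bar>l\<bar> * excess \<bar>k\<bar> x V es \<ge> \<bar>l\<bar> * (- 1)"
        using ex[of "\<bar>k\<bar>"] k0 by (intro mult_left_mono) auto
      moreover have "gcd k ?N = \<bar>k\<bar>" "gcd (l * k) ?N = ?N"
        using gcd_proj1_if_dvd[of k ?N] gcd_proj1_if_dvd[of "l * k" ?N] by (simp_all flip: abs_mult)
      \<comment> \<open>The excess is at least \<open>\<bar>l\<bar> * \<bar>k\<bar> - \<bar>k\<bar>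
        - \<bar>l\<bar>\<close>, which is this product minus 1. For two labels of absolute value 2
        the bound would be 0.\<close>
      moreover have "(\<bar>l\<bar> - 1) * (\<bar>k\<bar> - 1) > 1"
      proof -
        consider "\<bar>l\<bar> \<ge> 3" "\<bar>k\<bar> \<ge> 2" | "\<bar>l\<bar> \<ge> 2" "\<bar>k\<bar> \<ge> 3" using 4 by linarith
        then show ?thesis
        proof cases
          case 1
          then have "2 * 1 \<le> (\<bar>l\<bar> - 1) * (\<bar>k\<bar> - 1)" by (intro mult_mono) auto
          then show ?thesis by simp
        next
          case 2
          then have "1 * 2 \<le> (\<bar>l\<bar> - 1) * (\<bar>k\<bar> - 1)" by (intro mult_mono) auto
          then show ?thesis by simp
        qed
      qed
      moreover have "excess ?N y (insert u V) ((u, l, w, m) # es)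
          = wt ?N y (u, l, w, m) - gcd (y u) ?N + excess ?N (\<lambda>z. l * x z) V es"
        by (rule excess_leaf[OF V(1,2,6) yV])
      moreover have "wt ?N y (u, l, w, m) = gcd (l * k) ?N" "gcd (y u) ?N = gcd k ?N" by (simp_all add: y_def)
      moreover have "(\<bar>l\<bar> - 1) * (\<bar>k\<bar> - 1) = ?N - \<bar>l\<bar> - \<bar>k\<bar> + 1" by (simp add: left_diff_distrib right_diff_distrib)
      ultimately show ?thesis by linarith
    qed
    ultimately show ?thesis using nw N0 unfolding witness_def by blast
  qed
qed

text \<open>The excess modulo 2 is already nonnegative, so any strictly positive contribution of a
  leaf is fatal: if \<open>\<bar>l\<bar>\<close> is not 1, scaling by \<open>l\<close> gives a
  witness modulo \<open>2 * \<bar>l\<bar>\<close>. Hence the leaf is a power of its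
  neighbour.\<close>

lemma klein_tree_leaf:
  assumes V: "finite V" "u \<notin> V" "w \<in> V" "l \<noteq> 0" "m \<noteq> 0" "edges_in V es"
    and ac: "\<And>v. a v \<in> carrier G" and rel: "a u [^] l = a w [^] m"
    and kl: "klein_tree a V es" and nw: "\<not> witness (insert u V) ((u, l, w, m) # es)"
  shows "klein_tree a (insert u V) ((u, l, w, m) # es)"
proof -
  obtain v v' x \<epsilon> where v: "v \<in> V" "v' \<in> V" "\<epsilon> \<in> {1, -1::int}" "a v [^] (2::int) = a v' [^] (2 * \<epsilon>)"
    and x: "\<And>z. z \<in> V \<Longrightarrow> x z \<noteq> 0 \<and> (a z = a v [^] x z \<or> a z = a v' [^] x z)"
    and xc: "compat 2 x es" and ex: "excess 2 x V es \<ge> 0"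
    using kl unfolding klein_tree_def by blast
  define k where "k = m * x w"
  have k0: "k \<noteq> 0" using V x by (simp add: k_def)
  show ?thesis
  proof (cases "\<bar>l\<bar> = 1")
    case True
    let ?x = "x(u := l * k)"
    have upd: "?x z = x z" if "z \<in> V" for z using that V(2) by auto
    have ll: "l * l = 1" using True by (metis abs_mult_self_eq mult.right_neutral)
    have "l * ?x u = m * ?x w" using ll upd[OF V(3)] by (simp add: k_def mult.assoc[symmetric])
    then have "compat 2 ?x ((u, l, w, m) # es)" using xc compat_cong[of V es ?x x 2, OF V(6) upd] by simp
    moreover have "a u = a v [^] (l * k) \<or> a u = a v' [^] (l * k)"
    proof -
      have "a u = a w [^] (l * m)" by (rule int_pow_unit_root[OF ac ac rel True])
      moreover have "l * k = x w * (l * m)" by (simp add: k_def)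
      ultimately show ?thesis using x[OF V(3)] ac int_pow_pow by metis
    qed
    moreover have "gcd (l * (l * k)) 2 = gcd (l * k) 2" using True by (cases "l = 1") (auto simp: abs_if split: if_splits)
    then have "excess 2 ?x (insert u V) ((u, l, w, m) # es) \<ge> 0"
      using excess_leaf[of V u es ?x x 2 "(u, l, w, m)", OF V(1,2,6) upd] ex by simp
    moreover have "?x z \<noteq> 0 \<and> (a z = a v [^] ?x z \<or> a z = a v' [^] ?x z)" if z: "z \<in> insert u V" for z
    proof (cases "z = u")
      case True
      then show ?thesis using calculation(2) V(4) k0 by simp
    next
      case False
      then show ?thesis using x[of z] z by simp
    qed
    ultimately show ?thesis
      using v by (intro klein_treeI[of v _ v' \<epsilon> _ ?x]) blast+
  next
    case False
    \<comment> \<open>Modulo \<open>2 * \<bar>l\<bar>\<close> only the parity of \<open>k\<close>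
      matters in \<open>l * k\<close>. Replacing \<open>k\<close> by 1 or 2 makes the vertex gcd
      equal to \<open>b\<close>, against \<open>b * \<bar>l\<bar>\<close> for the edge.\<close>
    define b where "b = (if even k then 2 else 1 :: int)"
    define y where "y z = (if z = u then b else l * x z)" for z
    have yV: "y z = l * x z" if "z \<in> V" for z using that V(2) by (auto simp: y_def)
    let ?N = "2 * \<bar>l\<bar>"
    have N0: "?N > 0" using V(4) by simp
    have l2: "\<bar>l\<bar> \<ge> 2" using False V(4) by linarith
    have "even (b - k)" by (simp add: b_def)
    then have "l * 2 dvd l * (b - k)" by (intro mult_dvd_mono) auto
    moreover have "l * y u - m * y w = l * (b - k)"
      using yV[OF V(3)] by (simp add: y_def k_def algebra_simps)
    ultimately have "?N dvd l * y u - m * y w" by (metis abs_dvd_iff abs_mult abs_numeral mult.commute)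
    moreover have "?N = \<bar>l * 2\<bar>" by (simp add: abs_mult)
    then have "compat ?N (\<lambda>z. l * x z) es"
      using compat_scale[OF xc, of l] unfolding compat_def by (simp only: abs_dvd_iff)
    then have "compat ?N y es" using compat_cong[of V es y "\<lambda>z. l * x z" ?N, OF V(6) yV] by blast
    moreover have "excess ?N y (insert u V) ((u, l, w, m) # es) > 0"
    proof -
      have "gcd l ?N = \<bar>l\<bar>" using gcd_proj1_if_dvd[of l ?N] by simp
      then have "excess ?N (\<lambda>z. l * x z) V es \<ge> 0"
        using excess_scale[OF N0, of l x] V(4) ex by simp
      moreover have "gcd (l * b) ?N = b * \<bar>l\<bar>"
      proof -
        have "l * b dvd \<bar>l\<bar> * 2" by (rule mult_dvd_mono) (auto simp: b_def)
        then have "l * b dvd ?N" by (simp add: mult.commute)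
        then show ?thesis using gcd_proj1_if_dvd[of "l * b" ?N] by (simp add: abs_mult b_def)
      qed
      moreover have "gcd b ?N = b" by (simp add: b_def)
      moreover have "b * \<bar>l\<bar> > b" using l2 by (auto simp: b_def)
      moreover have "excess ?N y (insert u V) ((u, l, w, m) # es)
          = wt ?N y (u, l, w, m) - gcd (y u) ?N + excess ?N (\<lambda>z. l * x z) V es"
        by (rule excess_leaf[OF V(1,2,6) yV])
      moreover have "wt ?N y (u, l, w, m) = gcd (l * b) ?N" "gcd (y u) ?N = gcd b ?N" by (simp_all add: y_def)
      ultimately show ?thesis by linarith
    qed
    ultimately show ?thesis using nw N0 unfolding witness_def compat_Cons by blast
  qed
qed

lemma tree_cases:
  assumes "grow r V es" and ac: "\<And>v. a v \<in> carrier G"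
    and "\<forall>(u, l, w, m)\<in>set es. a u [^] l = a w [^] m" and "\<not> witness V es"
  shows "cyclic_tree a V es \<or> klein_tree a V es"
  using assms(1,3,4)
proof (induction rule: grow.induct)
  case grow_root
  have "cyclic_tree a {r} []" unfolding cyclic_tree_def
    using ac by (intro bexI[of _ r] exI[of _ "\<lambda>_. 1"]) (auto simp: excess_def)
  then show ?case ..
next
  case (grow_leaf V es u w l m)
  note gf = grow_facts[OF grow_leaf.hyps(1)]
  have "\<not> witness V es" using witness_leaf[OF gf(1) grow_leaf.hyps(2,3) gf(3)] grow_leaf by blast
  then have "cyclic_tree a V es \<or> klein_tree a V es" using grow_leaf by auto
  then show ?case
    using cyclic_tree_leaf[OF gf(1) grow_leaf.hyps(2-5) gf(3), of a, OF ac]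
      klein_tree_leaf[OF gf(1) grow_leaf.hyps(2-5) gf(3), of a, OF ac] grow_leaf.prems by auto
qed

end

section \<open>Group actions on trees\<close>

text \<open>A walk returning to a visited vertex is cut back to the first visit. The clause on
  \<open>Range R\<close> later bounds the depth of the vertices on the path.\<close>

lemma rtrancl_distinct_path:
  assumes "(x, y) \<in> R\<^sup>*"
  shows "\<exists>p. p \<noteq> [] \<and> hd p = x \<and> last p = y \<and> distinct p \<and> successively (\<lambda>a b. (a, b) \<in> R) p
    \<and> set p \<subseteq> insert x (Range R)"
  using assms
proof (induction rule: rtrancl_induct)
  case base
  show ?case by (rule exI[of _ "[x]"]) simp
next
  case (step y z)
  then obtain p where p: "p \<noteq> []" "hd p = x" "last p = y" "distinct p"
    "successively (\<lambda>a b. (a, b) \<in> R) p" "set p \<subseteq> insert x (Range R)" by blast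
  show ?case
  proof (cases "z \<in> set p")
    case True
    then obtain p1 p2 where s: "p = p1 @ z # p2" by (meson split_list)
    have "successively (\<lambda>a b. (a, b) \<in> R) (p1 @ [z])"
      using p(5) unfolding s by (auto simp: successively_append_iff successively_Cons)
    then show ?thesis using p s by (intro exI[of _ "p1 @ [z]"]) (cases p1; auto)
  next
    case False
    then show ?thesis using p step.hyps(2)
      by (intro exI[of _ "p @ [z]"]) (auto simp: successively_append_iff)
  qed
qed

locale rooted_tree =
  fixes V :: "'v set" and E :: "'v set set" and r :: 'v
  assumes tree: "is_tree V E" and root: "r \<in> V"
begin

abbreviation R :: "('v \<times> 'v) set" where "R \<equiv> {(u, v). {u, v} \<in> E}"

definition depth :: "'v \<Rightarrow> nat" where "depth x = (LEAST n. (r, x) \<in> R ^^ n)"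

definition parent :: "'v \<Rightarrow> 'v" where "parent x = (SOME y. {y, x} \<in> E \<and> depth x = Suc (depth y))"

lemma edge_neq: "{x, y} \<in> E \<Longrightarrow> x \<noteq> y"
proof -
  assume "{x, y} \<in> E"
  then obtain a b where "{x, y} = {a, b}" "a \<noteq> b"
    using tree unfolding is_tree_def by blast
  then show ?thesis by (auto simp: doubleton_eq_iff)
qed

lemma no_cycle:
  assumes "3 \<le> length c" "distinct c" "successively (\<lambda>a b. {a, b} \<in> E) c" "{last c, hd c} \<in> E"
  shows False
proof -
  have "{c ! i, c ! (Suc i mod length c)} \<in> E" if "i < length c" for i
  proof (cases "Suc i < length c")
    case True
    then show ?thesis using assms(3) by (simp add: successively_conv_nth)
  next
    case False
    then have "Suc i = length c" using that by simp
    moreover from this have "i = length c - 1" by simp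
    moreover have "c \<noteq> []" using assms(1) by auto
    ultimately show ?thesis using assms(4) by (simp add: hd_conv_nth last_conv_nth)
  qed
  then show False using tree assms(1,2) unfolding is_tree_def by blast
qed

lemma depth_attained: assumes "x \<in> V" shows "(r, x) \<in> R ^^ depth x"
proof -
  have "(r, x) \<in> R\<^sup>*" using tree root assms unfolding is_tree_def by blast
  then obtain n where "(r, x) \<in> R ^^ n" by (metis rtrancl_imp_relpow)
  then show ?thesis unfolding depth_def by (rule LeastI)
qed

lemma depth_le: "(r, x) \<in> R ^^ n \<Longrightarrow> depth x \<le> n"
  unfolding depth_def by (rule Least_le)

lemma edge_V: assumes "{x, y} \<in> E" shows "x \<in> V" "y \<in> V"
proof -
  obtain a b where "{x, y} = {a, b}" "a \<in> V" "b \<in> V"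
    using tree assms unfolding is_tree_def by blast
  then show "x \<in> V" "y \<in> V" by (auto simp: doubleton_eq_iff)
qed

lemma depth_edge: assumes "{x, y} \<in> E" shows "depth y \<le> Suc (depth x)"
proof (rule depth_le)
  show "(r, y) \<in> R ^^ Suc (depth x)"
    using depth_attained[OF edge_V(1)[OF assms]] assms by (auto intro: relcompI)
qed

lemma depth_zero: "x \<in> V \<Longrightarrow> depth x = 0 \<Longrightarrow> x = r"
  using depth_attained by fastforce

lemma parent: assumes "x \<in> V" "x \<noteq> r" shows "{parent x, x} \<in> E \<and> depth x = Suc (depth (parent x))"
proof -
  obtain n where n: "depth x = Suc n" using depth_zero assms by (cases "depth x") auto
  then have "(r, x) \<in> R ^^ Suc n" using depth_attained[OF assms(1)] by simp
  then obtain y where y: "(r, y) \<in> R ^^ n" "{y, x} \<in> E" by auto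
  then have "depth y \<le> n" "depth x \<le> Suc (depth y)" using depth_le depth_edge by blast+
  then have "depth x = Suc (depth y)" using n by simp
  with y(2) have "\<exists>y. {y, x} \<in> E \<and> depth x = Suc (depth y)" by blast
  then show ?thesis unfolding parent_def by (rule someI_ex)
qed

definition ball_edges :: "nat \<Rightarrow> ('v \<times> 'v) set" where
  "ball_edges n = {(u, v). {u, v} \<in> E \<and> depth u \<le> n \<and> depth v \<le> n}"

lemma ball_connected:
  assumes "x \<in> V" "depth x \<le> n"
  shows "(r, x) \<in> (ball_edges n)\<^sup>*"
  using assms
proof (induction "depth x" arbitrary: x)
  case 0
  then show ?case using depth_zero by auto
next
  case (Suc k)
  then have "x \<noteq> r" using depth_le[of r 0] by auto
  then have p: "{parent x, x} \<in> E" "depth x = Suc (depth (parent x))" using parent Suc by blast+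
  then have "(r, parent x) \<in> (ball_edges n)\<^sup>*" using Suc edge_V by auto
  moreover have "(parent x, x) \<in> ball_edges n" using p Suc by (auto simp: ball_edges_def)
  ultimately show ?case by (rule rtrancl_into_rtrancl)
qed

lemma ball_path:
  assumes "x \<in> V" "depth x \<le> n" "y \<in> V" "depth y \<le> n"
  shows "\<exists>p. p \<noteq> [] \<and> hd p = x \<and> last p = y \<and> distinct p \<and> successively (\<lambda>a b. {a, b} \<in> E) p
    \<and> (\<forall>z\<in>set p. depth z \<le> n)"
proof -
  have "sym (ball_edges n)" by (auto simp: sym_def ball_edges_def insert_commute)
  then have "(x, r) \<in> (ball_edges n)\<^sup>*" using ball_connected[OF assms(1,2)] by (meson symD sym_rtrancl)
  then have "(x, y) \<in> (ball_edges n)\<^sup>*" using ball_connected[OF assms(3,4)] by (rule rtrancl_trans)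
  then obtain p where p: "p \<noteq> []" "hd p = x" "last p = y" "distinct p"
    "successively (\<lambda>a b. (a, b) \<in> ball_edges n) p" "set p \<subseteq> insert x (Range (ball_edges n))"
    using rtrancl_distinct_path[of x y "ball_edges n"] by blast
  have "successively (\<lambda>a b. {a, b} \<in> E) p"
    using p(5) by (rule successively_mono) (auto simp: ball_edges_def)
  moreover have "\<forall>z\<in>set p. depth z \<le> n" using p(6) assms(2) by (auto simp: ball_edges_def)
  ultimately show ?thesis using p by blast
qed

text \<open>If \<open>x\<close> were not the parent of \<open>y\<close>, a cycle would arise. For
  different depths it runs from \<open>x\<close> to the parent of \<open>y\<close> and through
  \<open>y\<close>; for equal depths it runs through \<open>x\<close>, \<open>y\<close> and a path
  between their parents. The ball containing that path excludes the deeper vertices, so all vertices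
  are distinct.\<close>

lemma edge_parent_aux:
  assumes e: "{x, y} \<in> E" and le: "depth x \<le> depth y"
  shows "y \<noteq> r \<and> x = parent y"
proof -
  note V = edge_V[OF e]
  have yr: "y \<noteq> r"
  proof
    assume "y = r"
    then have "depth x = 0" using le depth_le[of r 0] by simp
    then show False using depth_zero V edge_neq[OF e] \<open>y = r\<close> by blast
  qed
  note py = parent[OF V(2) yr]
  have "x = parent y"
  proof (rule ccontr)
    assume ne: "x \<noteq> parent y"
    have "depth y \<le> Suc (depth x)" by (rule depth_edge[OF e])
    then consider "depth y = Suc (depth x)" | "depth y = depth x" using le by linarith
    then show False
    proof cases
      case 1
      then have "depth (parent y) \<le> depth x" using py by simp
      then obtain p where p: "p \<noteq> []" "hd p = x" "last p = parent y" "distinct p"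
        "successively (\<lambda>a b. {a, b} \<in> E) p" "\<forall>z\<in>set p. depth z \<le> depth x"
        using ball_path[OF V(1) order.refl edge_V(1)[of "parent y" y]] py by blast
      have "length p \<noteq> 1" using p(1-3) ne by (cases p) auto
      then have "length p \<ge> 2" using p(1) by (cases p; cases "tl p") auto
      show False
      proof (rule no_cycle[of "p @ [y]"])
        show "distinct (p @ [y])" using p 1 by auto
        show "successively (\<lambda>a b. {a, b} \<in> E) (p @ [y])"
          using p py by (auto simp: successively_append_iff)
        show "{last (p @ [y]), hd (p @ [y])} \<in> E" using p(1,2) e by (simp add: insert_commute)
      qed (use \<open>length p \<ge> 2\<close> in simp)
    next
      case 2
      have xr: "x \<noteq> r" using 2 py depth_le[of r 0] by auto
      note px = parent[OF V(1) xr]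
      have "depth (parent x) = depth (parent y)" using 2 px py by simp
      then obtain p where p: "p \<noteq> []" "hd p = parent x" "last p = parent y" "distinct p"
        "successively (\<lambda>a b. {a, b} \<in> E) p" "\<forall>z\<in>set p. depth z \<le> depth (parent y)"
        using ball_path[of "parent x" "depth (parent y)" "parent y"] edge_V(1) px py by (metis order.refl)
      show False
      proof (rule no_cycle[of "x # p @ [y]"])
        show "3 \<le> length (x # p @ [y])" using p(1) by (cases p) auto
        show "distinct (x # p @ [y])" using p 2 py edge_neq[OF e] by auto
        show "successively (\<lambda>a b. {a, b} \<in> E) (x # p @ [y])"
          using p px py by (auto simp: successively_append_iff successively_Cons insert_commute)
        show "{last (x # p @ [y]), hd (x # p @ [y])} \<in> E" using e by (simp add: insert_commute)
      qed
    qed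
  qed
  with yr show ?thesis by blast
qed

lemma edge_parent: "{x, y} \<in> E \<Longrightarrow> y \<noteq> r \<and> x = parent y \<or> x \<noteq> r \<and> y = parent x"
  using edge_parent_aux[of x y] edge_parent_aux[of y x] by (metis insert_commute linear)

end

text \<open>Since every edge joins a vertex to its parent, labels can be multiplied up along the way
  from the root without any consistency condition. This is the simple connectivity of the
  tree.\<close>

lemma tree_potential:
  fixes lab :: "'v \<Rightarrow> 'v \<Rightarrow> 'f"
  assumes "is_tree V E" and F: "group F"
    and lab: "\<And>x y. {x, y} \<in> E \<Longrightarrow> lab x y \<in> carrier F" "\<And>x y. {x, y} \<in> E \<Longrightarrow> lab y x = inv\<^bsub>F\<^esub> lab x y"
  obtains f where "\<And>x. x \<in> V \<Longrightarrow> f x \<in> carrier F"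
    "\<And>x y. {x, y} \<in> E \<Longrightarrow> f y = f x \<otimes>\<^bsub>F\<^esub> lab x y"
proof -
  obtain r where "r \<in> V" using assms(1) unfolding is_tree_def by blast
  then interpret rooted_tree V E r using assms(1) by unfold_locales
  interpret F: group F by (rule F)
  \<comment> \<open>The recursion runs on the depth, with the vertex as an argument that moves to
    the parent.\<close>
  define f where "f x = rec_nat (\<lambda>_. \<one>\<^bsub>F\<^esub>) (\<lambda>_ g x. g (parent x) \<otimes>\<^bsub>F\<^esub> lab (parent x) x) (depth x) x" for x
  have fpar: "f x = f (parent x) \<otimes>\<^bsub>F\<^esub> lab (parent x) x" if "x \<in> V" "x \<noteq> r" for x
    using parent[OF that] by (simp add: f_def)
  have fr: "f r = \<one>\<^bsub>F\<^esub>" using depth_le[of r 0] by (simp add: f_def)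
  have fc: "f x \<in> carrier F" if "x \<in> V" for x
    using that
  proof (induction "depth x" arbitrary: x rule: less_induct)
    case less
    show ?case
    proof (cases "x = r")
      case False
      note p = parent[OF less.prems False]
      have "f (parent x) \<in> carrier F" using p edge_V by (intro less.hyps) auto
      then show ?thesis using fpar[OF less.prems False] lab(1) p by simp
    qed (simp add: fr)
  qed
  have "f y = f x \<otimes>\<^bsub>F\<^esub> lab x y" if e: "{x, y} \<in> E" for x y
    using edge_parent[OF e]
  proof
    assume "y \<noteq> r \<and> x = parent y"
    then show ?thesis using fpar edge_V[OF e] by blast
  next
    assume a: "x \<noteq> r \<and> y = parent x"
    then have "f x = f y \<otimes>\<^bsub>F\<^esub> lab y x" using fpar edge_V[OF e] by blast
    moreover have e': "{y, x} \<in> E" using e by (simp add: insert_commute)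
    ultimately have "f x \<otimes>\<^bsub>F\<^esub> lab x y = f y \<otimes>\<^bsub>F\<^esub> lab y x \<otimes>\<^bsub>F\<^esub> inv\<^bsub>F\<^esub> lab y x"
      using lab(2)[OF e'] by simp
    also have "\<dots> = f y" using fc edge_V[OF e] lab(1)[OF e'] by (simp add: F.m_assoc)
    finally show ?thesis by simp
  qed
  with fc show ?thesis by (rule that)
qed

text \<open>Only pointwise laws on \<open>V\<close> are required, so that the same
  \<open>act\<close> can be used again for a subgroup or for an invariant subtree.\<close>

locale tree_action = group G for G (structure) +
  fixes V :: "'v set" and E :: "'v set set" and act :: "'a \<Rightarrow> 'v \<Rightarrow> 'v"
  assumes tree: "is_tree V E"
    and act_closed: "\<And>g x. g \<in> carrier G \<Longrightarrow> x \<in> V \<Longrightarrow> act g x \<in> V"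
    and act_one: "\<And>x. x \<in> V \<Longrightarrow> act \<one> x = x"
    and act_mult: "\<And>g h x. g \<in> carrier G \<Longrightarrow> h \<in> carrier G \<Longrightarrow> x \<in> V \<Longrightarrow> act (g \<otimes> h) x = act g (act h x)"
    and act_edge: "\<And>g x y. g \<in> carrier G \<Longrightarrow> {x, y} \<in> E \<Longrightarrow> {act g x, act g y} \<in> E"
    and no_inversion: "\<And>g x y. g \<in> carrier G \<Longrightarrow> {x, y} \<in> E \<Longrightarrow> act g x = y \<Longrightarrow> act g y \<noteq> x"
begin

lemma edge_V: assumes "{x, y} \<in> E" shows "x \<in> V" "y \<in> V"
proof -
  obtain a b where "{x, y} = {a, b}" "a \<in> V" "b \<in> V"
    using tree assms unfolding is_tree_def by blast
  then show "x \<in> V" "y \<in> V" by (auto simp: doubleton_eq_iff)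
qed

lemma connected: "x \<in> V \<Longrightarrow> y \<in> V \<Longrightarrow> (x, y) \<in> {(u, v). {u, v} \<in> E}\<^sup>*"
  using tree unfolding is_tree_def by blast

lemma act_inv: "g \<in> carrier G \<Longrightarrow> x \<in> V \<Longrightarrow> act (inv g) (act g x) = x"
  "g \<in> carrier G \<Longrightarrow> x \<in> V \<Longrightarrow> act g (act (inv g) x) = x"
  by (simp_all add: act_one flip: act_mult)

definition same_orbit :: "'v \<Rightarrow> 'v \<Rightarrow> bool" where
  "same_orbit x y \<longleftrightarrow> (\<exists>g\<in>carrier G. act g x = y)"

lemma same_orbit_act: "g \<in> carrier G \<Longrightarrow> x \<in> V \<Longrightarrow> same_orbit (act g x) y \<longleftrightarrow> same_orbit x y"
proof
  assume g: "g \<in> carrier G" and x: "x \<in> V"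
  show "same_orbit x y" if "same_orbit (act g x) y"
    using that g x unfolding same_orbit_def by (metis act_mult m_closed)
  show "same_orbit (act g x) y" if xy: "same_orbit x y"
  proof -
    obtain h where h: "h \<in> carrier G" "act h x = y" using xy by (auto simp: same_orbit_def)
    then have "act (h \<otimes> inv g) (act g x) = y" using g x by (simp add: act_mult act_inv act_closed)
    then show ?thesis using g h unfolding same_orbit_def by (intro bexI[of _ "h \<otimes> inv g"]) simp_all
  qed
qed

lemma same_orbit_sym: "x \<in> V \<Longrightarrow> same_orbit x y \<Longrightarrow> same_orbit y x"
  unfolding same_orbit_def using act_inv(1) by (metis inv_closed)

lemma edge_form: "e \<in> E \<Longrightarrow> \<exists>x y. e = {x, y}"
  using tree unfolding is_tree_def by blast

lemma edge_subset: "e \<in> E \<Longrightarrow> e \<subseteq> V"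
  using edge_form edge_V by blast

lemma act_image_mult:
  "g \<in> carrier G \<Longrightarrow> h \<in> carrier G \<Longrightarrow> e \<subseteq> V \<Longrightarrow> act (g \<otimes> h) ` e = act g ` (act h ` e)"
  unfolding image_image by (intro image_cong) (auto simp: act_mult)

lemma act_image_one: "e \<subseteq> V \<Longrightarrow> act \<one> ` e = e"
  using act_one by (force simp: image_iff)

lemma act_image_edge: "g \<in> carrier G \<Longrightarrow> e \<in> E \<Longrightarrow> act g ` e \<in> E"
  using edge_form act_edge by fastforce

text \<open>The predicate choosing \<open>rep x\<close> depends only on the orbit of
  \<open>x\<close>, which makes \<open>rep\<close> invariant.\<close>

lemma orbit_representatives:
  obtains rep h where "\<And>x. x \<in> V \<Longrightarrow> rep x \<in> V"
    "\<And>g x. g \<in> carrier G \<Longrightarrow> x \<in> V \<Longrightarrow> rep (act g x) = rep x"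
    "\<And>x. x \<in> V \<Longrightarrow> h x \<in> carrier G" "\<And>x. x \<in> V \<Longrightarrow> act (h x) (rep x) = x"
proof -
  define rep where "rep x = (SOME y. y \<in> V \<and> same_orbit x y)" for x
  have rep: "rep x \<in> V \<and> same_orbit x (rep x)" if "x \<in> V" for x
    unfolding rep_def
    by (rule someI[of _ x]) (use that act_one in \<open>auto simp: same_orbit_def intro!: bexI[of _ \<one>]\<close>)
  have rep_act: "rep (act g x) = rep x" if "g \<in> carrier G" "x \<in> V" for g x
    unfolding rep_def same_orbit_act[OF that] by (rule HOL.refl)
  define h where "h x = (SOME g. g \<in> carrier G \<and> act g (rep x) = x)" for x
  have h: "h x \<in> carrier G \<and> act (h x) (rep x) = x" if x: "x \<in> V" for x
  proof -
    obtain g where g: "g \<in> carrier G" "act g x = rep x" using rep[OF x] by (auto simp: same_orbit_def)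
    then have "act (inv g) (rep x) = x" using act_inv(1)[OF g(1) x] by simp
    then have "\<exists>g. g \<in> carrier G \<and> act g (rep x) = x" using g(1) by (intro exI[of _ "inv g"]) simp
    then show ?thesis unfolding h_def by (rule someI_ex)
  qed
  show ?thesis by (rule that[of rep h]) (use rep rep_act h in simp_all)
qed

text \<open>A maximal tree of the quotient graph lifts to the tree one vertex at a time. The orbits
  are described by an abstract colouring \<open>c\<close>, and \<open>P\<close> lets the caller
  attach labels to the chosen edges.\<close>

lemma spanning_tree:
  assumes c': "\<forall>x\<in>V. \<forall>y\<in>V. c x = c y \<longleftrightarrow> same_orbit x y"
    and fin: "finite (c ` V)" and r: "r \<in> V"
    and P: "\<forall>x y. {x, y} \<in> E \<longrightarrow> (\<exists>l m. l \<noteq> 0 \<and> m \<noteq> 0 \<and> P x l y m)"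
  shows "\<exists>S es. grow r S es \<and> S \<subseteq> V \<and> inj_on c S \<and> c ` S = c ` V \<and>
    (\<forall>(u, l, w, m)\<in>set es. {u, w} \<in> E \<and> P u l w m)"
proof -
  note c = c'[rule_format]
  define good where "good S es \<longleftrightarrow> grow r S es \<and> S \<subseteq> V \<and> inj_on c S \<and>
    (\<forall>(u, l, w, m)\<in>set es. {u, w} \<in> E \<and> P u l w m)" for S es
  have "\<exists>S es. good S es \<and> card S = Suc k" if "Suc k \<le> card (c ` V)" for k
    using that
  proof (induction k)
    case 0
    have "good {r} []" using r by (auto simp: good_def intro: grow.intros)
    then show ?case by (intro exI[of _ "{r}"] exI[of _ "[]"]) simp
  next
    case (Suc k)
    from Suc.prems have "Suc k \<le> card (c ` V)" by simp
    from Suc.IH[OF this] obtain S es where S: "good S es" "card S = Suc k" by blast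
    have sub: "S \<subseteq> V" and inj: "inj_on c S" and gr: "grow r S es" using S by (auto simp: good_def)
    have "c ` S \<noteq> c ` V" using Suc.prems S(2) card_image[OF inj] by auto
    then obtain z where z: "z \<in> V" "c z \<notin> c ` S" using sub by blast
    \<comment> \<open>A walk from \<open>r\<close> to a vertex of missing colour leaves the colours
      of \<open>S\<close> along some edge. A translate of that edge starts in \<open>S\<close> and
      adds a leaf.\<close>
    have "\<exists>x y. {x, y} \<in> E \<and> c x \<in> c ` S \<and> c y \<notin> c ` S"
      using connected[OF r z(1)] z(2)
    proof (induction rule: rtrancl_induct)
      case base
      then show ?case using grow_facts(2)[OF gr] by blast
    next
      case (step y z)
      then show ?case by blast
    qed
    then obtain x y s where xy: "{x, y} \<in> E" "s \<in> S" "c x = c s" "c y \<notin> c ` S" by auto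
    have xyV: "x \<in> V" "y \<in> V" "s \<in> V" using edge_V[OF xy(1)] xy(2) sub by auto
    then obtain g where g: "g \<in> carrier G" "act g x = s"
      using c xy(3) by (auto simp: same_orbit_def)
    define u where "u = act g y"
    have e: "{u, s} \<in> E" using act_edge[OF g(1) xy(1)] g(2) by (simp add: u_def insert_commute)
    have "c u = c y" using c[of y u] g xyV edge_V(1)[OF e] by (auto simp: u_def same_orbit_def)
    then have cu: "c u \<notin> c ` S" using xy(4) by simp
    then have "u \<notin> S" by blast
    obtain l m where lm: "l \<noteq> 0" "m \<noteq> 0" "P u l s m" using P e by blast
    have "good (insert u S) ((u, l, s, m) # es)"
      using S(1) cu \<open>u \<notin> S\<close> lm e edge_V[OF e] xy(2) by (auto simp: good_def intro: grow.intros)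
    moreover have "card (insert u S) = Suc (Suc k)"
      using S(2) \<open>u \<notin> S\<close> grow_facts(1)[OF gr] by simp
    ultimately show ?case by blast
  qed
  moreover have "card (c ` V) \<noteq> 0" using fin r by auto
  ultimately obtain S es where S: "good S es" "card S = card (c ` V)"
    by (metis Suc_pred' gr0I order.refl)
  have "c ` S = c ` V"
  proof (rule card_subset_eq[OF fin])
    show "c ` S \<subseteq> c ` V" "card (c ` S) = card (c ` V)"
      using S card_image[of c S] by (auto simp: good_def)
  qed
  then show ?thesis using S by (auto simp: good_def)
qed

lemma grow_const:
  assumes "grow r S es" "\<And>u l w m. (u, l, w, m) \<in> set es \<Longrightarrow> f u = f w" "s \<in> S"
  shows "f s = f r"
  using assms
proof (induction arbitrary: s rule: grow.induct)
  case grow_root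
  then show ?case by simp
next
  case (grow_leaf V es u w l m)
  have IH: "f s = f r" if "s \<in> V" for s
    using grow_leaf.IH[OF _ that] grow_leaf.prems(1) by (meson list.set_intros(2))
  have "f u = f w" using grow_leaf.prems(1) by (meson list.set_intros(1))
  then have "f u = f r" using IH[OF grow_leaf.hyps(3)] by simp
  then show ?case using IH grow_leaf.prems(2) by blast
qed

text \<open>
  Two edge orbits that are not needed to connect the quotient graph give a homomorphism onto a free
  group of rank two: label them by the two generators and all other edges trivially.
\<close>

lemma surj_free_group:
  fixes c :: "'v \<Rightarrow> 'c" and ce :: "'v set \<Rightarrow> 'e" and b b' :: 's
  assumes c': "\<forall>x\<in>V. \<forall>y\<in>V. c x = c y \<longleftrightarrow> same_orbit x y"
    and fin: "finite (c ` V)" and fine: "finite (ce ` E)" and card: "card (ce ` E) > card (c ` V)"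
    and ce: "\<And>g x y. g \<in> carrier G \<Longrightarrow> {x, y} \<in> E \<Longrightarrow> ce {act g x, act g y} = ce {x, y}"
  obtains h where "h \<in> hom G (free_group {b, b'})" "h ` carrier G = carrier (free_group {b, b'})"
proof -
  note c = c'[rule_format]
  obtain r where r: "r \<in> V" using tree unfolding is_tree_def by blast
  have one: "\<exists>(l :: int) (m :: int). l \<noteq> 0 \<and> m \<noteq> 0 \<and> True"
    by (intro exI[of _ 1] conjI) simp_all
  obtain S es where S: "grow r S es" "S \<subseteq> V" "inj_on c S" "c ` S = c ` V"
    and es: "\<forall>(u, l, w, m)\<in>set es. {u, w} \<in> E"
    using spanning_tree[OF c' fin r, of "\<lambda>_ _ _ _. True"] one by auto
  define T where "T = (\<lambda>(u, l :: int, w, m :: int). ce {u, w}) ` set es"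
  have "card T \<le> card (set es)" unfolding T_def by (rule card_image_le) simp
  moreover have "card (set es) \<le> length es" by (rule card_length)
  moreover have "Suc (length es) = card (c ` V)"
    using grow_facts(4)[OF S(1)] card_image[OF S(3)] S(4) by simp
  ultimately have T: "Suc (card T) \<le> card (c ` V)" by linarith
  have "finite T" by (simp add: T_def)
  then have "card (ce ` E - T) \<ge> card (ce ` E) - card T" by (rule diff_card_le_card_Diff)
  \<comment> \<open>The lifted tree uses one edge fewer than there are vertex orbits, so at least
    two edge orbits are left over.\<close>
  then have 2: "card (ce ` E - T) \<ge> 2" using T card by linarith
  then have "card (ce ` E - T) \<noteq> 0" by linarith
  then have "ce ` E - T \<noteq> {}" by (metis card.empty)
  then obtain C1 where C1: "C1 \<in> ce ` E - T" by blast
  have "card (ce ` E - T - {C1}) \<noteq> 0" using 2 C1 fine by (simp add: card_Diff_singleton)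
  then have "ce ` E - T - {C1} \<noteq> {}" by (metis card.empty)
  then obtain C2 where C2: "C2 \<in> ce ` E - T - {C1}" by blast
  have edge_form: "\<exists>u v. e = {u, v}" if "e \<in> E" for e
    using that tree unfolding is_tree_def by blast
  obtain u1 v1 where e1: "{u1, v1} \<in> E" "ce {u1, v1} = C1" using C1 edge_form by blast
  obtain u2 v2 where e2: "{u2, v2} \<in> E" "ce {u2, v2} = C2" using C2 edge_form by blast
  \<comment> \<open>Translates are taken with orientation. Absence of inversions is what keeps the
    two orientations of an edge apart and makes the labelling below antisymmetric.\<close>
  define orb where "orb u v x y \<longleftrightarrow> (\<exists>g\<in>carrier G. act g u = x \<and> act g v = y)" for u v x y
  have orb_edge: "{x, y} \<in> E \<and> ce {x, y} = ce {u, v}" if "orb u v x y" "{u, v} \<in> E" for u v x y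
    using that act_edge ce by (auto simp: orb_def)
  have orb_asym: "\<not> orb u v y x" if o: "orb u v x y" and e: "{u, v} \<in> E" for u v x y
  proof
    assume "orb u v y x"
    then obtain h where h: "h \<in> carrier G" "act h u = y" "act h v = x" by (auto simp: orb_def)
    obtain g where g: "g \<in> carrier G" "act g u = x" "act g v = y" using o by (auto simp: orb_def)
    note uv = edge_V[OF e]
    have "act (inv h \<otimes> g) u = v" "act (inv h \<otimes> g) v = u"
      using g h uv act_inv(1)[OF h(1)] by (simp_all add: act_mult) (metis)+
    then show False using no_inversion[OF _ e, of "inv h \<otimes> g"] g h by simp
  qed
  have orb_act: "orb u v (act g x) (act g y) \<longleftrightarrow> orb u v x y"
    if g: "g \<in> carrier G" and e: "{u, v} \<in> E" and xy: "x \<in> V" "y \<in> V" for u v g x y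
  proof
    assume "orb u v (act g x) (act g y)"
    then obtain h where h: "h \<in> carrier G" "act h u = act g x" "act h v = act g y" by (auto simp: orb_def)
    then have "act (inv g \<otimes> h) u = x" "act (inv g \<otimes> h) v = y"
      using g xy edge_V[OF e] by (simp_all add: act_mult act_inv)
    then show "orb u v x y" using g h by (auto simp: orb_def)
  next
    assume "orb u v x y"
    then obtain h where h: "h \<in> carrier G" "act h u = x" "act h v = y" by (auto simp: orb_def)
    then have "act (g \<otimes> h) u = act g x" "act (g \<otimes> h) v = act g y"
      using g edge_V[OF e] by (simp_all add: act_mult)
    then show "orb u v (act g x) (act g y)" using g h by (auto simp: orb_def)
  qed
  let ?F = "free_group {b, b'}"
  interpret F: group ?F unfolding free_group_def by (rule group_presented_group)
  define gX where "gX = word_class {b, b'} {} [(b, True)]"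
  define gY where "gY = word_class {b, b'} {} [(b', True)]"
  have gc: "gX \<in> carrier ?F" "gY \<in> carrier ?F"
    by (auto simp: gX_def gY_def free_group_def carrier_presented_group)
  define lab where "lab x y = (if orb u1 v1 x y then gX else if orb u1 v1 y x then inv\<^bsub>?F\<^esub> gX
    else if orb u2 v2 x y then gY else if orb u2 v2 y x then inv\<^bsub>?F\<^esub> gY else \<one>\<^bsub>?F\<^esub>)" for x y
  have lab_closed: "lab x y \<in> carrier ?F" for x y using gc by (simp add: lab_def)
  have lab_inv: "lab y x = inv\<^bsub>?F\<^esub> lab x y" for x y
    using orb_asym[OF _ e1(1)] orb_asym[OF _ e2(1)] gc by (auto simp: lab_def)
  obtain f where f: "\<And>x. x \<in> V \<Longrightarrow> f x \<in> carrier ?F" "\<And>x y. {x, y} \<in> E \<Longrightarrow> f y = f x \<otimes>\<^bsub>?F\<^esub> lab x y"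
    using tree_potential[OF tree F.group_axioms, of lab] lab_closed lab_inv by blast
  have lab_act: "lab (act g x) (act g y) = lab x y" if "g \<in> carrier G" "x \<in> V" "y \<in> V" for g x y
    using that by (simp add: lab_def orb_act e1 e2)
  \<comment> \<open>The labelling is invariant under the action, so the label product between two
    vertices does not change under translation.\<close>
  have inv_step: "inv\<^bsub>?F\<^esub> f x \<otimes>\<^bsub>?F\<^esub> f y = inv\<^bsub>?F\<^esub> f (act g x) \<otimes>\<^bsub>?F\<^esub> f (act g y)"
    if g: "g \<in> carrier G" and x: "x \<in> V" and y: "y \<in> V" for g x y
    using connected[OF x y]
  proof (induction rule: rtrancl_induct)
    case base
    then show ?case using f(1) act_closed g x by simp
  next
    case (step y z)
    then have e: "{y, z} \<in> E" by simp
    note yz = edge_V[OF e]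
    have "inv\<^bsub>?F\<^esub> f x \<otimes>\<^bsub>?F\<^esub> f z = (inv\<^bsub>?F\<^esub> f x \<otimes>\<^bsub>?F\<^esub> f y) \<otimes>\<^bsub>?F\<^esub> lab y z"
      using f(1) x yz lab_closed by (simp add: f(2)[OF e] F.m_assoc)
    also have "\<dots> = inv\<^bsub>?F\<^esub> f (act g x) \<otimes>\<^bsub>?F\<^esub> f (act g y) \<otimes>\<^bsub>?F\<^esub> lab (act g y) (act g z)"
      using step.IH lab_act[OF g yz] by simp
    also have "\<dots> = inv\<^bsub>?F\<^esub> f (act g x) \<otimes>\<^bsub>?F\<^esub> f (act g z)"
      using f(1) act_closed[OF g] x yz lab_closed
      by (simp add: f(2)[OF act_edge[OF g e]] F.m_assoc)
    finally show ?case .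
  qed
  \<comment> \<open>The label product of the path from \<open>r\<close> to its translate; by
    \<open>inv_step\<close>, concatenating paths becomes multiplication.\<close>
  define \<rho> where "\<rho> g = inv\<^bsub>?F\<^esub> f r \<otimes>\<^bsub>?F\<^esub> f (act g r)" for g
  have \<rho>_hom: "\<rho> \<in> hom G ?F"
  proof (rule homI)
    fix g assume g: "g \<in> carrier G"
    show "\<rho> g \<in> carrier ?F" using f(1) act_closed g r by (simp add: \<rho>_def)
    fix h assume h: "h \<in> carrier G"
    have "\<rho> g \<otimes>\<^bsub>?F\<^esub> \<rho> h = inv\<^bsub>?F\<^esub> f r \<otimes>\<^bsub>?F\<^esub> f (act g r) \<otimes>\<^bsub>?F\<^esub>
        (inv\<^bsub>?F\<^esub> f (act g r) \<otimes>\<^bsub>?F\<^esub> f (act g (act h r)))"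
      using inv_step[OF g r act_closed[OF h r]] by (simp add: \<rho>_def)
    also have "\<dots> = \<rho> (g \<otimes> h)"
      using f(1) act_closed g h r by (simp add: \<rho>_def F.m_assoc F.mult_inv_cancel act_mult)
    finally show "\<rho> (g \<otimes> h) = \<rho> g \<otimes>\<^bsub>?F\<^esub> \<rho> h" by simp
  qed
  have fS: "f s = f r" if "s \<in> S" for s
  proof (rule grow_const[OF S(1) _ that])
    fix u l w m assume a: "(u, l, w, m) \<in> set es"
    then have e: "{u, w} \<in> E" using es by blast
    have t: "ce {u, w} \<in> T" "ce {w, u} \<in> T" using a by (force simp: T_def insert_commute)+
    have "\<not> orb u1 v1 u w" "\<not> orb u1 v1 w u" "\<not> orb u2 v2 u w" "\<not> orb u2 v2 w u"
      using orb_edge e1 e2 C1 C2 t by (metis DiffD1 DiffD2)+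
    then have "lab u w = \<one>\<^bsub>?F\<^esub>" by (simp add: lab_def)
    then show "f u = f w" using f(2)[OF e] f(1) edge_V[OF e] by simp
  qed
  \<comment> \<open>After a translation the edge starts at some \<open>s\<close> in \<open>S\<close>
    and ends in \<open>act h s'\<close> with \<open>s'\<close> in \<open>S\<close>. As
    \<open>f\<close> is constant on \<open>S\<close>, the element \<open>h\<close> has the label of
    the edge as its value.\<close>
  have hit: "\<exists>k\<in>carrier G. \<rho> k = lab u v" if e: "{u, v} \<in> E" for u v
  proof -
    note uv = edge_V[OF e]
    obtain s g where s: "s \<in> S" "g \<in> carrier G" "act g u = s"
      using c S(2,4) uv(1) unfolding same_orbit_def by (metis (no_types, lifting) imageE imageI subsetD)
    obtain s' h where s': "s' \<in> S" "h \<in> carrier G" "act h s' = act g v"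
      using c S(2,4) act_closed[OF s(2) uv(2)] unfolding same_orbit_def
      by (metis (no_types, lifting) imageE imageI subsetD)
    have sV: "s \<in> V" "s' \<in> V" using s s' S(2) by auto
    have "inv\<^bsub>?F\<^esub> f s' \<otimes>\<^bsub>?F\<^esub> f r = inv\<^bsub>?F\<^esub> f (act h s') \<otimes>\<^bsub>?F\<^esub> f (act h r)"
      by (rule inv_step[OF s'(2) sV(2) r])
    moreover have "inv\<^bsub>?F\<^esub> f s' \<otimes>\<^bsub>?F\<^esub> f r = \<one>\<^bsub>?F\<^esub>" using fS[OF s'(1)] f(1) r by simp
    ultimately have "f (act h r) = f (act h s')"
      using f(1) act_closed[OF s'(2)] r sV
      by (metis F.inv_closed F.inv_equality F.inv_inv F.l_inv F.r_inv F.inv_solve_left' F.r_one)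
    also have "\<dots> = f s \<otimes>\<^bsub>?F\<^esub> lab (act g u) (act g v)"
      unfolding s'(3) using f(2)[OF act_edge[OF s(2) e]] s(3) by simp
    also have "\<dots> = f r \<otimes>\<^bsub>?F\<^esub> lab u v" using fS[OF s(1)] lab_act[OF s(2) uv] by simp
    finally have "\<rho> h = lab u v"
      using f(1) r lab_closed by (simp add: \<rho>_def F.mult_inv_cancel)
    then show ?thesis using s'(2) by blast
  qed
  have "orb u1 v1 u1 v1" "orb u2 v2 u2 v2"
    using act_one edge_V e1(1) e2(1) by (auto simp: orb_def intro!: bexI[of _ \<one>])
  moreover have "\<not> orb u1 v1 u2 v2" "\<not> orb u1 v1 v2 u2"
    using orb_edge[OF _ e1(1)] e1(2) e2(2) C2 by (metis DiffD2 insert_commute singletonI)+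
  ultimately have "lab u1 v1 = gX" "lab u2 v2 = gY" by (simp_all add: lab_def)
  then have gen: "gX \<in> \<rho> ` carrier G" "gY \<in> \<rho> ` carrier G"
    using hit[OF e1(1)] hit[OF e2(1)] by force+
  interpret \<rho>: group_hom G ?F \<rho> using \<rho>_hom by unfold_locales
  have "carrier ?F \<subseteq> \<rho> ` carrier G"
  proof
    fix A assume "A \<in> carrier ?F"
    then obtain w where w: "w \<in> words {b, b'}" "A = word_class {b, b'} {} w"
      by (auto simp: free_group_def carrier_presented_group)
    have "word_eval ?F (\<lambda>x. word_class {b, b'} {} [(x, True)]) w \<in> \<rho> ` carrier G"
      by (rule word_eval_in_subgroup[OF F.group_axioms \<rho>.img_is_subgroup _ w(1)])
        (use gen in \<open>auto simp: gX_def gY_def\<close>)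
    then show "A \<in> \<rho> ` carrier G" using w by (simp add: free_group_def word_eval_cls_generators)
  qed
  then have "\<rho> ` carrier G = carrier ?F" using \<rho>.hom_closed by blast
  then show ?thesis using \<rho>_hom that by blast
qed

end

section \<open>From a surjection onto a free group of rank two to largeness\<close>

lemma free_group_not_comm:
  assumes "b \<noteq> b'"
  shows "\<not> comm_group (free_group {b, b'})"
proof
  assume "comm_group (free_group {b, b'})"
  then interpret F: comm_group "free_group {b, b'}" .
  let ?K = "sym_group 3"
  interpret K: group ?K by (rule sym_group_is_group)
  define f where "f z = (if z = b then transpose 1 2 else transpose 2 3 :: nat \<Rightarrow> nat)" for z
  have f: "f \<in> {b, b'} \<rightarrow> carrier ?K"
    by (auto simp: f_def sym_group_carrier intro!: permutes_swap_id)
  obtain h where h: "h \<in> hom (free_group {b, b'}) ?K"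
    "\<And>w. w \<in> words {b, b'} \<Longrightarrow> h (word_class {b, b'} {} w) = word_eval ?K f w"
    using presented_group_universal[OF sym_group_is_group f, of "{}"] unfolding free_group_def by blast
  interpret h: group_hom "free_group {b, b'}" ?K h using h(1) by unfold_locales
  have c: "word_class {b, b'} {} [(z, True)] \<in> carrier (free_group {b, b'})" if "z \<in> {b, b'}" for z
    using that by (auto simp: free_group_def carrier_presented_group)
  have hz: "h (word_class {b, b'} {} [(z, True)]) = f z" if "z \<in> {b, b'}" for z
    using h(2)[of "[(z, True)]"] that by (auto simp: sym_group_one sym_group_mult)
  have "f b \<circ> f b' = f b' \<circ> f b"
    using h.hom_mult[OF c[of b] c[of b']] h.hom_mult[OF c[of b'] c[of b]] F.m_comm[OF c[of b] c[of b']]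
    by (simp add: hz sym_group_mult)
  from fun_cong[OF this, of 1] show False using assms by (simp add: f_def transpose_def)
qed

text \<open>The letters have type \<open>'a set\<close> because the elements of the factor group are
  cosets, and \<open>is_free_group\<close> takes its basis in the element type.\<close>

lemma (in group) large_groupI:
  assumes H: "subgroup H G" "finite (rcosets H)"
    and h: "h \<in> hom (G\<lparr>carrier := H\<rparr>) (free_group {b, b' :: 'a set})"
      "h ` H = carrier (free_group {b, b'})" and "b \<noteq> b'"
  shows "large_group G"
proof -
  let ?H = "G\<lparr>carrier := H\<rparr>" and ?F = "free_group {b, b'}"
  interpret H: group ?H by (rule subgroup_imp_group[OF H(1)])
  have gF: "group ?F" unfolding free_group_def by (rule group_presented_group)
  interpret F: group ?F by (rule gF)
  interpret h: group_hom ?H ?F h using h(1) by unfold_locales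
  let ?N = "kernel ?H ?F h"
  have N: "?N \<lhd> ?H" by (rule h.normal_kernel)
  have iso: "?H Mod ?N \<cong> ?F" using h(2) by (intro h.FactGroup_iso) simp
  have gQ: "group (?H Mod ?N)" by (rule normal.factorgroup_is_group[OF N])
  have "?F \<cong> ?H Mod ?N" using iso by (rule group.iso_sym[OF gQ])
  then have "is_free_group (?H Mod ?N)" unfolding is_free_group_def by blast
  moreover have "\<not> comm_group (?H Mod ?N)"
    using comm_group_iso[OF _ _ gF] iso free_group_not_comm[OF assms(5)] unfolding is_iso_def by blast
  ultimately show ?thesis using H N unfolding large_group_def by blast
qed

section \<open>Homomorphisms from vertex stabilizers\<close>

text \<open>
  \<open>a x\<close> generates the stabilizer of \<open>x\<close>. Conjugation in a cyclic stabilizer is trivial, which is why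
  the generators can be chosen equivariantly.
\<close>

locale gbs_action = tree_action G V E act
  for G (structure) and V :: "'v set" and E and act +
  fixes a :: "'v \<Rightarrow> 'a"
  assumes gen_closed: "\<And>x. x \<in> V \<Longrightarrow> a x \<in> carrier G"
    and gen_stab: "\<And>g x. x \<in> V \<Longrightarrow> g \<in> carrier G \<Longrightarrow> act g x = x \<longleftrightarrow> (\<exists>k :: int. g = a x [^] k)"
    and gen_inf: "\<And>x k. x \<in> V \<Longrightarrow> a x [^] (k :: int) = \<one> \<Longrightarrow> k = 0"
    and gen_equi: "\<And>g x. g \<in> carrier G \<Longrightarrow> x \<in> V \<Longrightarrow> a (act g x) = g \<otimes> a x \<otimes> inv g"
begin

lemma gen_pow_inj:
  assumes "x \<in> V" "a x [^] (k :: int) = a x [^] (l :: int)"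
  shows "k = l"
proof -
  have "a x [^] (k - l) = \<one>" using assms gen_closed by (simp add: int_pow_diff)
  then show ?thesis using gen_inf[OF assms(1)] by fastforce
qed

definition exponent :: "'v \<Rightarrow> 'a \<Rightarrow> int" where "exponent x s = (THE k. s = a x [^] k)"

lemma exponent_pow: "x \<in> V \<Longrightarrow> exponent x (a x [^] (k :: int)) = k"
  unfolding exponent_def using gen_pow_inj by (intro the_equality) (auto dest: sym)

lemma exponent: "x \<in> V \<Longrightarrow> s \<in> carrier G \<Longrightarrow> act s x = x \<Longrightarrow> s = a x [^] exponent x s"
  using gen_stab exponent_pow by metis

lemma exponent_mult:
  assumes "x \<in> V" "s \<in> carrier G" "act s x = x" "t \<in> carrier G" "act t x = x"
  shows "exponent x (s \<otimes> t) = exponent x s + exponent x t"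
proof -
  have "s \<otimes> t = a x [^] (exponent x s + exponent x t)"
    using exponent[OF assms(1-3)] exponent[OF assms(1,4,5)] gen_closed[OF assms(1)] by (simp add: int_pow_mult)
  then show ?thesis using exponent_pow[OF assms(1)] by simp
qed

lemma exponent_conj:
  assumes "x \<in> V" "s \<in> carrier G" "act s x = x" "g \<in> carrier G"
  shows "exponent (act g x) (g \<otimes> s \<otimes> inv g) = exponent x s"
proof -
  have "g \<otimes> s \<otimes> inv g = g \<otimes> (a x [^] exponent x s) \<otimes> inv g" using exponent[OF assms(1-3)] by simp
  also have "\<dots> = a (act g x) [^] exponent x s"
    using conj_int_pow[OF gen_closed[OF assms(1)] assms(4)] gen_equi[OF assms(4,1)] by simp
  finally show ?thesis using exponent_pow act_closed[OF assms(4,1)] by simp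
qed

lemma edge_stab_setwise:
  assumes "{x, y} \<in> E" "s \<in> carrier G" "{act s x, act s y} = {x, y}"
  shows "act s x = x" "act s y = y"
  using assms no_inversion[OF assms(2,1)] by (auto simp: doubleton_eq_iff)

text \<open>
  The obstruction \<open>\<kappa>\<close> to extending the homomorphisms on the stabilizers is a cocycle on the vertices,
  and it becomes independent of the vertex after correction by a potential on the tree.
\<close>

lemma hom_mod_exists:
  fixes q :: "'v \<Rightarrow> int" and N :: int
  assumes q_inv: "\<And>g x. g \<in> carrier G \<Longrightarrow> x \<in> V \<Longrightarrow> q (act g x) = q x"
    and compat: "\<And>x y s. {x, y} \<in> E \<Longrightarrow> s \<in> carrier G \<Longrightarrow> act s x = x \<Longrightarrow> act s y = y \<Longrightarrow>
      N dvd exponent x s * q x - exponent y s * q y"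
  obtains \<rho> where "\<And>g h. g \<in> carrier G \<Longrightarrow> h \<in> carrier G \<Longrightarrow> N dvd \<rho> (g \<otimes> h) - (\<rho> g + \<rho> h)"
    "\<And>x. x \<in> V \<Longrightarrow> N dvd \<rho> (a x) - q x"
proof -
  obtain rep h where rep: "\<And>x. x \<in> V \<Longrightarrow> rep x \<in> V" "\<And>g x. g \<in> carrier G \<Longrightarrow> x \<in> V \<Longrightarrow> rep (act g x) = rep x"
    and h: "\<And>x. x \<in> V \<Longrightarrow> h x \<in> carrier G" "\<And>x. x \<in> V \<Longrightarrow> act (h x) (rep x) = x"
    by (rule orbit_representatives) (rule that)
  note rep_act = rep(2)
  \<comment> \<open>Going from the orbit representative to \<open>x\<close>, then by
    \<open>g\<close>, then back to the representative gives an element of the representative's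
    stabilizer, where \<open>q\<close> prescribes a value.\<close>
  define \<sigma> where "\<sigma> g x = inv (h (act g x)) \<otimes> g \<otimes> h x" for g x
  define \<kappa> where "\<kappa> g x = exponent (rep x) (\<sigma> g x) * q x" for g x
  have \<sigma>: "\<sigma> g x \<in> carrier G" "act (\<sigma> g x) (rep x) = rep x" if g: "g \<in> carrier G" and x: "x \<in> V" for g x
  proof -
    have hx: "h x \<in> carrier G" "act (h x) (rep x) = x" using h x by auto
    have hg: "h (act g x) \<in> carrier G" "act (h (act g x)) (rep x) = act g x"
      using h(1,2)[OF act_closed[OF g x]] rep_act[OF g x] by auto
    show "\<sigma> g x \<in> carrier G" using g hx hg by (simp add: \<sigma>_def)
    show "act (\<sigma> g x) (rep x) = rep x"
      using g x hx hg rep(1)[OF x] act_inv(1)[OF hg(1), of "rep x"] act_closed by (simp add: \<sigma>_def act_mult)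
  qed
  have \<sigma>_mult: "\<sigma> (g \<otimes> k) x = \<sigma> g (act k x) \<otimes> \<sigma> k x"
    if g: "g \<in> carrier G" and k: "k \<in> carrier G" and x: "x \<in> V" for g k x
  proof -
    have c: "h x \<in> carrier G" "h (act k x) \<in> carrier G" "h (act g (act k x)) \<in> carrier G"
      using h act_closed g k x by auto
    show ?thesis unfolding \<sigma>_def act_mult[OF g k x] using c g k by (simp add: m_assoc mult_inv_cancel)
  qed
  have \<kappa>_mult: "\<kappa> (g \<otimes> k) x = \<kappa> g (act k x) + \<kappa> k x"
    if g: "g \<in> carrier G" and k: "k \<in> carrier G" and x: "x \<in> V" for g k x
    using exponent_mult[of "rep x" "\<sigma> g (act k x)" "\<sigma> k x"] \<sigma>[OF g act_closed[OF k x]] \<sigma>[OF k x] rep(1)[OF x]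
    by (simp add: \<kappa>_def \<sigma>_mult[OF that] rep_act[OF k x] q_inv[OF k x] distrib_right)
  have \<kappa>_stab: "\<kappa> s x = exponent x s * q x" if s: "s \<in> carrier G" "act s x = x" and x: "x \<in> V" for s x
  proof -
    have hx: "h x \<in> carrier G" "act (h x) (rep x) = x" using h x by auto
    have "\<sigma> s x = inv (h x) \<otimes> s \<otimes> h x" by (simp add: \<sigma>_def s(2))
    then have "h x \<otimes> \<sigma> s x \<otimes> inv (h x) = s" using hx s by (simp add: m_assoc mult_inv_cancel)
    then show ?thesis
      using exponent_conj[OF rep(1)[OF x] \<sigma>[OF s(1) x] hx(1)] hx by (simp add: \<kappa>_def)
  qed
  \<comment> \<open>An invariant representative of each edge orbit; \<open>T e\<close> below is a
    chosen element moving it to \<open>e\<close>.\<close>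
  define er where "er e = (SOME e'. \<exists>g\<in>carrier G. e' = act g ` e)" for e
  have er_act: "er (act g ` e) = er e" if g: "g \<in> carrier G" and e: "e \<subseteq> V" for g e
  proof -
    have "(\<exists>k\<in>carrier G. e' = act k ` (act g ` e)) \<longleftrightarrow> (\<exists>k\<in>carrier G. e' = act k ` e)" for e'
    proof
      assume "\<exists>k\<in>carrier G. e' = act k ` (act g ` e)"
      then obtain k where k: "k \<in> carrier G" "e' = act k ` (act g ` e)" by blast
      have "act k ` (act g ` e) = act (k \<otimes> g) ` e"
        unfolding image_image using act_mult[OF k(1) g] e by (intro image_cong) auto
      then show "\<exists>k\<in>carrier G. e' = act k ` e" using k g by (intro bexI[of _ "k \<otimes> g"]) simp_all
    next
      assume "\<exists>k\<in>carrier G. e' = act k ` e"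
      then obtain k where k: "k \<in> carrier G" "e' = act k ` e" by blast
      have "act (k \<otimes> inv g) ` (act g ` e) = act k ` e"
        unfolding image_image using act_mult[OF k(1) inv_closed[OF g]] act_inv(1)[OF g] act_closed[OF g] e
        by (intro image_cong) auto
      then show "\<exists>k\<in>carrier G. e' = act k ` (act g ` e)"
        using k g by (intro bexI[of _ "k \<otimes> inv g"]) simp_all
    qed
    then show ?thesis by (simp add: er_def)
  qed
  define T where "T e = (SOME g. g \<in> carrier G \<and> act g ` (er e) = e)" for e
  have T: "T e \<in> carrier G \<and> act (T e) ` (er e) = e" if e: "e \<subseteq> V" for e
  proof -
    have "\<exists>g\<in>carrier G. er e = act g ` e"
      unfolding er_def by (rule someI[of _ "act \<one> ` e"]) blast
    then obtain g where g: "g \<in> carrier G" "er e = act g ` e" by blast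
    have "act (inv g) ` (er e) = id ` e"
      unfolding g(2) image_image using act_inv(1)[OF g(1)] e by (intro image_cong) auto
    then have "\<exists>g. g \<in> carrier G \<and> act g ` er e = e" using g(1) by (intro exI[of _ "inv g"]) simp
    then show ?thesis unfolding T_def by (rule someI_ex)
  qed
  \<comment> \<open>The difference of \<open>\<kappa>\<close> at the two ends, measured along the
    chosen transport from the representative edge.\<close>
  define lab where "lab x y = (let t = T {x, y} in \<kappa> t (act (inv t) x) - \<kappa> t (act (inv t) y))" for x y
  have lab_anti: "lab y x = - lab x y" for x y
    by (simp add: lab_def Let_def insert_commute)
  obtain f where f: "\<And>x y. {x, y} \<in> E \<Longrightarrow> f y = f x + lab x y"
  proof (rule tree_potential[OF tree group_integer_group, of lab])
    fix x y
    show "lab x y \<in> carrier integer_group" by simp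
    show "lab y x = inv\<^bsub>integer_group\<^esub> lab x y" unfolding inv_integer_group by (rule lab_anti)
  next
    fix f assume "\<And>x y. {x, y} \<in> E \<Longrightarrow> f y = f x \<otimes>\<^bsub>integer_group\<^esub> lab x y"
    then show thesis using that[of f] unfolding mult_integer_group by blast
  qed
  \<comment> \<open>The transports of an edge and of its translate differ by an element fixing the
    representative edge. On it the two end values agree modulo \<open>N\<close>, which is the
    assumed compatibility.\<close>
  have key: "N dvd lab (act g x) (act g y) - (lab x y + \<kappa> g x - \<kappa> g y)"
    if g: "g \<in> carrier G" and e: "{x, y} \<in> E" for g x y
  proof -
    note xy = edge_V[OF e]
    define t where "t = T {x, y}"
    define t' where "t' = T {act g x, act g y}"
    have er': "er {act g x, act g y} = er {x, y}" using er_act[OF g, of "{x, y}"] xy by simp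
    have t: "t \<in> carrier G" "act t ` er {x, y} = {x, y}" using T[of "{x, y}"] xy by (auto simp: t_def)
    have t': "t' \<in> carrier G" "act t' ` er {x, y} = {act g x, act g y}"
      using T[of "{act g x, act g y}"] xy act_closed[OF g] er' by (auto simp: t'_def)
    define u where "u = act (inv t) x"
    define v where "v = act (inv t) y"
    have uv: "u \<in> V" "v \<in> V" "act t u = x" "act t v = y"
      using t xy act_closed act_inv(2) by (auto simp: u_def v_def)
    have euv: "{u, v} \<in> E" using act_edge[OF inv_closed[OF t(1)] e] by (simp add: u_def v_def)
    have erV: "er {x, y} \<subseteq> V"
    proof -
      have "\<exists>g\<in>carrier G. er {x, y} = act g ` {x, y}"
        unfolding er_def by (rule someI[of _ "act \<one> ` {x, y}"]) blast
      then show ?thesis using xy act_closed by auto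
    qed
    have er: "er {x, y} = {u, v}"
    proof -
      have "act (inv t) ` (act t ` er {x, y}) = id ` er {x, y}"
        unfolding image_image using act_inv(1)[OF t(1)] erV by (intro image_cong) auto
      then show ?thesis unfolding t(2) by (simp add: u_def v_def)
    qed
    define s where "s = inv t' \<otimes> g \<otimes> t"
    have s: "s \<in> carrier G" using t t' g by (simp add: s_def)
    have su: "act s u = act (inv t') (act g x)" "act s v = act (inv t') (act g y)"
      using t t' g uv xy act_closed by (simp_all add: s_def act_mult)
    have "act (inv t') ` (act t' ` {u, v}) = id ` {u, v}"
      unfolding image_image using act_inv(1)[OF t'(1)] uv by (intro image_cong) auto
    then have "act (inv t') ` {act g x, act g y} = {u, v}" unfolding t'(2)[unfolded er] by simp
    then have "{act s u, act s v} = {u, v}" unfolding su by simp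
    from edge_stab_setwise[OF euv s this] have suv: "act s u = u" "act s v = v" .
    have ts: "t' \<otimes> s = g \<otimes> t" using t t' g by (simp add: s_def m_assoc mult_inv_cancel)
    have "\<kappa> (t' \<otimes> s) u = \<kappa> t' u + \<kappa> s u" "\<kappa> (t' \<otimes> s) v = \<kappa> t' v + \<kappa> s v"
      using \<kappa>_mult[OF t'(1) s] uv suv by simp_all
    moreover have "\<kappa> (g \<otimes> t) u = \<kappa> g x + \<kappa> t u" "\<kappa> (g \<otimes> t) v = \<kappa> g y + \<kappa> t v"
      using \<kappa>_mult[OF g t(1)] uv by simp_all
    moreover have "\<kappa> s u = exponent u s * q u" "\<kappa> s v = exponent v s * q v" using \<kappa>_stab s suv uv by simp_all
    moreover have "lab x y = \<kappa> t u - \<kappa> t v" by (simp add: lab_def Let_def t_def u_def v_def)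
    moreover have "lab (act g x) (act g y) = \<kappa> t' u - \<kappa> t' v"
      using su suv by (simp add: lab_def Let_def t'_def[symmetric])
    ultimately have "lab (act g x) (act g y) - (lab x y + \<kappa> g x - \<kappa> g y)
      = - (exponent u s * q u - exponent v s * q v)" using ts by simp
    then show ?thesis using compat[OF euv s suv] by (simp only: dvd_minus_iff)
  qed
  \<comment> \<open>\<open>f\<close> is the potential of \<open>lab\<close>. By \<open>key\<close>
    the corrected value is the same modulo \<open>N\<close> at both ends of every edge, hence
    everywhere, and then the cocycle law for \<open>\<kappa>\<close> becomes additivity.\<close>
  define \<rho>x where "\<rho>x x g = f (act g x) + \<kappa> g x - f x" for x g
  have step: "N dvd \<rho>x x g - \<rho>x y g" if g: "g \<in> carrier G" and e: "{x, y} \<in> E" for g x y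
  proof -
    have "\<rho>x x g - \<rho>x y g = - (lab (act g x) (act g y) - (lab x y + \<kappa> g x - \<kappa> g y))"
      using f[OF e] f[OF act_edge[OF g e]] by (simp add: \<rho>x_def)
    then show ?thesis using key[OF g e] by (simp only: dvd_minus_iff)
  qed
  have indep: "N dvd \<rho>x x g - \<rho>x y g" if g: "g \<in> carrier G" and x: "x \<in> V" and y: "y \<in> V" for g x y
    using connected[OF x y]
  proof (induction rule: rtrancl_induct)
    case base
    then show ?case by simp
  next
    case (step y z)
    then have "N dvd (\<rho>x x g - \<rho>x y g) + (\<rho>x y g - \<rho>x z g)"
      using \<open>\<And>x y g. g \<in> carrier G \<Longrightarrow> {x, y} \<in> E \<Longrightarrow> N dvd \<rho>x x g - \<rho>x y g\<close>[OF g, of y z]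
      by (intro dvd_add) auto
    then show ?case by simp
  qed
  obtain r where r: "r \<in> V" using tree unfolding is_tree_def by blast
  show ?thesis
  proof (rule that[of "\<rho>x r"])
    fix g k assume g: "g \<in> carrier G" and k: "k \<in> carrier G"
    have eq: "\<rho>x r (g \<otimes> k) - (\<rho>x r g + \<rho>x r k) = \<rho>x (act k r) g - \<rho>x r g"
      using \<kappa>_mult[OF g k r] by (simp add: \<rho>x_def act_mult[OF g k r])
    show "N dvd \<rho>x r (g \<otimes> k) - (\<rho>x r g + \<rho>x r k)"
      unfolding eq by (rule indep[OF g act_closed[OF k r] r])
  next
    fix x assume x: "x \<in> V"
    have st: "act (a x) x = x" using gen_stab[OF x gen_closed[OF x]] gen_closed[OF x] by (auto intro: exI[of _ 1])
    have "exponent x (a x) = 1" using exponent_pow[OF x, of 1] gen_closed[OF x] by simp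
    then have "\<rho>x x (a x) = q x"
      using \<kappa>_stab[OF gen_closed[OF x] st x] st by (simp add: \<rho>x_def)
    then show "N dvd \<rho>x r (a x) - q x" using indep[OF gen_closed[OF x] r x] by simp
  qed
qed

end

section \<open>Surjective homomorphisms to the integers modulo N, and the orbits of their
  kernels\<close>

lemma Gcd_combination:
  fixes q :: "'v \<Rightarrow> int"
  assumes "finite S" "P N" "\<And>s. s \<in> S \<Longrightarrow> P (q s)"
    and "\<And>c d x y. P x \<Longrightarrow> P y \<Longrightarrow> P (c * x + d * y)"
  shows "P (Gcd (insert N (q ` S)))"
  using assms(1,3)
proof (induction S rule: finite_induct)
  case empty
  have "Gcd (insert N (q ` {})) = sgn N * N + 0 * N" by (simp add: abs_sgn mult.commute)
  then show ?case using assms(4)[OF assms(2,2), of "sgn N" 0] by simp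
next
  case (insert s S)
  obtain c d where "c * q s + d * Gcd (insert N (q ` S)) = gcd (q s) (Gcd (insert N (q ` S)))"
    using bezout_int by blast
  moreover have "Gcd (insert N (q ` insert s S)) = gcd (q s) (Gcd (insert N (q ` S)))"
    by (simp add: insert_commute[of N])
  moreover have "P (Gcd (insert N (q ` S)))" using insert by simp
  ultimately show ?case using assms(4)[of "q s" "Gcd (insert N (q ` S))" c d] insert.prems by simp
qed

text \<open>Dividing \<open>N\<close> and all values by their common divisor makes the homomorphism
  onto, as counting orbits of its kernel requires; \<open>excess_scale\<close> shows that the excess
  stays positive.\<close>

lemma witness_primitive:
  assumes "finite V" "edges_in V es" "witness V es"
  obtains N q where "N > 0" "compat N q es" "excess N q V es > 0" "Gcd (insert N (q ` V)) = 1"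
proof -
  obtain N q where N: "N > 0" "compat N q es" "excess N q V es > 0"
    using assms(3) unfolding witness_def by blast
  define d where "d = Gcd (insert N (q ` V))"
  have "d dvd x" if "x \<in> insert N (q ` V)" for x unfolding d_def using that by (rule Gcd_dvd)
  then have dd: "d dvd N" "\<And>v. v \<in> V \<Longrightarrow> d dvd q v" by blast+
  have "d \<noteq> 0" using dd(1) N(1) by auto
  then have d0: "d > 0" unfolding d_def by (metis Gcd_int_greater_eq_0 order_le_less)
  obtain N' where N': "N = d * N'" using dd(1) by (rule dvdE)
  define q' where "q' v = q v div d" for v
  have q': "q v = d * q' v" if "v \<in> V" for v using dd(2)[OF that] by (simp add: q'_def)
  have N'0: "N' > 0" using N(1) d0 unfolding N' by (simp add: zero_less_mult_iff)
  have "N' dvd l * q' u - m * q' w" if "(u, l, w, m) \<in> set es" for u l w m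
  proof -
    have "u \<in> V" "w \<in> V" using that assms(2) by (auto simp: edges_in_def)
    then have "l * q u - m * q w = d * (l * q' u - m * q' w)" by (simp add: q' algebra_simps)
    moreover have "N dvd l * q u - m * q w" using N(2) that by (auto simp: compat_def)
    ultimately show ?thesis using d0 unfolding N' by simp
  qed
  then have "compat N' q' es" by (auto simp: compat_def)
  moreover have "excess N' q' V es > 0"
  proof -
    have "sum_list (map (wt N q) es) = sum_list (map (wt N (\<lambda>v. d * q' v)) es)"
      by (intro arg_cong[of _ _ sum_list] map_cong) (use assms(2) q' in \<open>auto simp: edges_in_def wt_def\<close>)
    moreover have "(\<Sum>v\<in>V. gcd (q v) N) = (\<Sum>v\<in>V. gcd (d * q' v) N)" by (rule sum.cong) (simp_all add: q')
    ultimately have "excess N q V es = excess N (\<lambda>v. d * q' v) V es" by (simp add: excess_def)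
    also have "\<dots> = gcd d N * excess (N div gcd d N) q' V es" by (rule excess_scale[OF N(1)])
    also have "gcd d N = d" using d0 by (simp add: N')
    finally show ?thesis using N(3) d0 by (simp add: N' zero_less_mult_iff)
  qed
  moreover have "Gcd (insert N' (q' ` V)) = 1"
  proof -
    have ins: "insert N (q ` V) = (*) d ` insert N' (q' ` V)" using q' by (auto simp: N' image_image)
    have "d = normalize (d * Gcd (insert N' (q' ` V)))"
      unfolding Gcd_mult[symmetric] by (rule d_def[unfolded ins])
    also have "\<dots> = normalize d * normalize (Gcd (insert N' (q' ` V)))" by (rule normalize_mult)
    finally have "d * 1 = d * Gcd (insert N' (q' ` V))" using d0 by (simp only: normalize_Gcd mult_1_right) simp
    then show ?thesis using d0 by (simp only: mult_cancel_left) simp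
  qed
  ultimately show ?thesis using that N'0 by blast
qed

context group
begin

lemma mod_hom_pow:
  fixes \<rho> :: "'a \<Rightarrow> int"
  assumes \<rho>': "\<forall>g\<in>carrier G. \<forall>h\<in>carrier G. N dvd \<rho> (g \<otimes> h) - (\<rho> g + \<rho> h)"
  shows "N dvd \<rho> \<one>" "g \<in> carrier G \<Longrightarrow> N dvd \<rho> (inv g) + \<rho> g"
    "g \<in> carrier G \<Longrightarrow> N dvd \<rho> (g [^] (k :: int)) - k * \<rho> g"
proof -
  note \<rho> = \<rho>'[rule_format]
  have "N dvd \<rho> \<one> - (\<rho> \<one> + \<rho> \<one>)" using \<rho>[of \<one> \<one>] by simp
  then show one: "N dvd \<rho> \<one>" by simp
  have inv: "N dvd \<rho> (inv g) + \<rho> g" if g: "g \<in> carrier G" for g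
  proof -
    have "N dvd \<rho> \<one> - (\<rho> (inv g) + \<rho> g)" using \<rho>[of "inv g" g] g by simp
    from dvd_diff[OF one this] show ?thesis by simp
  qed
  then show "g \<in> carrier G \<Longrightarrow> N dvd \<rho> (inv g) + \<rho> g" .
  have nat: "N dvd \<rho> (g [^] (n :: nat)) - int n * \<rho> g" if g: "g \<in> carrier G" for g n
  proof (induction n)
    case 0
    then show ?case using one by simp
  next
    case (Suc n)
    have "N dvd (\<rho> (g [^] n \<otimes> g) - (\<rho> (g [^] n) + \<rho> g)) + (\<rho> (g [^] n) - int n * \<rho> g)"
      using Suc \<rho>[of "g [^] n" g] g by (intro dvd_add) simp_all
    then show ?case by (simp add: algebra_simps)
  qed
  show "N dvd \<rho> (g [^] k) - k * \<rho> g" if g: "g \<in> carrier G"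
  proof (cases k rule: int_cases2)
    case (nonneg n)
    then show ?thesis using nat[OF g, of n] by (simp add: int_pow_int)
  next
    case (nonpos n)
    have "N dvd (\<rho> (inv (g [^] n)) + \<rho> (g [^] n)) - (\<rho> (g [^] n) - int n * \<rho> g)"
      by (rule dvd_diff[OF inv nat[OF g]]) (use g in simp)
    then show ?thesis using g nonpos by (simp add: int_pow_neg_int)
  qed
qed

text \<open>
  The orbits of the kernel of \<open>\<rho>\<close> inside one orbit correspond to the residues modulo the image of
  the stabilizer.
\<close>

lemma kernel_orbit_colouring:
  fixes \<rho> :: "'a \<Rightarrow> int" and \<Omega> :: "'o set" and P :: "'i \<Rightarrow> 'o"
  assumes \<rho>: "\<And>g h. g \<in> carrier G \<Longrightarrow> h \<in> carrier G \<Longrightarrow> N dvd \<rho> (g \<otimes> h) - (\<rho> g + \<rho> h)"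
    and surj: "\<And>k. \<exists>g\<in>carrier G. N dvd \<rho> g - k" and N: "N > 0"
    and one: "\<And>x. x \<in> \<Omega> \<Longrightarrow> act \<one> x = x"
    and mult: "\<And>g h x. g \<in> carrier G \<Longrightarrow> h \<in> carrier G \<Longrightarrow> x \<in> \<Omega> \<Longrightarrow> act (g \<otimes> h) x = act g (act h x)"
    and closed: "\<And>g x. g \<in> carrier G \<Longrightarrow> x \<in> \<Omega> \<Longrightarrow> act g x \<in> \<Omega>"
    and P: "\<And>i. i \<in> I \<Longrightarrow> P i \<in> \<Omega>"
    and uniq: "\<And>i j h. i \<in> I \<Longrightarrow> j \<in> I \<Longrightarrow> h \<in> carrier G \<Longrightarrow> act h (P i) = P j \<Longrightarrow> i = j"
    and cover: "\<And>x. x \<in> \<Omega> \<Longrightarrow> \<exists>i\<in>I. \<exists>h\<in>carrier G. x = act h (P i)"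
    and stab: "\<And>i s. i \<in> I \<Longrightarrow> s \<in> carrier G \<Longrightarrow> act s (P i) = P i \<Longrightarrow> gcd (y i) N dvd \<rho> s"
    and stab2: "\<And>i k. i \<in> I \<Longrightarrow> \<exists>s\<in>carrier G. act s (P i) = P i \<and> N dvd \<rho> s - k * y i"
  obtains c where "c ` \<Omega> = (SIGMA i:I. {0..<gcd (y i) N})"
    "\<And>x x'. x \<in> \<Omega> \<Longrightarrow> x' \<in> \<Omega> \<Longrightarrow> c x = c x' \<longleftrightarrow> (\<exists>g\<in>carrier G. N dvd \<rho> g \<and> act g x = x')"
proof -
  define sel where "sel x = (SOME (i, h). i \<in> I \<and> h \<in> carrier G \<and> x = act h (P i))" for x
  define c where "c x = (case sel x of (i, h) \<Rightarrow> (i, \<rho> h mod gcd (y i) N))" for x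
  have gN: "gcd (y i) N > 0" for i using N by simp
  \<comment> \<open>Two elements moving \<open>P i\<close> to \<open>x\<close> differ by a
    stabilizer element, and this changes \<open>\<rho>\<close> by a multiple of
    \<open>gcd (y i) N\<close>.\<close>
  have c: "c x = (i, \<rho> h mod gcd (y i) N)" if i: "i \<in> I" and h: "h \<in> carrier G" and x: "x = act h (P i)" for x i h
  proof -
    have "case sel x of (i, h) \<Rightarrow> i \<in> I \<and> h \<in> carrier G \<and> x = act h (P i)"
      unfolding sel_def by (rule someI[of _ "(i, h)"]) (use that in simp)
    then obtain j k where jk: "sel x = (j, k)" "j \<in> I" "k \<in> carrier G" "x = act k (P j)"
      by (cases "sel x") auto
    have "act (inv h \<otimes> k) (P j) = P i"
      using jk h x i P one mult[OF inv_closed[OF h] jk(3) P[OF jk(2)]] mult[OF inv_closed[OF h] h P[OF i]]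
      by simp
    then have ji: "j = i" using uniq jk h i by (meson inv_closed m_closed)
    define s where "s = inv h \<otimes> k"
    have s: "s \<in> carrier G" "act s (P i) = P i" "k = h \<otimes> s"
      using \<open>act (inv h \<otimes> k) (P j) = P i\<close> ji h jk by (auto simp: s_def mult_inv_cancel)
    have "gcd (y i) N dvd (\<rho> (h \<otimes> s) - (\<rho> h + \<rho> s)) + \<rho> s"
      using \<rho>[OF h s(1)] stab[OF i s(1,2)] by (intro dvd_add) (auto intro: dvd_trans[OF gcd_dvd2])
    then have "gcd (y i) N dvd \<rho> k - \<rho> h" by (simp add: s(3))
    then show ?thesis using jk ji by (simp add: c_def mod_eq_dvd_iff)
  qed
  have "c ` \<Omega> = (SIGMA i:I. {0..<gcd (y i) N})"
  proof
    show "c ` \<Omega> \<subseteq> (SIGMA i:I. {0..<gcd (y i) N})"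
    proof
      fix z assume "z \<in> c ` \<Omega>"
      then obtain x where x: "x \<in> \<Omega>" "z = c x" by blast
      obtain i h where "i \<in> I" "h \<in> carrier G" "x = act h (P i)" using cover[OF x(1)] by blast
      then show "z \<in> (SIGMA i:I. {0..<gcd (y i) N})" using c x(2) gN by simp
    qed
    show "(SIGMA i:I. {0..<gcd (y i) N}) \<subseteq> c ` \<Omega>"
    proof
      fix z assume "z \<in> (SIGMA i:I. {0..<gcd (y i) N})"
      then obtain i k where z: "z = (i, k)" "i \<in> I" "0 \<le> k" "k < gcd (y i) N" by auto
      obtain g where g: "g \<in> carrier G" "N dvd \<rho> g - k" using surj by blast
      have "gcd (y i) N dvd \<rho> g - k" using g(2) by (rule dvd_trans[OF gcd_dvd2])
      then have "\<rho> g mod gcd (y i) N = k mod gcd (y i) N" by (simp add: mod_eq_dvd_iff)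
      also have "\<dots> = k" using z by simp
      finally have "c (act g (P i)) = z" using c[OF z(2) g(1) HOL.refl] z by simp
      then show "z \<in> c ` \<Omega>" using closed[OF g(1) P[OF z(2)]] by blast
    qed
  qed
  moreover have "c x = c x' \<longleftrightarrow> (\<exists>g\<in>carrier G. N dvd \<rho> g \<and> act g x = x')"
    if x: "x \<in> \<Omega>" and x': "x' \<in> \<Omega>" for x x'
  proof -
    obtain i h where i: "i \<in> I" and h: "h \<in> carrier G" and xe: "x = act h (P i)" using cover[OF x] by blast
    show ?thesis
    proof
      assume cc: "c x = c x'"
      obtain j k where j: "j \<in> I" and k: "k \<in> carrier G" and xe': "x' = act k (P j)" using cover[OF x'] by blast
      have ji: "j = i" and "gcd (y i) N dvd \<rho> k - \<rho> h"
        using cc c[OF i h xe] c[OF j k xe'] by (auto simp: mod_eq_dvd_iff dvd_diff_commute)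
      obtain \<alpha> \<beta> where "\<alpha> * y i + \<beta> * N = gcd (y i) N" using bezout_int by blast
      then obtain \<alpha>' \<beta>' where ab: "\<rho> k - \<rho> h = \<alpha>' * y i + \<beta>' * N"
        using \<open>gcd (y i) N dvd \<rho> k - \<rho> h\<close> by (metis dvd_def mult.commute mult.left_commute distrib_left)
      obtain s where s: "s \<in> carrier G" "act s (P i) = P i" "N dvd \<rho> s - \<alpha>' * y i" using stab2[OF i] by blast
      \<comment> \<open>Equal colours say that \<open>\<rho> k - \<rho> h\<close> is a multiple of
        \<open>y i\<close> modulo \<open>N\<close>. The stabilizer element \<open>s\<close> absorbs
        it, so that \<open>g\<close> lies in the kernel.\<close>
      define g where "g = k \<otimes> inv (h \<otimes> s)"
      have hs: "h \<otimes> s \<in> carrier G" using h s by simp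
      have "act (h \<otimes> s) (P i) = x" using mult[OF h s(1) P[OF i]] s xe by simp
      moreover have "act (inv (h \<otimes> s)) (act (h \<otimes> s) (P i)) = P i"
        using mult[OF inv_closed[OF hs] hs P[OF i]] one[OF P[OF i]] hs by simp
      ultimately have "act g x = x'"
        using mult[OF k inv_closed[OF hs] x] xe' ji by (simp add: g_def)
      have d1: "N dvd \<rho> g - (\<rho> k + \<rho> (inv (h \<otimes> s)))" unfolding g_def by (rule \<rho>[OF k inv_closed[OF hs]])
      have d2: "N dvd \<rho> (inv (h \<otimes> s)) + \<rho> (h \<otimes> s)" using \<rho> mod_hom_pow(2)[OF _ hs] by blast
      have d5: "N dvd \<beta>' * N" by simp
      have "N dvd (\<rho> g - (\<rho> k + \<rho> (inv (h \<otimes> s)))) + (\<rho> (inv (h \<otimes> s)) + \<rho> (h \<otimes> s))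
          - (\<rho> (h \<otimes> s) - (\<rho> h + \<rho> s)) - (\<rho> s - \<alpha>' * y i) + \<beta>' * N"
        by (rule dvd_add[OF dvd_diff[OF dvd_diff[OF dvd_add[OF d1 d2] \<rho>[OF h s(1)]] s(3)] d5])
      also have "(\<rho> g - (\<rho> k + \<rho> (inv (h \<otimes> s)))) + (\<rho> (inv (h \<otimes> s)) + \<rho> (h \<otimes> s))
          - (\<rho> (h \<otimes> s) - (\<rho> h + \<rho> s)) - (\<rho> s - \<alpha>' * y i) + \<beta>' * N = \<rho> g"
        using ab by simp
      finally show "\<exists>g\<in>carrier G. N dvd \<rho> g \<and> act g x = x'"
        using \<open>act g x = x'\<close> k hs by (intro bexI[of _ g]) (auto simp: g_def)
    next
      assume "\<exists>g\<in>carrier G. N dvd \<rho> g \<and> act g x = x'"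
      then obtain g where g: "g \<in> carrier G" "N dvd \<rho> g" "act g x = x'" by blast
      have "x' = act (g \<otimes> h) (P i)" using mult[OF g(1) h P[OF i]] xe g by simp
      then have c': "c x' = (i, \<rho> (g \<otimes> h) mod gcd (y i) N)" using c i g h by simp
      have "N dvd (\<rho> (g \<otimes> h) - (\<rho> g + \<rho> h)) + \<rho> g" using \<rho>[OF g(1) h] g(2) by (rule dvd_add)
      then have "gcd (y i) N dvd \<rho> (g \<otimes> h) - \<rho> h" by (intro dvd_trans[OF gcd_dvd2]) simp
      then show "c x = c x'" using c' c[OF i h xe] by (simp add: mod_eq_dvd_iff dvd_diff_commute)
    qed
  qed
  ultimately show ?thesis by (rule that)
qed

end

section \<open>Generalized Baumslag--Solitar groups\<close>

context gbs_action
begin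

text \<open>Besides the relation, the second clause makes \<open>a x [^] l\<close> a generator of
  the whole edge stabilizer. Fixing both ends is no loss, as there are no inversions.\<close>

definition edge_label :: "'v \<Rightarrow> int \<Rightarrow> 'v \<Rightarrow> int \<Rightarrow> bool" where
  "edge_label x l y m \<longleftrightarrow> a x [^] l = a y [^] m \<and>
    (\<forall>s\<in>carrier G. act s x = x \<longrightarrow> act s y = y \<longrightarrow> (\<exists>k :: int. s = a x [^] (l * k)))"

text \<open>\<open>b\<close> is the stable letter: the entry joins two transversal vertices in the
  quotient graph, while in the tree the edge ends in a translate of the second one.\<close>

definition edge_of :: "'v lab_edge \<times> 'a \<Rightarrow> 'v set" where
  "edge_of = (\<lambda>((u, l, w, m), b). {u, act b w})"

definition eorb :: "'v set \<Rightarrow> 'v set set" where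
  "eorb e = {act g ` e | g. g \<in> carrier G}"

definition transversal :: "'v set \<Rightarrow> bool" where
  "transversal S \<longleftrightarrow> finite S \<and> S \<subseteq> V \<and> (\<forall>x\<in>V. \<exists>s\<in>S. same_orbit s x) \<and>
    (\<forall>s\<in>S. \<forall>s'\<in>S. same_orbit s s' \<longrightarrow> s = s')"

definition edge_system :: "'v set \<Rightarrow> ('v lab_edge \<times> 'a) list \<Rightarrow> bool" where
  "edge_system S F \<longleftrightarrow>
    (\<forall>((u, l, w, m), b)\<in>set F. u \<in> S \<and> w \<in> S \<and> b \<in> carrier G \<and> {u, act b w} \<in> E \<and>
      l \<noteq> 0 \<and> m \<noteq> 0 \<and> edge_label u l (act b w) m) \<and>
    distinct (map (\<lambda>x. eorb (edge_of x)) F) \<and> (\<lambda>x. eorb (edge_of x)) ` set F = eorb ` E"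

lemma eorb_act:
  assumes "g \<in> carrier G" "e \<subseteq> V"
  shows "eorb (act g ` e) = eorb e"
proof
  show "eorb (act g ` e) \<subseteq> eorb e"
  proof
    fix z assume "z \<in> eorb (act g ` e)"
    then obtain h where h: "h \<in> carrier G" "z = act h ` (act g ` e)" by (auto simp: eorb_def)
    then have "z = act (h \<otimes> g) ` e" using act_image_mult[OF h(1) assms] by simp
    then show "z \<in> eorb e" using h(1) assms(1) m_closed unfolding eorb_def by blast
  qed
  show "eorb e \<subseteq> eorb (act g ` e)"
  proof
    fix z assume "z \<in> eorb e"
    then obtain h where h: "h \<in> carrier G" "z = act h ` e" by (auto simp: eorb_def)
    have hg: "h \<otimes> inv g \<in> carrier G" using h assms by simp
    have "(h \<otimes> inv g) \<otimes> g = h" using h assms by (simp add: m_assoc)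
    then have "z = act (h \<otimes> inv g) ` (act g ` e)" using act_image_mult[OF hg assms] h by simp
    then show "z \<in> eorb (act g ` e)" using hg unfolding eorb_def by blast
  qed
qed

lemma eorb_self: "e \<subseteq> V \<Longrightarrow> e \<in> eorb e"
  unfolding eorb_def using act_image_one by (auto intro!: exI[of _ \<one>])

lemma edge_system_facts:
  assumes "edge_system S F"
  shows "\<And>u l w m b. ((u, l, w, m), b) \<in> set F \<Longrightarrow> u \<in> S \<and> w \<in> S \<and> b \<in> carrier G \<and>
      {u, act b w} \<in> E \<and> l \<noteq> 0 \<and> m \<noteq> 0 \<and> edge_label u l (act b w) m"
    and "\<And>f. f \<in> set F \<Longrightarrow> edge_of f \<in> E"
    and "\<And>e. e \<in> E \<Longrightarrow> \<exists>i<length F. \<exists>h\<in>carrier G. e = act h ` edge_of (F ! i)"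
    and "\<And>i j h. i < length F \<Longrightarrow> j < length F \<Longrightarrow> h \<in> carrier G \<Longrightarrow>
      act h ` edge_of (F ! i) = edge_of (F ! j) \<Longrightarrow> i = j"
proof -
  show 1: "u \<in> S \<and> w \<in> S \<and> b \<in> carrier G \<and>
      {u, act b w} \<in> E \<and> l \<noteq> 0 \<and> m \<noteq> 0 \<and> edge_label u l (act b w) m"
    if "((u, l, w, m), b) \<in> set F" for u l w m b
    using bspec[OF conjunct1[OF assms[unfolded edge_system_def]] that] by simp
  show 2: "edge_of f \<in> E" if "f \<in> set F" for f
  proof -
    obtain u l w m b where f: "f = ((u, l, w, m), b)" by (metis prod.exhaust)
    then show ?thesis using 1[of u l w m b] that by (simp add: edge_of_def)
  qed
  show "\<exists>i<length F. \<exists>h\<in>carrier G. e = act h ` edge_of (F ! i)" if e: "e \<in> E" for e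
  proof -
    have "(\<lambda>x. eorb (edge_of x)) ` set F = eorb ` E"
      using assms unfolding edge_system_def by (elim conjE)
    then have "eorb e \<in> (\<lambda>x. eorb (edge_of x)) ` set F" using e by simp
    then obtain f where "f \<in> set F" "eorb e = eorb (edge_of f)" by blast
    then obtain i where i: "i < length F" "eorb e = eorb (edge_of (F ! i))" by (metis in_set_conv_nth)
    have "e \<in> eorb (edge_of (F ! i))" using eorb_self[OF edge_subset[OF e]] i(2) by simp
    then show ?thesis using i(1) by (auto simp: eorb_def)
  qed
  show "i = j" if i: "i < length F" and j: "j < length F" and h: "h \<in> carrier G"
    and e: "act h ` edge_of (F ! i) = edge_of (F ! j)" for i j h
  proof -
    have "eorb (edge_of (F ! j)) = eorb (edge_of (F ! i))"
      using eorb_act[OF h edge_subset[OF 2[OF nth_mem[OF i]]]] e by simp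
    moreover have "distinct (map (\<lambda>x. eorb (edge_of x)) F)" using assms unfolding edge_system_def by (elim conjE)
    ultimately show ?thesis using i j by (metis (no_types, lifting) length_map nth_eq_iff_index_eq nth_map)
  qed
qed

lemma edge_label_fixes:
  assumes "{x, y} \<in> E" "edge_label x l y m"
  shows "act (a x [^] (l * k)) x = x" "act (a x [^] (l * k)) y = y" "a x [^] (l * k) = a y [^] (m * k)"
proof -
  note xy = edge_V[OF assms(1)]
  have "a x [^] (l * k) = (a x [^] l) [^] k" using gen_closed[OF xy(1)] by (simp add: int_pow_pow)
  also have "\<dots> = (a y [^] m) [^] k" using assms(2) by (simp add: edge_label_def)
  finally show e: "a x [^] (l * k) = a y [^] (m * k)" using gen_closed[OF xy(2)] by (simp add: int_pow_pow)
  show "act (a x [^] (l * k)) x = x" using gen_stab[OF xy(1)] gen_closed[OF xy(1)] by blast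
  show "act (a x [^] (l * k)) y = y" unfolding e using gen_stab[OF xy(2)] gen_closed[OF xy(2)] by blast
qed

text \<open>A primitive witness, extended along orbits to \<open>Q\<close>, defines a homomorphism
  onto the integers modulo \<open>N\<close>. The two sums in \<open>excess\<close> are exactly the
  edge and vertex orbit counts of its kernel \<open>H\<close>, so \<open>surj_free_group\<close>
  applies to \<open>H\<close>.\<close>

lemma witness_large:
  assumes S: "transversal S" and F: "edge_system S F" and wit: "witness S (map fst F)"
  shows "large_group G"
proof -
  have finS: "finite S" and SV: "S \<subseteq> V" using S by (auto simp: transversal_def)
  note Ff = edge_system_facts[OF F]
  have "edges_in S (map fst F)" using Ff(1) by (force simp: edges_in_def)
  then obtain N q where N: "N > 0" "compat N q (map fst F)" "excess N q S (map fst F) > 0"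
    "Gcd (insert N (q ` S)) = 1" using witness_primitive[OF finS _ wit] by blast
  define rp where "rp x = (THE s. s \<in> S \<and> same_orbit s x)" for x
  have rp_eq: "rp x = s" if s: "s \<in> S" "same_orbit s x" for s x
    unfolding rp_def
  proof (rule the_equality)
    fix s' assume s': "s' \<in> S \<and> same_orbit s' x"
    have "same_orbit s' s"
    proof -
      obtain g g' where "g \<in> carrier G" "act g s = x" "g' \<in> carrier G" "act g' s' = x"
        using s s' by (auto simp: same_orbit_def)
      moreover have "s \<in> V" "s' \<in> V" using s s' SV by auto
      ultimately have "act (inv g \<otimes> g') s' = s" "inv g \<otimes> g' \<in> carrier G"
        using act_mult[of "inv g" g' s'] act_inv(1)[of g s] by simp_all
      then show ?thesis unfolding same_orbit_def by blast
    qed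
    then show "s' = s" using S s s' unfolding transversal_def by blast
  qed (use s in simp)
  have rp: "rp x \<in> S \<and> same_orbit (rp x) x" if x: "x \<in> V" for x
  proof -
    obtain s where s: "s \<in> S" "same_orbit s x" using S x unfolding transversal_def by blast
    then show ?thesis using rp_eq[OF s] by simp
  qed
  have rp_act: "rp (act h s) = s" if "s \<in> S" "h \<in> carrier G" for s h
    using rp_eq[OF that(1)] that(2) by (auto simp: same_orbit_def)
  define Q where "Q x = q (rp x)" for x
  have Q_inv: "Q (act g x) = Q x" if g: "g \<in> carrier G" and x: "x \<in> V" for g x
  proof -
    obtain h where h: "h \<in> carrier G" "act h (rp x) = x" using rp[OF x] by (auto simp: same_orbit_def)
    have "act (g \<otimes> h) (rp x) = act g x" using act_mult[OF g h(1)] rp[OF x] SV h by auto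
    then have "rp (act g x) = rp x" using rp_act[of "rp x" "g \<otimes> h"] rp[OF x] g h by auto
    then show ?thesis by (simp add: Q_def)
  qed
  have Q_S: "Q s = q s" if "s \<in> S" for s
    using rp_act[OF that one_closed] act_one that SV by (auto simp: Q_def)
  have compat1: "N dvd exponent (act h u) s * Q (act h u) - exponent (act h (act b w)) s * Q (act h (act b w))"
    if f: "((u, l, w, m), b) \<in> set F" and h: "h \<in> carrier G" and s: "s \<in> carrier G"
      "act s (act h u) = act h u" "act s (act h (act b w)) = act h (act b w)" for u l w m b h s
  proof -
    have fu: "u \<in> S" "w \<in> S" "b \<in> carrier G" "{u, act b w} \<in> E" "edge_label u l (act b w) m"
      using Ff(1)[OF f] by auto
    have V: "u \<in> V" "act b w \<in> V" "w \<in> V" using fu SV act_closed by auto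
    define s' where "s' = inv h \<otimes> s \<otimes> h"
    have s'c: "s' \<in> carrier G" using h s by (simp add: s'_def)
    have sfix: "act s' u = u" "act s' (act b w) = act b w"
      using h s V by (simp_all add: s'_def act_mult act_closed act_inv)
    have ss': "s = h \<otimes> s' \<otimes> inv h" using h s by (simp add: s'_def m_assoc mult_inv_cancel)
    obtain k where k: "s' = a u [^] (l * k)" using fu(5) s'c sfix unfolding edge_label_def by blast
    have e1: "exponent u s' = l * k" unfolding k by (rule exponent_pow[OF V(1)])
    have e2: "exponent (act b w) s' = m * k"
      unfolding k edge_label_fixes(3)[OF fu(4,5)] by (rule exponent_pow[OF V(2)])
    have "exponent (act h u) s = l * k" "exponent (act h (act b w)) s = m * k"
      using exponent_conj[OF V(1) s'c sfix(1) h] exponent_conj[OF V(2) s'c sfix(2) h] e1 e2 ss' by simp_all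
    moreover have "Q (act h u) = q u" "Q (act h (act b w)) = q w"
      using Q_inv[OF h] Q_inv[OF fu(3)] Q_S V fu by simp_all
    moreover have "N dvd l * q u - m * q w" using N(2) f by (force simp: compat_def)
    then have "N dvd k * (l * q u - m * q w)" by simp
    ultimately show ?thesis by (simp add: algebra_simps)
  qed
  have compat: "N dvd exponent x s * Q x - exponent y s * Q y"
    if e: "{x, y} \<in> E" and s: "s \<in> carrier G" "act s x = x" "act s y = y" for x y s
  proof -
    obtain i h where i: "i < length F" "h \<in> carrier G" "{x, y} = act h ` edge_of (F ! i)"
      using Ff(3)[OF e] by blast
    obtain u l w m b where f: "F ! i = ((u, l, w, m), b)" by (metis prod.exhaust)
    have f': "((u, l, w, m), b) \<in> set F" using i f by (metis nth_mem)
    have "{x, y} = {act h u, act h (act b w)}" using i(3) f by (simp add: edge_of_def)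
    then consider "x = act h u" "y = act h (act b w)" | "y = act h u" "x = act h (act b w)"
      by (auto simp: doubleton_eq_iff)
    then show ?thesis
    proof cases
      case 1
      then show ?thesis using compat1[OF f' i(2) s(1)] s by simp
    next
      case 2
      then have "N dvd exponent y s * Q y - exponent x s * Q x" using compat1[OF f' i(2) s(1)] s by simp
      then show ?thesis by (simp add: dvd_diff_commute)
    qed
  qed
  obtain \<rho> where \<rho>: "\<And>g h. g \<in> carrier G \<Longrightarrow> h \<in> carrier G \<Longrightarrow> N dvd \<rho> (g \<otimes> h) - (\<rho> g + \<rho> h)"
    and \<rho>a: "\<And>x. x \<in> V \<Longrightarrow> N dvd \<rho> (a x) - Q x"
    using hom_mod_exists[of Q N, OF Q_inv compat] by blast
  have "\<forall>g\<in>carrier G. \<forall>h\<in>carrier G. N dvd \<rho> (g \<otimes> h) - (\<rho> g + \<rho> h)" using \<rho> by blast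
  note \<rho>p = mod_hom_pow[OF this]
  have \<rho>ak: "N dvd \<rho> (a x [^] k) - k * Q x" if "x \<in> V" for x and k :: int
  proof -
    have "N dvd (\<rho> (a x [^] k) - k * \<rho> (a x)) + k * (\<rho> (a x) - Q x)"
      using \<rho>p(3)[OF gen_closed[OF that]] \<rho>a[OF that] by (intro dvd_add dvd_mult) auto
    then show ?thesis by (simp add: algebra_simps)
  qed
  \<comment> \<open>The values attained modulo \<open>N\<close> are closed under integer
    combinations and contain \<open>N\<close> and all \<open>q s\<close>, whose gcd is 1.\<close>
  have surj: "\<exists>g\<in>carrier G. N dvd \<rho> g - k" for k
  proof -
    define P where "P k \<longleftrightarrow> (\<exists>g\<in>carrier G. N dvd \<rho> g - k)" for k
    have comb: "P (c * x + d * y)" if xy: "P x" "P y" for c d x y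
    proof -
      obtain g h where g: "g \<in> carrier G" "N dvd \<rho> g - x" and h: "h \<in> carrier G" "N dvd \<rho> h - y"
        using xy by (auto simp: P_def)
      have "N dvd (\<rho> (g [^] c \<otimes> h [^] d) - (\<rho> (g [^] c) + \<rho> (h [^] d)))" using g h \<rho> by simp
      moreover have "N dvd \<rho> (g [^] c) - c * \<rho> g" "N dvd \<rho> (h [^] d) - d * \<rho> h" using \<rho>p(3) g h by auto
      moreover have "N dvd c * (\<rho> g - x)" "N dvd d * (\<rho> h - y)" using g h by auto
      ultimately have "N dvd (\<rho> (g [^] c \<otimes> h [^] d) - (\<rho> (g [^] c) + \<rho> (h [^] d)))
        + (\<rho> (g [^] c) - c * \<rho> g) + (\<rho> (h [^] d) - d * \<rho> h) + c * (\<rho> g - x) + d * (\<rho> h - y)"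
        by (meson dvd_add)
      then have "N dvd \<rho> (g [^] c \<otimes> h [^] d) - (c * x + d * y)" by (simp add: algebra_simps)
      then show ?thesis using g h unfolding P_def by (meson int_pow_closed m_closed)
    qed
    have PN: "P N" using \<rho>p(1) unfolding P_def by (intro bexI[of _ \<one>]) auto
    have Pq: "P (q s)" if "s \<in> S" for s
      using \<rho>a[of s] Q_S[OF that] gen_closed[of s] that SV unfolding P_def by auto
    have "P (Gcd (insert N (q ` S)))"
      by (rule Gcd_combination[OF finS PN Pq comb])
    then have "P 1" using N(4) by simp
    then have "P (k * 1 + 0 * 1)" by (intro comb)
    then show ?thesis by (simp add: P_def)
  qed
  define H where "H = {g \<in> carrier G. N dvd \<rho> g}"
  have H: "subgroup H G"
  proof (rule subgroupI)
    fix g assume "g \<in> H"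
    then show "inv g \<in> H" using \<rho>p(2)[of g] by (auto simp: H_def dvd_add_left_iff)
  next
    fix g h assume "g \<in> H" "h \<in> H"
    then have "N dvd (\<rho> (g \<otimes> h) - (\<rho> g + \<rho> h)) + (\<rho> g + \<rho> h)"
      using \<rho>[of g h] by (intro dvd_add) (auto simp: H_def)
    then show "g \<otimes> h \<in> H" using \<open>g \<in> H\<close> \<open>h \<in> H\<close> by (auto simp: H_def)
  qed (use \<rho>p(1) in \<open>auto simp: H_def\<close>)
  have finH: "finite (rcosets H)"
  proof (rule finite_subset)
    show "rcosets H \<subseteq> (\<lambda>k. {g \<in> carrier G. N dvd \<rho> g - k}) ` {0..<N}"
    proof
      fix C assume "C \<in> rcosets H"
      then obtain g where g: "g \<in> carrier G" "C = H #> g" by (auto simp: RCOSETS_def)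
      have "x \<in> H #> g \<longleftrightarrow> x \<in> carrier G \<and> N dvd \<rho> x - \<rho> g" for x
      proof
        assume "x \<in> H #> g"
        then obtain h where h: "h \<in> H" "x = h \<otimes> g" by (auto simp: r_coset_def)
        then have "N dvd (\<rho> (h \<otimes> g) - (\<rho> h + \<rho> g)) + \<rho> h" using \<rho>[of h g] g by (intro dvd_add) (auto simp: H_def)
        then show "x \<in> carrier G \<and> N dvd \<rho> x - \<rho> g" using h g by (auto simp: H_def)
      next
        assume x: "x \<in> carrier G \<and> N dvd \<rho> x - \<rho> g"
        have "N dvd (\<rho> (x \<otimes> inv g) - (\<rho> x + \<rho> (inv g))) + (\<rho> (inv g) + \<rho> g) + (\<rho> x - \<rho> g)"
          by (rule dvd_add[OF dvd_add[OF \<rho> \<rho>p(2)]]) (use x g in simp_all)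
        then have "x \<otimes> inv g \<in> H" using x g by (simp add: H_def)
        moreover have "x \<otimes> inv g \<otimes> g = x" using x g by (simp add: m_assoc)
        ultimately show "x \<in> H #> g" unfolding r_coset_def by force
      qed
      moreover have "N dvd \<rho> x - \<rho> g \<longleftrightarrow> N dvd \<rho> x - \<rho> g mod N" for x
        by (metis mod_eq_dvd_iff mod_mod_trivial)
      ultimately have "C = {x \<in> carrier G. N dvd \<rho> x - \<rho> g mod N}" using g(2) by blast
      moreover have "\<rho> g mod N \<in> {0..<N}" using N(1) by simp
      ultimately show "C \<in> (\<lambda>k. {g \<in> carrier G. N dvd \<rho> g - k}) ` {0..<N}" by blast
    qed
  qed simp
  obtain c where c: "c ` V = (SIGMA s:S. {0..<gcd (q s) N})"
    "\<And>x x'. x \<in> V \<Longrightarrow> x' \<in> V \<Longrightarrow> c x = c x' \<longleftrightarrow> (\<exists>g\<in>carrier G. N dvd \<rho> g \<and> act g x = x')"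
  proof (rule kernel_orbit_colouring[of N \<rho> V act S "\<lambda>s. s" q])
    show "s = s'" if "s \<in> S" "s' \<in> S" "h \<in> carrier G" "act h s = s'" for s s' h
      using S that unfolding transversal_def same_orbit_def by blast
    show "\<exists>s\<in>S. \<exists>h\<in>carrier G. x = act h s" if x: "x \<in> V" for x
    proof -
      obtain h where "h \<in> carrier G" "act h (rp x) = x" using rp[OF x] by (auto simp: same_orbit_def)
      then show ?thesis using rp[OF x] by (intro bexI[of _ "rp x"] bexI[of _ h]) simp_all
    qed
    show "gcd (q i) N dvd \<rho> s" if i: "i \<in> S" and s: "s \<in> carrier G" "act s i = i" for i s
    proof -
      have iV: "i \<in> V" using i SV by auto
      obtain k :: int where k: "s = a i [^] k" using gen_stab[OF iV s(1)] s(2) by blast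
      have "gcd (q i) N dvd (\<rho> s - k * q i) + k * q i"
        using \<rho>ak[OF iV, of k] Q_S[OF i] k by (intro dvd_add) (auto intro: dvd_trans[OF gcd_dvd2])
      then show ?thesis by simp
    qed
    show "\<exists>s\<in>carrier G. act s i = i \<and> N dvd \<rho> s - k * q i" if i: "i \<in> S" for i k
    proof -
      have iV: "i \<in> V" using i SV by auto
      show ?thesis using \<rho>ak[OF iV, of k] Q_S[OF i] gen_stab[OF iV] gen_closed[OF iV]
        by (intro bexI[of _ "a i [^] k"]) auto
    qed
    show "N dvd \<rho> (g \<otimes> h) - (\<rho> g + \<rho> h)" if "g \<in> carrier G" "h \<in> carrier G" for g h
      by (rule \<rho>[OF that])
    show "\<exists>g\<in>carrier G. N dvd \<rho> g - k" for k by (rule surj)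
    show "N > 0" by (rule N(1))
    show "act \<one> x = x" if "x \<in> V" for x by (rule act_one[OF that])
    show "act (g \<otimes> h) x = act g (act h x)" if "g \<in> carrier G" "h \<in> carrier G" "x \<in> V" for g h x
      by (rule act_mult[OF that])
    show "act g x \<in> V" if "g \<in> carrier G" "x \<in> V" for g x by (rule act_closed[OF that])
    show "i \<in> V" if "i \<in> S" for i using SV that by blast
  qed (rule that)
  \<comment> \<open>The image of the generator of the edge stabilizer of entry \<open>i\<close>, so
    that the gcds below are the weights \<open>wt\<close>.\<close>
  define y where "y i = (case F ! i of ((u, l, w, m), b) \<Rightarrow> l * q u)" for i
  obtain ce where ce: "ce ` E = (SIGMA i:{..<length F}. {0..<gcd (y i) N})"
    "\<And>e e'. e \<in> E \<Longrightarrow> e' \<in> E \<Longrightarrow> ce e = ce e' \<longleftrightarrow> (\<exists>g\<in>carrier G. N dvd \<rho> g \<and> act g ` e = e')"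
  proof (rule kernel_orbit_colouring[of N \<rho> E "\<lambda>g e. act g ` e" "{..<length F}" "\<lambda>i. edge_of (F ! i)" y])
    fix i assume i: "i \<in> {..<length F}"
    obtain u l w m b where f: "F ! i = ((u, l, w, m), b)" by (metis prod.exhaust)
    have f': "((u, l, w, m), b) \<in> set F" using i f by (metis lessThan_iff nth_mem)
    have fu: "u \<in> S" "{u, act b w} \<in> E" "edge_label u l (act b w) m" using Ff(1)[OF f'] by auto
    note uV = edge_V[OF fu(2)]
    have eo: "edge_of (F ! i) = {u, act b w}" and yi: "y i = l * q u" using f by (simp_all add: edge_of_def y_def)
    have \<rho>u: "N dvd \<rho> (a u [^] (l * k)) - k * y i" for k
      using \<rho>ak[OF uV(1), of "l * k"] Q_S[OF fu(1)] yi by (simp add: algebra_simps)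
    show "gcd (y i) N dvd \<rho> s" if s: "s \<in> carrier G" "act s ` edge_of (F ! i) = edge_of (F ! i)" for s
    proof -
      have "act s u = u" "act s (act b w) = act b w"
        using edge_stab_setwise[OF fu(2) s(1)] s(2) eo by auto
      then obtain k where k: "s = a u [^] (l * k)" using fu(3) s(1) unfolding edge_label_def by blast
      have "gcd (y i) N dvd (\<rho> s - k * y i) + k * y i"
        using \<rho>u[of k] k by (intro dvd_add) (auto intro: dvd_trans[OF gcd_dvd2])
      then show ?thesis by simp
    qed
    show "\<exists>s\<in>carrier G. act s ` edge_of (F ! i) = edge_of (F ! i) \<and> N dvd \<rho> s - k * y i" for k
      using \<rho>u[of k] edge_label_fixes(1,2)[OF fu(2,3)] gen_closed[OF uV(1)]
      by (intro bexI[of _ "a u [^] (l * k)"]) (auto simp: eo)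
    show "edge_of (F ! i) \<in> E" using fu(2) eo by simp
  next
    show "i = j" if "i \<in> {..<length F}" "j \<in> {..<length F}" "h \<in> carrier G"
      "act h ` edge_of (F ! i) = edge_of (F ! j)" for i j h
      using Ff(4) that by simp
    show "\<exists>i\<in>{..<length F}. \<exists>h\<in>carrier G. e = act h ` edge_of (F ! i)" if "e \<in> E" for e
      using Ff(3)[OF that] by blast
    show "N dvd \<rho> (g \<otimes> h) - (\<rho> g + \<rho> h)" if "g \<in> carrier G" "h \<in> carrier G" for g h
      by (rule \<rho>[OF that])
    show "\<exists>g\<in>carrier G. N dvd \<rho> g - k" for k by (rule surj)
    show "N > 0" by (rule N(1))
    show "act \<one> ` e = e" if "e \<in> E" for e by (rule act_image_one[OF edge_subset[OF that]])
    show "act (g \<otimes> h) ` e = act g ` (act h ` e)" if "g \<in> carrier G" "h \<in> carrier G" "e \<in> E" for g h e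
      by (rule act_image_mult[OF that(1,2) edge_subset[OF that(3)]])
    show "act g ` e \<in> E" if "g \<in> carrier G" "e \<in> E" for g e by (rule act_image_edge[OF that])
  qed (rule that)
  interpret K: tree_action "G\<lparr>carrier := H\<rparr>" V E act
  proof (intro tree_action.intro tree_action_axioms.intro)
    show "group (G\<lparr>carrier := H\<rparr>)" by (rule subgroup_imp_group[OF H])
  qed (use tree act_closed act_one act_mult act_edge no_inversion in \<open>auto simp: H_def\<close>)
  have cV: "card (c ` V) = (\<Sum>s\<in>S. nat (gcd (q s) N))"
    unfolding c(1) using finS by (subst card_SigmaI) simp_all
  have cE: "card (ce ` E) = (\<Sum>i<length F. nat (gcd (y i) N))"
    unfolding ce(1) by (subst card_SigmaI) simp_all
  have "sum_list (map (wt N q) (map fst F)) = (\<Sum>i<length F. gcd (y i) N)"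
    unfolding sum_list_sum_nth by (auto simp: wt_def y_def lessThan_atLeast0 split: prod.split intro!: sum.cong)
  then have "(\<Sum>s\<in>S. gcd (q s) N) < (\<Sum>i<length F. gcd (y i) N)" using N(3) by (simp add: excess_def)
  then have "int (card (c ` V)) < int (card (ce ` E))" by (simp add: cV cE)
  then have card: "card (c ` V) < card (ce ` E)" by simp
  have so: "K.same_orbit x x' \<longleftrightarrow> (\<exists>g\<in>carrier G. N dvd \<rho> g \<and> act g x = x')" for x x'
    unfolding K.same_orbit_def by (auto simp: H_def)
  \<comment> \<open>The sets \<open>{}\<close> and \<open>UNIV\<close> serve merely as two distinct
    letters of type \<open>'a set\<close>.\<close>
  have "\<exists>h. h \<in> hom (G\<lparr>carrier := H\<rparr>) (free_group {{}, UNIV :: 'a set}) \<and>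
      h ` H = carrier (free_group {{}, UNIV :: 'a set})"
  proof (rule K.surj_free_group[of c ce "{}" UNIV])
    show "\<forall>x\<in>V. \<forall>x'\<in>V. c x = c x' \<longleftrightarrow> K.same_orbit x x'"
      unfolding so using c(2) by blast
    show "finite (c ` V)" unfolding c(1) using finS by simp
    show "finite (ce ` E)" unfolding ce(1) by simp
    show "card (c ` V) < card (ce ` E)" by (rule card)
    fix g x y assume "g \<in> carrier (G\<lparr>carrier := H\<rparr>)" and e: "{x, y} \<in> E"
    then have g: "g \<in> carrier G" "N dvd \<rho> g" by (auto simp: H_def)
    have "ce {x, y} = ce {act g x, act g y}"
      using ce(2)[OF e act_edge[OF g(1) e]] g by auto
    then show "ce {act g x, act g y} = ce {x, y}" by simp
  qed auto
  then show ?thesis using large_groupI[OF H finH, of _ "{}" UNIV] by blast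
qed

end

section \<open>Generators and edge representatives, and the case distinction on extra edges\<close>

lemma grow_distinct:
  assumes "grow r S es"
  shows "distinct (map (\<lambda>(u, l, w, m). {u, w}) es)"
  using assms
proof (induction rule: grow.induct)
  case (grow_leaf V es u w l m)
  have "{u, w} \<notin> (\<lambda>(u, l, w, m). {u, w}) ` set es"
    using grow_facts(3)[OF grow_leaf.hyps(1)] grow_leaf.hyps(2)
    by (auto simp: edges_in_def doubleton_eq_iff)
  then show ?case using grow_leaf.IH by simp
qed simp

context gbs_action
begin

text \<open>Crossing an edge out of a translate of \<open>S\<close> by the generated subgroup
  \<open>K\<close> leads into another such translate, so these translates cover the connected tree.
  An element of the group then agrees on \<open>s0\<close> with one of \<open>K\<close> up to the
  stabilizer of \<open>s0\<close>, which is in \<open>K\<close>.\<close>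

lemma generate_transversal:
  assumes S: "transversal S" and F: "edge_system S F" and s0: "s0 \<in> S"
  shows "generate G (a ` S \<union> snd ` set F) = carrier G"
proof -
  note Ff = edge_system_facts[OF F]
  have SV: "S \<subseteq> V" using S by (auto simp: transversal_def)
  have St: "s = s'" if "s \<in> S" "s' \<in> S" "h \<in> carrier G" "act h s = s'" for s s' h
    using S that unfolding transversal_def same_orbit_def by blast
  define K where "K = generate G (a ` S \<union> snd ` set F)"
  have gens: "a ` S \<union> snd ` set F \<subseteq> carrier G" using gen_closed SV Ff(1) by force
  have K: "subgroup K G" unfolding K_def by (rule generate_is_subgroup[OF gens])
  note Km = subgroup.m_closed[OF K] and Ki = subgroup.m_inv_closed[OF K] and Kc = subgroup.mem_carrier[OF K]
  have aK: "a s \<in> K" if "s \<in> S" for s unfolding K_def using that by (intro generate.incl) auto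
  have bK: "b \<in> K" if "(e, b) \<in> set F" for e b unfolding K_def using that by (intro generate.incl) force
  have stabK: "g \<in> K" if s: "s \<in> S" and g: "g \<in> carrier G" "act g s = s" for g s
  proof -
    obtain k :: int where "g = a s [^] k" using gen_stab[of s g] s g SV by auto
    then show ?thesis using subgroup_int_pow_closed[OF K aK[OF s]] by simp
  qed
  have step: "\<exists>k\<in>K. \<exists>s\<in>S. y = act k s"
    if e: "{x, y} \<in> E" and x: "k \<in> K" "s \<in> S" "x = act k s" for x y k s
  proof -
    obtain i h where i: "i < length F" "h \<in> carrier G" "{x, y} = act h ` edge_of (F ! i)"
      using Ff(3)[OF e] by blast
    obtain u l w m b where f: "F ! i = ((u, l, w, m), b)" by (metis prod.exhaust)
    have f': "((u, l, w, m), b) \<in> set F" using i f by (metis nth_mem)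
    have fu: "u \<in> S" "w \<in> S" "b \<in> carrier G" using Ff(1)[OF f'] by auto
    have V: "u \<in> V" "w \<in> V" "s \<in> V" "act b w \<in> V" using fu x SV act_closed by auto
    have kc: "k \<in> carrier G" using Kc x(1) by blast
    have "{x, y} = {act h u, act h (act b w)}" using i(3) f by (simp add: edge_of_def)
    then consider "x = act h u" "y = act h (act b w)" | "y = act h u" "x = act h (act b w)"
      by (auto simp: doubleton_eq_iff)
    then show ?thesis
    proof cases
      case 1
      have kh: "inv k \<otimes> h \<in> carrier G" using kc i by simp
      have us: "act (inv k \<otimes> h) u = s" using 1 x(3) act_mult[of "inv k" h u] act_inv(1)[of k s] kc i V by simp
      have "u = s" by (rule St[OF fu(1) x(2) kh us])
      then have "inv k \<otimes> h \<in> K" using stabK[OF fu(1) kh] us by simp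
      then have "k \<otimes> (inv k \<otimes> h) \<in> K" using Km x(1) by blast
      then have "h \<in> K" using kc i by (simp add: mult_inv_cancel)
      then have "h \<otimes> b \<in> K" using Km bK[OF f'] by blast
      moreover have "y = act (h \<otimes> b) w" using 1 act_mult i fu V by simp
      ultimately show ?thesis using fu(2) by blast
    next
      case 2
      have hb: "h \<otimes> b \<in> carrier G" using i fu by simp
      have "x = act (h \<otimes> b) w" using 2 act_mult i fu V by simp
      then have ws: "act (inv k \<otimes> (h \<otimes> b)) w = s"
        using x(3) act_mult[of "inv k" "h \<otimes> b" w] act_inv(1)[of k s] kc hb V by simp
      have kh: "inv k \<otimes> (h \<otimes> b) \<in> carrier G" using kc hb by simp
      have "w = s" by (rule St[OF fu(2) x(2) kh ws])
      then have "inv k \<otimes> (h \<otimes> b) \<in> K" using stabK[OF fu(2) kh] ws by simp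
      then have "k \<otimes> (inv k \<otimes> (h \<otimes> b)) \<in> K" using Km x(1) by blast
      then have "h \<otimes> b \<in> K" using kc hb mult_inv_cancel(1) by metis
      then have "(h \<otimes> b) \<otimes> inv b \<in> K" using Km Ki bK[OF f'] by blast
      then have "h \<in> K" using i fu by (simp add: m_assoc)
      then show ?thesis using 2(1) fu(1) by blast
    qed
  qed
  have s0V: "s0 \<in> V" using s0 SV by auto
  have all: "\<exists>k\<in>K. \<exists>s\<in>S. y = act k s" if y: "y \<in> V" for y
    using connected[OF s0V y]
  proof (induction rule: rtrancl_induct)
    case base
    have "\<one> \<in> K" by (rule subgroup.one_closed[OF K])
    then show ?case using s0 act_one[OF s0V] by (intro bexI[of _ \<one>] bexI[of _ s0]) simp_all
  next
    case (step y z)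
    then show ?case using \<open>\<And>x y k s. {x, y} \<in> E \<Longrightarrow> k \<in> K \<Longrightarrow> s \<in> S \<Longrightarrow> x = act k s \<Longrightarrow> \<exists>k\<in>K. \<exists>s\<in>S. y = act k s\<close>
      by blast
  qed
  have "g \<in> K" if g: "g \<in> carrier G" for g
  proof -
    obtain k s where k: "k \<in> K" "s \<in> S" "act g s0 = act k s" using all[OF act_closed[OF g s0V]] by blast
    have kc: "k \<in> carrier G" using Kc k(1) by blast
    have sV: "s \<in> V" using k SV by auto
    have kg: "inv k \<otimes> g \<in> carrier G" using kc g by simp
    have e: "act (inv k \<otimes> g) s0 = s" using k(3) act_mult[of "inv k" g s0] act_inv(1)[OF kc sV] kc g s0V by simp
    have "s0 = s" by (rule St[OF s0 k(2) kg e])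
    then have "inv k \<otimes> g \<in> K" using stabK[OF s0 kg] e by simp
    then have "k \<otimes> (inv k \<otimes> g) \<in> K" using Km k(1) by blast
    then show ?thesis using kc g by (simp add: mult_inv_cancel)
  qed
  then show ?thesis using subgroup.subset[OF K] unfolding K_def by blast
qed

text \<open>Edges of the lifted spanning tree get the trivial stable letter. For every other edge
  orbit an edge starting in \<open>S\<close> is chosen, and its far end is written as a translate of
  a vertex of \<open>S\<close>.\<close>

lemma edge_system_exists:
  assumes lab: "\<forall>x y. {x, y} \<in> E \<longrightarrow> (\<exists>l m. l \<noteq> 0 \<and> m \<noteq> 0 \<and> edge_label x l y m)"
    and finE: "finite (eorb ` E)" and S: "transversal S" and gr: "grow r S es"
    and es: "\<forall>(u, l, w, m)\<in>set es. {u, w} \<in> E \<and> edge_label u l w m"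
  shows "\<exists>F. edge_system S (map (\<lambda>e. (e, \<one>)) es @ F)"
proof -
  have SV: "S \<subseteq> V" using S by (auto simp: transversal_def)
  have St: "s = s'" if "s \<in> S" "s' \<in> S" "h \<in> carrier G" "act h s = s'" for s s' h
    using S that unfolding transversal_def same_orbit_def by blast
  define ok where "ok f \<longleftrightarrow> (case f of ((u, l, w, m), b) \<Rightarrow> u \<in> S \<and> w \<in> S \<and> b \<in> carrier G \<and>
    {u, act b w} \<in> E \<and> l \<noteq> 0 \<and> m \<noteq> 0 \<and> edge_label u l (act b w) m)" for f
  let ?es = "map (\<lambda>e. (e, \<one>)) es"
  have es_ok: "ok f" if f: "f \<in> set ?es" for f
  proof -
    obtain u l w m where "f = ((u, l, w, m), \<one>)" "(u, l, w, m) \<in> set es" using f by auto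
    moreover from this have "u \<in> S" "w \<in> S" "l \<noteq> 0" "m \<noteq> 0" "{u, w} \<in> E" "edge_label u l w m"
      using grow_facts(3,5)[OF gr] es by (auto simp: edges_in_def)
    ultimately show ?thesis using act_one SV by (auto simp: ok_def)
  qed
  have pick: "\<exists>f. ok f \<and> edge_of f \<in> C" if C: "C \<in> eorb ` E" for C
  proof -
    obtain e where e: "e \<in> E" "C = eorb e" using C by blast
    obtain x y where xy: "e = {x, y}" using edge_form[OF e(1)] by blast
    have V: "x \<in> V" "y \<in> V" using edge_V e(1) xy by auto
    obtain u where u: "u \<in> S" "same_orbit u x" using S V unfolding transversal_def by blast
    have uV: "u \<in> V" using u SV by auto
    obtain g where g: "g \<in> carrier G" "act g x = u" using same_orbit_sym[OF uV u(2)] by (auto simp: same_orbit_def)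
    obtain w where w: "w \<in> S" "same_orbit w (act g y)"
      using S act_closed[OF g(1) V(2)] unfolding transversal_def by blast
    obtain b where b: "b \<in> carrier G" "act b w = act g y" using w(2) by (auto simp: same_orbit_def)
    have eg: "act g ` e = {u, act b w}" using xy g b by simp
    then have "{u, act b w} \<in> E" using act_image_edge[OF g(1) e(1)] by simp
    moreover from this obtain l m where "l \<noteq> 0" "m \<noteq> 0" "edge_label u l (act b w) m" using lab by blast
    ultimately have "ok ((u, l, w, m), b)" using u w b by (simp add: ok_def)
    moreover have "edge_of ((u, l, w, m), b) \<in> C"
      unfolding e(2) eorb_def edge_of_def using eg g(1) by auto
    ultimately show ?thesis by blast
  qed
  define t where "t C = (SOME f. ok f \<and> edge_of f \<in> C)" for C
  have t: "ok (t C) \<and> edge_of (t C) \<in> C" if "C \<in> eorb ` E" for C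
    unfolding t_def using pick[OF that] by (rule someI_ex)
  have eorb_t: "eorb (edge_of (t C)) = C" if C: "C \<in> eorb ` E" for C
  proof -
    obtain e where e: "e \<in> E" "C = eorb e" using C by blast
    then obtain g where "g \<in> carrier G" "edge_of (t C) = act g ` e"
      using t[OF C] by (auto simp: eorb_def)
    then show ?thesis using eorb_act[OF _ edge_subset[OF e(1)]] e(2) by simp
  qed
  define Rm where "Rm = eorb ` E - (\<lambda>x. eorb (edge_of x)) ` set ?es"
  obtain L where L: "set L = Rm" "distinct L"
    using finite_distinct_list[of Rm] finE unfolding Rm_def by blast
  define F where "F = map t L"
  have okF: "ok f" if "f \<in> set (?es @ F)" for f
    using that es_ok t L(1) by (auto simp: F_def Rm_def)
  have es_eo: "edge_of (e, \<one>) = (case e of (u, l, w, m) \<Rightarrow> {u, w})" if "e \<in> set es" for e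
    using that grow_facts(3)[OF gr] SV act_one by (auto simp: edge_of_def edges_in_def)
  have ok_E: "edge_of f \<in> E" if "ok f" for f
    using that by (auto simp: ok_def edge_of_def)
  \<comment> \<open>If a translate of one tree edge is another, the ends correspond within the
    transversal \<open>S\<close>, so both edges are the same.\<close>
  have inj: "e = e'" if e: "e \<in> set es" "e' \<in> set es" and o: "eorb (edge_of (e, \<one>)) = eorb (edge_of (e', \<one>))" for e e'
  proof -
    obtain u l w m where e1: "e = (u, l, w, m)" by (metis prod.exhaust)
    obtain u' l' w' m' where e2: "e' = (u', l', w', m')" by (metis prod.exhaust)
    have s: "u \<in> S" "w \<in> S" "u' \<in> S" "w' \<in> S" using grow_facts(3)[OF gr] e e1 e2 by (auto simp: edges_in_def)
    have "{u', w'} \<in> eorb {u, w}"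
      using o eorb_self[of "{u', w'}"] es_eo[OF e(1)] es_eo[OF e(2)] e1 e2 s SV by auto
    then obtain g where g: "g \<in> carrier G" "{u', w'} = {act g u, act g w}" by (auto simp: eorb_def)
    then have "{u', w'} = {u, w}" using St[OF _ _ g(1)] s by (metis doubleton_eq_iff)
    then have "(\<lambda>(u, l, w, m). {u, w}) e = (\<lambda>(u, l, w, m). {u, w}) e'" by (simp add: e1 e2)
    moreover have "inj_on (\<lambda>(u, l, w, m). {u, w}) (set es)"
      using grow_distinct[OF gr] by (simp add: distinct_map)
    ultimately show ?thesis using e by (simp add: inj_on_eq_iff)
  qed
  have "distinct (map (\<lambda>x. eorb (edge_of x)) ?es)"
  proof -
    have "distinct es" using grow_distinct[OF gr] by (simp add: distinct_map)
    moreover have "inj_on (\<lambda>e. eorb (edge_of (e, \<one>))) (set es)" using inj by (intro inj_onI) blast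
    ultimately show ?thesis by (simp add: distinct_map o_def)
  qed
  moreover have mapF: "map (\<lambda>x. eorb (edge_of x)) F = L"
    unfolding F_def map_map o_def using eorb_t L(1) by (intro map_idI) (auto simp: Rm_def)
  ultimately have dist: "distinct (map (\<lambda>x. eorb (edge_of x)) (?es @ F))"
    using L by (auto simp: Rm_def)
  have "(\<lambda>x. eorb (edge_of x)) ` set F = Rm" using arg_cong[OF mapF, of set] L(1) by simp
  moreover have "(\<lambda>x. eorb (edge_of x)) ` set ?es \<subseteq> eorb ` E" using es_ok ok_E by blast
  ultimately have "(\<lambda>x. eorb (edge_of x)) ` set (?es @ F) = eorb ` E"
    unfolding set_append image_Un by (auto simp: Rm_def)
  then have "edge_system S (?es @ F)"
    unfolding edge_system_def using okF dist unfolding ok_def by blast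
  then show ?thesis by blast
qed

text \<open>The length of \<open>F\<close> is the first Betti number of the quotient graph. The
  three cases are a tree, a single circuit, and more than one circuit.\<close>

lemma quotient_of_BS_if_not_large:
  assumes lab: "\<forall>x y. {x, y} \<in> E \<longrightarrow> (\<exists>l m. l \<noteq> 0 \<and> m \<noteq> 0 \<and> edge_label x l y m)"
    and finV: "finite ((\<lambda>x. {y. same_orbit x y}) ` V)" and finE: "finite (eorb ` E)"
    and nl: "\<not> large_group G"
  shows "\<exists>m n :: int. m \<noteq> 0 \<and> n \<noteq> 0 \<and> coprime m n \<and> is_quotient_of G (BS m n)"
proof -
  obtain r where r: "r \<in> V" using tree unfolding is_tree_def by blast
  define c where "c x = {y. same_orbit x y}" for x
  have self: "same_orbit x x" if "x \<in> V" for x using that act_one by (auto simp: same_orbit_def intro: bexI[of _ \<one>])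
  have c: "\<forall>x\<in>V. \<forall>y\<in>V. c x = c y \<longleftrightarrow> same_orbit x y"
  proof (intro ballI iffI)
    fix x y assume xy: "x \<in> V" "y \<in> V"
    show "same_orbit x y" if "c x = c y" using that self[OF xy(2)] by (auto simp: c_def)
    assume "same_orbit x y"
    then obtain g where "g \<in> carrier G" "act g x = y" by (auto simp: same_orbit_def)
    then show "c x = c y" using same_orbit_act[of g x] xy by (auto simp: c_def)
  qed
  have finc: "finite (c ` V)" using finV by (simp add: c_def)
  obtain S es where gr: "grow r S es" and SV: "S \<subseteq> V" and inj: "inj_on c S" and cS: "c ` S = c ` V"
    and es: "\<forall>(u, l, w, m)\<in>set es. {u, w} \<in> E \<and> edge_label u l w m"
    using spanning_tree[OF c finc r lab] by iprover
  note gf = grow_facts[OF gr]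
  have S: "transversal S"
    unfolding transversal_def
  proof (intro conjI ballI impI)
    show "finite S" "S \<subseteq> V" by (fact gf(1), fact SV)
    show "\<exists>s\<in>S. same_orbit s x" if x: "x \<in> V" for x
    proof -
      have "c x \<in> c ` S" using cS x by simp
      then obtain s where "s \<in> S" "c x = c s" by blast
      then show ?thesis using c SV x by (metis subsetD)
    qed
    show "s = s'" if "s \<in> S" "s' \<in> S" "same_orbit s s'" for s s'
      using c inj SV that by (metis inj_onD subsetD)
  qed
  obtain F where F: "edge_system S (map (\<lambda>e. (e, \<one>)) es @ F)"
    using edge_system_exists[OF lab finE S gr es] by blast
  have mf: "map fst (map (\<lambda>e. (e, \<one>)) es @ F) = es @ map fst F" by (simp add: o_def)
  have nw: "\<not> witness S (es @ map fst F)" using witness_large[OF S F] nl unfolding mf by blast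
  have gen: "generate G (a ` S \<union> snd ` set (map (\<lambda>e. (e, \<one>)) es @ F)) = carrier G"
    by (rule generate_transversal[OF S F gf(2)])
  note Ff = edge_system_facts(1)[OF F]
  \<comment> \<open>\<open>tree_cases\<close> and \<open>circuit_cases\<close> want elements of the
    group at all vertices, so \<open>\<one>\<close> is the default outside \<open>S\<close>.\<close>
  define a' where "a' v = (if v \<in> S then a v else \<one>)" for v
  have a'c: "a' v \<in> carrier G" for v using gen_closed SV by (auto simp: a'_def)
  have a'S: "a' v = a v" if "v \<in> S" for v using that by (simp add: a'_def)
  have rel: "a' u [^] l = a' w [^] m" if e: "(u, l, w, m) \<in> set es" for u l w m
  proof -
    have "edge_label u l w m" using bspec[OF es e] by simp
    moreover have "u \<in> S \<and> w \<in> S" using bspec[OF gf(3)[unfolded edges_in_def] e] by simp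
    ultimately show ?thesis using a'S by (simp add: edge_label_def)
  qed
  have rels: "\<forall>(u, l, w, m)\<in>set es. a' u [^] l = a' w [^] m" using rel by blast
  consider "F = []" | f where "F = [f]" | "length F \<ge> 2" by (cases F; cases "tl F") auto
  then show ?thesis
  proof cases
    case 1
    have gen1: "carrier G \<subseteq> J" if "subgroup J G" "a ` S \<subseteq> J" for J
    proof -
      have "a ` S \<union> snd ` set (map (\<lambda>e. (e, \<one>)) es @ F) \<subseteq> J"
        using that 1 subgroup.one_closed by auto
      then show ?thesis using generate_subgroup_incl that(1) gen by metis
    qed
    have "cyclic_tree a' S es \<or> klein_tree a' S es"
      using tree_cases[OF gr a'c rels] nw 1 by simp
    then show ?thesis
    proof
      assume "cyclic_tree a' S es"
      then obtain v x where v: "v \<in> S" "\<And>z. z \<in> S \<Longrightarrow> a' z = a' v [^] (x z :: int)"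
        unfolding cyclic_tree_def by blast
      have J: "subgroup (generate G {a' v, \<one>}) G" using a'c by (intro generate_is_subgroup) auto
      have avJ: "a' v \<in> generate G {a' v, \<one>}" by (intro generate.incl) simp
      have "a z \<in> generate G {a' v, \<one>}" if "z \<in> S" for z
      proof -
        have "a z = a' v [^] x z" using v(2)[OF that] a'S[OF that] by simp
        then show ?thesis using subgroup_int_pow_closed[OF J avJ] by simp
      qed
      then have "carrier G \<subseteq> generate G {a' v, \<one>}" using gen1[OF J] by blast
      then have genv: "generate G {a' v, \<one>} = carrier G" using subgroup.subset[OF J] by blast
      \<comment> \<open>A cyclic group is a quotient of the free abelian group
        \<open>BS 1 1\<close>, with the stable letter sent to \<open>\<one>\<close>.\<close>
      have relv: "\<one> \<otimes> a' v [^] (1::int) \<otimes> inv \<one> = a' v [^] (1::int)" using a'c[of v] by simp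
      have "is_quotient_of G (BS 1 1)"
        by (rule quotient_of_BSI[OF a'c one_closed genv relv])
      then show ?thesis by (intro exI[of _ 1]) simp
    next
      assume "klein_tree a' S es"
      then obtain v v' \<epsilon> x where v: "v \<in> S" "v' \<in> S" "\<epsilon> \<in> {1, -1::int}"
        "a' v [^] (2::int) = a' v' [^] (2 * \<epsilon>)"
        "\<And>z. z \<in> S \<Longrightarrow> a' z = a' v [^] (x z :: int) \<or> a' z = a' v' [^] x z"
        unfolding klein_tree_def by blast
      define A where "A = a' v"
      define B where "B = a' v' [^] \<epsilon>"
      have AB: "A \<in> carrier G" "B \<in> carrier G" using a'c by (auto simp: A_def B_def)
      have sq: "A \<otimes> A = B \<otimes> B"
      proof -
        have "A \<otimes> A = A [^] (2::int)" using AB int_pow_mult[of A 1 1] by simp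
        also have "\<dots> = B [^] (2::int)" using v(4) a'c by (simp add: A_def B_def int_pow_pow mult.commute)
        also have "\<dots> = B \<otimes> B" using AB int_pow_mult[of B 1 1] by simp
        finally show ?thesis .
      qed
      \<comment> \<open>For elements with equal squares, conjugation by \<open>A\<close> inverts
        \<open>inv B \<otimes> A\<close>: the product \<open>A \<otimes> inv B\<close> equals
        \<open>inv A \<otimes> (A \<otimes> A) \<otimes> inv B\<close>, hence
        \<open>inv A \<otimes> B\<close>.\<close>
      let ?T = "inv B \<otimes> A"
      have T: "?T \<in> carrier G" using AB by simp
      have J: "subgroup (generate G {?T, A}) G" using AB by (intro generate_is_subgroup) auto
      have inJ: "?T \<in> generate G {?T, A}" "A \<in> generate G {?T, A}" by (auto intro: generate.incl)
      have "A \<otimes> inv ?T \<in> generate G {?T, A}"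
        using inJ subgroup.m_closed[OF J] subgroup.m_inv_closed[OF J] by blast
      moreover have "A \<otimes> inv ?T = B" using AB by (simp add: inv_mult_group mult_inv_cancel)
      ultimately have BJ: "B \<in> generate G {?T, A}" by simp
      have v'B: "a' v' = B [^] \<epsilon>" using v(3) a'c by (auto simp: B_def int_pow_pow)
      have v'J: "a' v' \<in> generate G {?T, A}" unfolding v'B by (rule subgroup_int_pow_closed[OF J BJ])
      have "a z \<in> generate G {?T, A}" if z: "z \<in> S" for z
        using v(5)[OF z] a'S[OF z] subgroup_int_pow_closed[OF J v'J, of "x z"]
          subgroup_int_pow_closed[OF J inJ(2), of "x z"] by (auto simp: A_def)
      then have "carrier G \<subseteq> generate G {?T, A}" using gen1[OF J] by blast
      then have genT: "generate G {?T, A} = carrier G" using subgroup.subset[OF J] by blast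
      have "A \<otimes> ?T \<otimes> inv A = A \<otimes> inv B" using AB by (simp add: m_assoc)
      also have "\<dots> = inv A \<otimes> (A \<otimes> A) \<otimes> inv B" using AB by (simp add: m_assoc mult_inv_cancel)
      also have "\<dots> = inv ?T" unfolding sq using AB by (simp add: m_assoc inv_mult_group)
      finally have relT: "A \<otimes> ?T [^] (1::int) \<otimes> inv A = ?T [^] (- 1 :: int)" using T by (simp add: int_pow_neg)
      have "is_quotient_of G (BS 1 (- 1))"
        by (rule quotient_of_BSI[OF T AB(1) genT relT])
      then show ?thesis by (intro exI[of _ 1] exI[of _ "- 1"]) simp
    qed
  next
    case (2 f)
    obtain x l y m b where f: "f = ((x, l, y, m), b)" by (metis prod.exhaust)
    have fx: "x \<in> S" "y \<in> S" "b \<in> carrier G" "l \<noteq> 0" "m \<noteq> 0" "edge_label x l (act b y) m"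
      using Ff[of x l y m b] 2 f by auto
    have yV: "y \<in> V" using fx SV by auto
    have "a x [^] l = (b \<otimes> a y \<otimes> inv b) [^] m"
      using fx(6) gen_equi[OF fx(3) yV] by (simp add: edge_label_def)
    also have "\<dots> = b \<otimes> a y [^] m \<otimes> inv b" using conj_int_pow gen_closed[OF yV] fx(3) by simp
    finally have "inv b \<otimes> a x [^] l \<otimes> inv (inv b) = a y [^] m"
      using gen_closed[OF yV] fx(3) by (simp add: m_assoc mult_inv_cancel)
    then have rel2: "inv b \<otimes> a' x [^] l \<otimes> inv (inv b) = a' y [^] m" using a'S fx by simp
    \<comment> \<open>With stable letter \<open>inv b\<close> the extra edge starts at
      \<open>x\<close>, and \<open>circuit_cases\<close> expects its start to be the root of the
      tree.\<close>
    obtain es' where es': "grow x S es'"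
      "\<forall>(u, l, w, m)\<in>set es'. (u, l, w, m) \<in> set es \<or> (w, m, u, l) \<in> set es"
      "\<forall>N q. compat N q es' \<longrightarrow> compat N q es \<and>
        sum_list (map (wt N q) es) = sum_list (map (wt N q) es')"
      using grow_reroot[OF gr fx(1)] by blast
    have rels': "\<forall>(u, l, w, m)\<in>set es'. a' u [^] l = a' w [^] m"
      using es'(2) rel by (force dest: sym)
    have npw: "\<not> prime_witness S ((x, l, y, m) # es')"
    proof
      assume "prime_witness S ((x, l, y, m) # es')"
      then obtain N q where N: "N > 0" "compat N q ((x, l, y, m) # es')" "excess N q S ((x, l, y, m) # es') > 0"
        using prime_witness_imp_witness unfolding witness_def by blast
      have "compat N q es'" using N(2) by simp
      then have "compat N q es" "sum_list (map (wt N q) es) = sum_list (map (wt N q) es')"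
        using es'(3) by blast+
      then have "compat N q (es @ map fst F) \<and> excess N q S (es @ map fst F) > 0"
        using N(2,3) 2 f by (auto simp: compat_def excess_def)
      then show False using nw N(1) unfolding witness_def by blast
    qed
    obtain L M :: int where LM: "L \<noteq> 0" "M \<noteq> 0" "coprime L M"
      "inv b \<otimes> a' x [^] L \<otimes> inv (inv b) = a' x [^] M" "a' ` S \<subseteq> generate G {a' x, inv b}"
      using circuit_cases[OF es'(1) a'c inv_closed[OF fx(3)] rels' fx(2,4,5) rel2 npw] by blast
    let ?J = "generate G {a' x, inv b}"
    have J: "subgroup ?J G" using a'c fx(3) by (intro generate_is_subgroup) auto
    have "inv b \<in> ?J" by (intro generate.incl) simp
    then have "inv (inv b) \<in> ?J" by (rule subgroup.m_inv_closed[OF J])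
    then have "b \<in> ?J" using fx(3) by simp
    moreover have "a ` S \<subseteq> ?J" using LM(5) a'S by auto
    ultimately have "a ` S \<union> snd ` set (map (\<lambda>e. (e, \<one>)) es @ F) \<subseteq> ?J"
      using 2 f subgroup.one_closed[OF J] by auto
    then have "carrier G \<subseteq> ?J" using generate_subgroup_incl[OF _ J] gen by metis
    then have genJ: "?J = carrier G" using subgroup.subset[OF J] by blast
    have "is_quotient_of G (BS L M)"
      by (rule quotient_of_BSI[OF a'c inv_closed[OF fx(3)] genJ LM(4)])
    then show ?thesis using LM by blast
  next
    case 3
    \<comment> \<open>Modulo 1 the kernel is the whole group, and the excess is the number of edges
      minus the number of vertices of the quotient graph.\<close>
    define q :: "'v \<Rightarrow> int" where "q v = 0" for v
    have "length (es @ map fst F) > card S" using 3 gf(4) by simp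
    moreover have "sum_list (map (wt 1 q) (es @ map fst F)) = int (length (es @ map fst F))"
    proof -
      have "map (wt 1 q) (es @ map fst F) = map (\<lambda>_. 1) (es @ map fst F)"
        by (intro map_cong) (auto simp: wt_def)
      then show ?thesis by (simp only: sum_list_triv)
    qed
    ultimately have "excess 1 q S (es @ map fst F) > 0" by (simp add: excess_def)
    moreover have "compat 1 q (es @ map fst F)" by (auto simp: compat_def)
    ultimately have "witness S (es @ map fst F)" unfolding witness_def by (intro exI[of _ 1]) auto
    then show ?thesis using nw by blast
  qed
qed

end

section \<open>From an arbitrary tree with infinite cyclic stabilizers to a cofinite action with
  chosen generators\<close>

lemma (in group) infinite_cyclic_generator:
  assumes "infinite_cyclic_subgroup H G"
  shows "\<exists>c\<in>carrier G. (\<forall>g. g \<in> H \<longleftrightarrow> (\<exists>k::int. g = c [^] k)) \<and> (\<forall>k::int. c [^] k = \<one> \<longrightarrow> k = 0)"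
proof -
  have H: "subgroup H G" and iso: "G\<lparr>carrier := H\<rparr> \<cong> integer_group"
    using assms by (auto simp: infinite_cyclic_subgroup_def)
  interpret H: group "G\<lparr>carrier := H\<rparr>" by (rule subgroup_imp_group[OF H])
  have "integer_group \<cong> G\<lparr>carrier := H\<rparr>" by (rule H.iso_sym[OF iso])
  then obtain \<psi> where \<psi>: "\<psi> \<in> iso integer_group (G\<lparr>carrier := H\<rparr>)" by (auto simp: is_iso_def)
  interpret \<psi>: group_hom integer_group "G\<lparr>carrier := H\<rparr>" \<psi>
    using \<psi> by (intro group_hom.intro group_integer_group H.group_axioms group_hom_axioms.intro)
      (simp add: iso_def)
  define c where "c = \<psi> 1"
  have cH: "c \<in> H" using \<psi>.hom_closed[of 1] by (simp add: c_def)
  have pow: "\<psi> k = c [^] k" for k :: int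
  proof -
    have "\<psi> (1 [^]\<^bsub>integer_group\<^esub> k) = c [^]\<^bsub>G\<lparr>carrier := H\<rparr>\<^esub> k"
      unfolding c_def by (rule \<psi>.hom_int_pow) simp
    then show ?thesis using int_pow_consistent[OF H cH] by simp
  qed
  have bij: "bij_betw \<psi> UNIV H" using \<psi> by (simp add: iso_def)
  have "g \<in> H \<longleftrightarrow> (\<exists>k::int. g = c [^] k)" for g
    using bij_betw_imp_surj_on[OF bij] by (auto simp flip: pow)
  moreover have "k = 0" if "c [^] k = \<one>" for k :: int
  proof -
    have "\<psi> k = \<psi> 0" using that pow[of k] pow[of 0] by simp
    then show ?thesis using bij_betw_imp_inj_on[OF bij] by (simp add: inj_eq)
  qed
  ultimately show ?thesis using subgroup.mem_carrier[OF H cH] by blast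
qed

text \<open>The edges of one walk suffice. The last clause, that each of them is reachable within
  the set, is what later makes the union of all translates connected.\<close>

lemma rtrancl_finite_edges:
  assumes "(x, y) \<in> {(u, v). {u, v} \<in> E}\<^sup>*"
  shows "\<exists>F. finite F \<and> F \<subseteq> E \<and> (x, y) \<in> {(u, v). {u, v} \<in> F}\<^sup>* \<and>
    (\<forall>e\<in>F. \<forall>z\<in>e. (x, z) \<in> {(u, v). {u, v} \<in> F}\<^sup>*)"
  using assms
proof (induction rule: rtrancl_induct)
  case base
  show ?case by (rule exI[of _ "{}"]) simp
next
  case (step y z)
  then obtain F where F: "finite F" "F \<subseteq> E" "(x, y) \<in> {(u, v). {u, v} \<in> F}\<^sup>*"
    "\<forall>e\<in>F. \<forall>z\<in>e. (x, z) \<in> {(u, v). {u, v} \<in> F}\<^sup>*" by blast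
  let ?F = "insert {y, z} F"
  have mono: "{(u, v). {u, v} \<in> F}\<^sup>* \<subseteq> {(u, v). {u, v} \<in> ?F}\<^sup>*" by (rule rtrancl_mono) auto
  have xy: "(x, y) \<in> {(u, v). {u, v} \<in> ?F}\<^sup>*" using F(3) mono by blast
  moreover have "(y, z) \<in> {(u, v). {u, v} \<in> ?F}" by simp
  ultimately have xz: "(x, z) \<in> {(u, v). {u, v} \<in> ?F}\<^sup>*" by (rule rtrancl_into_rtrancl)
  have "\<forall>e\<in>?F. \<forall>w\<in>e. (x, w) \<in> {(u, v). {u, v} \<in> ?F}\<^sup>*"
    using F(4) mono xy xz by blast
  then show ?case using F(1,2) xz step.hyps(2) by (intro exI[of _ ?F]) auto
qed

context tree_action
begin

text \<open>The given tree may have infinitely many orbits. Finite paths from a base vertex to its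
  images under the generators are taken, together with all their translates; a connected subgraph of
  a tree is a tree.\<close>

lemma cofinite_subtree:
  assumes "finite A" "A \<subseteq> carrier G" "generate G A = carrier G"
  shows "\<exists>V' E' W F. V' \<subseteq> V \<and> E' \<subseteq> E \<and> tree_action G V' E' act \<and> finite W \<and> finite F \<and>
    (\<forall>x\<in>V'. \<exists>w\<in>W. \<exists>g\<in>carrier G. x = act g w) \<and> (\<forall>e\<in>E'. \<exists>f\<in>F. \<exists>g\<in>carrier G. e = act g ` f) \<and>
    F \<subseteq> E' \<and> W \<subseteq> V'"
proof -
  obtain x0 where x0: "x0 \<in> V" using tree unfolding is_tree_def by blast
  have "\<forall>s\<in>A. \<exists>F. finite F \<and> F \<subseteq> E \<and> (x0, act s x0) \<in> {(u, v). {u, v} \<in> F}\<^sup>* \<and>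
    (\<forall>e\<in>F. \<forall>z\<in>e. (x0, z) \<in> {(u, v). {u, v} \<in> F}\<^sup>*)"
  proof
    fix s assume "s \<in> A"
    then have "act s x0 \<in> V" using act_closed assms(2) x0 by blast
    then show "\<exists>F. finite F \<and> F \<subseteq> E \<and> (x0, act s x0) \<in> {(u, v). {u, v} \<in> F}\<^sup>* \<and>
      (\<forall>e\<in>F. \<forall>z\<in>e. (x0, z) \<in> {(u, v). {u, v} \<in> F}\<^sup>*)"
      by (rule rtrancl_finite_edges[OF connected[OF x0]])
  qed
  from bchoice[OF this] obtain P where P: "\<forall>s\<in>A. finite (P s) \<and> P s \<subseteq> E \<and>
    (x0, act s x0) \<in> {(u, v). {u, v} \<in> P s}\<^sup>* \<and>
    (\<forall>e\<in>P s. \<forall>z\<in>e. (x0, z) \<in> {(u, v). {u, v} \<in> P s}\<^sup>*)" by iprover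
  define F where "F = (\<Union>s\<in>A. P s)"
  have F: "finite F" "F \<subseteq> E" using P assms(1) by (auto simp: F_def)
  define E' where "E' = {act g ` e | g e. g \<in> carrier G \<and> e \<in> F}"
  \<comment> \<open>The orbit of \<open>x0\<close> is added explicitly, since there are no edges at
    all if the generators fix \<open>x0\<close>.\<close>
  define V' where "V' = {act g x0 | g. g \<in> carrier G} \<union> \<Union>E'"
  define C where "C = {(u, v). {u, v} \<in> E'}"
  have E'E: "E' \<subseteq> E" using F(2) act_image_edge by (auto simp: E'_def)
  have V'V: "V' \<subseteq> V" using act_closed x0 E'E edge_subset by (fastforce simp: V'_def)
  have FE': "F \<subseteq> E'"
  proof
    fix e assume e: "e \<in> F"
    then have "e = act \<one> ` e" using act_image_one[OF edge_subset] F(2) by auto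
    then show "e \<in> E'" using e one_closed unfolding E'_def by blast
  qed
  have E'_act: "act g ` e \<in> E'" if g: "g \<in> carrier G" and e: "e \<in> E'" for g e
  proof -
    obtain h f where h: "h \<in> carrier G" "f \<in> F" "e = act h ` f" using e by (auto simp: E'_def)
    have "act g ` e = act (g \<otimes> h) ` f" using act_image_mult[OF g h(1) edge_subset] h F(2) by auto
    then show ?thesis using h g m_closed unfolding E'_def by blast
  qed
  have C_act: "(act g x, act g y) \<in> C\<^sup>*" if g: "g \<in> carrier G" and xy: "(x, y) \<in> C\<^sup>*" for g x y
    using xy
  proof (induction rule: rtrancl_induct)
    case (step y z)
    have "{y, z} \<in> E'" using step.hyps(2) by (simp add: C_def)
    from E'_act[OF g this] have "(act g y, act g z) \<in> C" by (simp add: C_def)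
    with step.IH show ?case by (rule rtrancl_into_rtrancl)
  qed simp
  have symC: "sym C" by (auto simp: C_def sym_def insert_commute)
  then have C_sym: "(y, x) \<in> C\<^sup>*" if "(x, y) \<in> C\<^sup>*" for x y using that by (meson symD sym_rtrancl)
  have PC: "{(u, v). {u, v} \<in> P s}\<^sup>* \<subseteq> C\<^sup>*" if "s \<in> A" for s
    using that FE' by (intro rtrancl_mono) (auto simp: C_def F_def)
  \<comment> \<open>The elements that move \<open>x0\<close> within its component form a subgroup.
    It contains the generators, so it is everything and the subgraph is connected.\<close>
  define M where "M = {g \<in> carrier G. (x0, act g x0) \<in> C\<^sup>*}"
  have "subgroup M G"
  proof (rule subgroupI)
    fix g assume "g \<in> M"
    then have g: "g \<in> carrier G" "(x0, act g x0) \<in> C\<^sup>*" by (auto simp: M_def)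
    have "(act (inv g) x0, act (inv g) (act g x0)) \<in> C\<^sup>*" using C_act g by simp
    then show "inv g \<in> M" using g act_inv(1) x0 C_sym by (simp add: M_def)
  next
    fix g h assume "g \<in> M" "h \<in> M"
    then have g: "g \<in> carrier G" "(x0, act g x0) \<in> C\<^sup>*" and h: "h \<in> carrier G" "(x0, act h x0) \<in> C\<^sup>*"
      by (auto simp: M_def)
    have "(act g x0, act g (act h x0)) \<in> C\<^sup>*" using C_act[OF g(1) h(2)] .
    then have "(x0, act (g \<otimes> h) x0) \<in> C\<^sup>*" using g(2) act_mult g h x0 by simp
    then show "g \<otimes> h \<in> M" using g h by (simp add: M_def)
  next
    have "\<one> \<in> M" using act_one[OF x0] by (simp add: M_def)
    then show "M \<noteq> {}" by blast
  qed (auto simp: M_def)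
  moreover have "A \<subseteq> M"
  proof
    fix s assume s: "s \<in> A"
    have "(x0, act s x0) \<in> {(u, v). {u, v} \<in> P s}\<^sup>*" using bspec[OF P s] by (elim conjE)
    then have "(x0, act s x0) \<in> C\<^sup>*" using PC[OF s] by blast
    then show "s \<in> M" using s assms(2) by (auto simp: M_def)
  qed
  ultimately have M: "carrier G \<subseteq> M" using generate_subgroup_incl[of A M] assms(3) by simp
  have reach: "(x0, x) \<in> C\<^sup>*" if x: "x \<in> V'" for x
  proof -
    consider g where "g \<in> carrier G" "x = act g x0" | e where "e \<in> E'" "x \<in> e"
      using x by (auto simp: V'_def)
    then show ?thesis
    proof cases
      case 1
      then show ?thesis using M by (auto simp: M_def)
    next
      case 2
      obtain g f where gf: "g \<in> carrier G" "f \<in> F" "e = act g ` f" using 2(1) by (auto simp: E'_def)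
      obtain z where z: "z \<in> f" "x = act g z" using 2(2) gf(3) by blast
      obtain s where s: "s \<in> A" "f \<in> P s" using gf(2) by (auto simp: F_def)
      have "\<forall>e\<in>P s. \<forall>z\<in>e. (x0, z) \<in> {(u, v). {u, v} \<in> P s}\<^sup>*" using bspec[OF P s(1)] by (elim conjE)
      then have "(x0, z) \<in> {(u, v). {u, v} \<in> P s}\<^sup>*" using s(2) z(1) by blast
      then have "(x0, z) \<in> C\<^sup>*" using PC[OF s(1)] by blast
      then have "(act g x0, x) \<in> C\<^sup>*" using C_act[OF gf(1)] z(2) by simp
      moreover have "(x0, act g x0) \<in> C\<^sup>*" using M gf(1) by (auto simp: M_def)
      ultimately show ?thesis by simp
    qed
  qed
  have x0V': "x0 \<in> V'" using act_one[OF x0] one_closed unfolding V'_def by force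
  have tree': "is_tree V' E'"
    unfolding is_tree_def
  proof (intro conjI ballI)
    show "V' \<noteq> {}" using x0V' by blast
    show "E' \<subseteq> {{x, y} |x y. x \<in> V' \<and> y \<in> V' \<and> x \<noteq> y}"
    proof
      fix e assume e: "e \<in> E'"
      then obtain x y where "e = {x, y}" "x \<noteq> y" using tree E'E unfolding is_tree_def by blast
      then show "e \<in> {{x, y} |x y. x \<in> V' \<and> y \<in> V' \<and> x \<noteq> y}" using e unfolding V'_def by blast
    qed
    show "(x, y) \<in> {(u, v). {u, v} \<in> E'}\<^sup>*" if "x \<in> V'" "y \<in> V'" for x y
      using C_sym[OF reach[OF that(1)]] reach[OF that(2)] unfolding C_def by (rule rtrancl_trans)
    show "\<not> (\<exists>c. 3 \<le> length c \<and> distinct c \<and> (\<forall>i<length c. {c ! i, c ! (Suc i mod length c)} \<in> E'))"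
      using tree E'E unfolding is_tree_def by blast
  qed
  have closed': "act g x \<in> V'" if g: "g \<in> carrier G" and x: "x \<in> V'" for g x
  proof -
    consider h where "h \<in> carrier G" "x = act h x0" | e where "e \<in> E'" "x \<in> e"
      using x by (auto simp: V'_def)
    then show ?thesis
    proof cases
      case 1
      then have "act g x = act (g \<otimes> h) x0" using act_mult g x0 by simp
      then show ?thesis using 1 g m_closed unfolding V'_def by blast
    next
      case 2
      then show ?thesis using E'_act[OF g 2(1)] unfolding V'_def by blast
    qed
  qed
  have edge': "{act g x, act g y} \<in> E'" if "g \<in> carrier G" "{x, y} \<in> E'" for g x y
    using E'_act[OF that] by simp
  have "tree_action G V' E' act"
  proof (intro tree_action.intro tree_action_axioms.intro group_axioms tree')
    show "act g x \<in> V'" if "g \<in> carrier G" "x \<in> V'" for g x by (rule closed'[OF that])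
    show "act \<one> x = x" if "x \<in> V'" for x using act_one that V'V by blast
    show "act (g \<otimes> h) x = act g (act h x)" if "g \<in> carrier G" "h \<in> carrier G" "x \<in> V'" for g h x
      by (rule act_mult[OF that(1,2) subsetD[OF V'V that(3)]])
    show "{act g x, act g y} \<in> E'" if "g \<in> carrier G" "{x, y} \<in> E'" for g x y by (rule edge'[OF that])
    show "act g y \<noteq> x" if "g \<in> carrier G" "{x, y} \<in> E'" "act g x = y" for g x y
      by (rule no_inversion[OF that(1) subsetD[OF E'E that(2)] that(3)])
  qed
  moreover define W where "W = insert x0 (\<Union>F)"
  have "finite e" if "e \<in> F" for e using edge_form[of e] F(2) that by auto
  then have "finite W" using F(1) by (simp add: W_def)
  moreover have "W \<subseteq> V'" using x0V' FE' by (auto simp: W_def V'_def)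
  moreover have "\<forall>x\<in>V'. \<exists>w\<in>W. \<exists>g\<in>carrier G. x = act g w"
  proof
    fix x assume "x \<in> V'"
    then consider g where "g \<in> carrier G" "x = act g x0" | e where "e \<in> E'" "x \<in> e"
      by (auto simp: V'_def)
    then show "\<exists>w\<in>W. \<exists>g\<in>carrier G. x = act g w"
    proof cases
      case 1
      then show ?thesis by (auto simp: W_def)
    next
      case 2
      obtain g f where gf: "g \<in> carrier G" "f \<in> F" "e = act g ` f" using 2(1) by (auto simp: E'_def)
      then obtain z where "z \<in> f" "x = act g z" using 2(2) by blast
      then show ?thesis using gf unfolding W_def by blast
    qed
  qed
  moreover have "\<forall>e\<in>E'. \<exists>f\<in>F. \<exists>g\<in>carrier G. e = act g ` f"
    unfolding E'_def by blast
  ultimately show ?thesis using V'V E'E F(1) FE' by iprover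
qed

lemma gbs_action_exists:
  assumes "\<forall>x\<in>V. \<exists>c\<in>carrier G. (\<forall>g\<in>carrier G. act g x = x \<longleftrightarrow> (\<exists>k::int. g = c [^] k)) \<and>
    (\<forall>k::int. c [^] k = \<one> \<longrightarrow> k = 0)"
  shows "\<exists>a. gbs_action G V E act a"
proof -
  obtain c where c: "\<forall>x\<in>V. c x \<in> carrier G \<and> (\<forall>g\<in>carrier G. act g x = x \<longleftrightarrow> (\<exists>k::int. g = c x [^] k)) \<and>
    (\<forall>k::int. c x [^] k = \<one> \<longrightarrow> k = 0)" using bchoice[OF assms[unfolded Bex_def]] by blast
  obtain rep h where rep: "\<And>x. x \<in> V \<Longrightarrow> rep x \<in> V" "\<And>g x. g \<in> carrier G \<Longrightarrow> x \<in> V \<Longrightarrow> rep (act g x) = rep x"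
    and h: "\<And>x. x \<in> V \<Longrightarrow> h x \<in> carrier G" "\<And>x. x \<in> V \<Longrightarrow> act (h x) (rep x) = x"
    by (rule orbit_representatives) (rule that)
  define a where "a x = h x \<otimes> c (rep x) \<otimes> inv (h x)" for x
  have cr: "c (rep x) \<in> carrier G" if "x \<in> V" for x using c rep(1)[OF that] by blast
  have ak: "a x [^] k = h x \<otimes> c (rep x) [^] k \<otimes> inv (h x)" if x: "x \<in> V" for x and k :: int
    unfolding a_def using conj_int_pow[OF cr[OF x] h(1)[OF x]] by simp
  have "gbs_action_axioms G V act a"
  proof (intro gbs_action_axioms.intro)
    fix x assume x: "x \<in> V"
    note hx = h(1)[OF x] and cx = cr[OF x] and rx = rep(1)[OF x]
    show "a x \<in> carrier G" using hx cx by (simp add: a_def)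
    show "k = 0" if "a x [^] k = \<one>" for k :: int
    proof -
      have "inv (h x) \<otimes> (a x [^] k) \<otimes> h x = c (rep x) [^] k"
        unfolding ak[OF x] using hx cx by (simp add: m_assoc mult_inv_cancel)
      then have "c (rep x) [^] k = \<one>" using that hx by simp
      then show ?thesis using c rx by blast
    qed
    fix g assume g: "g \<in> carrier G"
    let ?s = "inv (h x) \<otimes> g \<otimes> h x"
    have sc: "?s \<in> carrier G" using hx g by simp
    have "act g x = x \<longleftrightarrow> act ?s (rep x) = rep x"
    proof
      assume "act g x = x"
      then show "act ?s (rep x) = rep x"
        using hx g rx h(2)[OF x] act_inv(1)[OF hx rx] x by (simp add: act_mult)
    next
      assume "act ?s (rep x) = rep x"
      then have "act (h x) (act ?s (rep x)) = x" using h(2)[OF x] by simp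
      moreover have "h x \<otimes> ?s = g \<otimes> h x" using hx g by (simp add: m_assoc mult_inv_cancel)
      ultimately have "act (g \<otimes> h x) (rep x) = x" using act_mult[OF hx sc rx] by simp
      then show "act g x = x" using act_mult[OF g hx rx] h(2)[OF x] by simp
    qed
    also have "\<dots> \<longleftrightarrow> (\<exists>k::int. ?s = c (rep x) [^] k)" using c rx sc by blast
    also have "\<dots> \<longleftrightarrow> (\<exists>k::int. g = a x [^] k)"
    proof (intro ex_cong1 iffI)
      fix k :: int
      assume "?s = c (rep x) [^] k"
      then have "a x [^] k = h x \<otimes> ?s \<otimes> inv (h x)" using ak[OF x] by simp
      then show "g = a x [^] k" using hx g by (simp add: m_assoc mult_inv_cancel)
    next
      fix k :: int
      assume "g = a x [^] k"
      then show "?s = c (rep x) [^] k" using hx cx ak[OF x] by (simp add: m_assoc mult_inv_cancel)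
    qed
    finally show "act g x = x \<longleftrightarrow> (\<exists>k::int. g = a x [^] k)" .
    let ?h' = "h (act g x)"
    have gx: "act g x \<in> V" by (rule act_closed[OF g x])
    have h': "?h' \<in> carrier G" "act ?h' (rep x) = act g x" using h[OF gx] rep(2)[OF g x] by auto
    define t where "t = inv ?h' \<otimes> g \<otimes> h x"
    have tc: "t \<in> carrier G" using h' g hx by (simp add: t_def)
    have "act t (rep x) = rep x"
      using h' g hx rx x h(2)[OF x] act_inv(1)[OF h'(1) rx] by (simp add: t_def act_mult)
    then obtain k :: int where k: "t = c (rep x) [^] k" using c rx tc by blast
    \<comment> \<open>\<open>t\<close> measures how far the chosen transports are from being
      equivariant. It fixes \<open>rep x\<close>, so it is a power of the generator there and
      disappears under conjugation.\<close>
    have comm: "t \<otimes> c (rep x) = c (rep x) \<otimes> t"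
      unfolding k using cx int_pow_mult[OF cx, of k 1] int_pow_mult[OF cx, of 1 k] by (simp add: add.commute)
    have gh: "g \<otimes> h x = ?h' \<otimes> t" using h' g hx by (simp add: t_def m_assoc mult_inv_cancel)
    have "g \<otimes> a x \<otimes> inv g = (g \<otimes> h x) \<otimes> c (rep x) \<otimes> inv (g \<otimes> h x)"
      using g hx cx by (simp add: a_def m_assoc inv_mult_group)
    also have "\<dots> = ?h' \<otimes> (t \<otimes> c (rep x)) \<otimes> inv t \<otimes> inv ?h'"
      unfolding gh using h' tc cx by (simp add: m_assoc inv_mult_group)
    also have "\<dots> = a (act g x)"
      unfolding comm a_def rep(2)[OF g x] using h' tc cx by (simp add: m_assoc)
    finally show "a (act g x) = g \<otimes> a x \<otimes> inv g" by simp
  qed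
  then show ?thesis using tree_action_axioms by (auto intro: gbs_action.intro)
qed

end

context gbs_action
begin

text \<open>Without inversions the generator \<open>c\<close> of the setwise stabilizer fixes both
  ends, hence is a power of both vertex generators. Both exponents are nonzero because
  \<open>c\<close> is not the identity.\<close>

lemma edge_label_exists:
  assumes e: "{x, y} \<in> E" and c: "c \<in> carrier G"
    and stab: "\<And>g. g \<in> carrier G \<Longrightarrow> act g ` {x, y} = {x, y} \<longleftrightarrow> (\<exists>k::int. g = c [^] k)"
    and inf: "\<And>k::int. c [^] k = \<one> \<Longrightarrow> k = 0"
  shows "\<exists>l m. l \<noteq> 0 \<and> m \<noteq> 0 \<and> edge_label x l y m"
proof -
  note xy = edge_V[OF e]
  have "act c ` {x, y} = {x, y}" using stab[OF c] c by (metis int_pow_1)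
  then have fx: "act c x = x" "act c y = y" using edge_stab_setwise[OF e c] by simp_all
  obtain l :: int where l: "c = a x [^] l" using gen_stab[OF xy(1) c] fx by blast
  obtain m :: int where m: "c = a y [^] m" using gen_stab[OF xy(2) c] fx by blast
  have c1: "c \<noteq> \<one>"
  proof
    assume "c = \<one>"
    then have "c [^] (1::int) = \<one>" by simp
    then show False using inf by fastforce
  qed
  have "l \<noteq> 0" "m \<noteq> 0" using c1 l m by auto
  moreover have "\<exists>k::int. s = a x [^] (l * k)" if s: "s \<in> carrier G" "act s x = x" "act s y = y" for s
  proof -
    obtain k :: int where "s = c [^] k" using stab[OF s(1)] s by auto
    then have "s = a x [^] (l * k)" using gen_closed[OF xy(1)] by (simp add: l int_pow_pow)
    then show ?thesis by blast
  qed
  ultimately show ?thesis using l m unfolding edge_label_def by blast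
qed

end

theorem corollary6p5:
  fixes G :: "('a, 'b) monoid_scheme"
  assumes "GBS_group TYPE('v) G"
  shows "large_group G \<longleftrightarrow>
    \<not> (\<exists>m n :: int. m \<noteq> 0 \<and> n \<noteq> 0 \<and> coprime m n \<and> is_quotient_of G (BS m n))"
proof -
  obtain A where grp: "group G" and A: "finite A" "A \<subseteq> carrier G" "generate G A = carrier G"
    using assms unfolding GBS_group_def finitely_generated_group_def by blast
  interpret group G by (rule grp)
  obtain V0 :: "'v set" and E0 \<phi> where act: "acts_on_tree_without_inversions G V0 E0 \<phi>"
    and Vst: "\<forall>x\<in>V0. infinite_cyclic_subgroup (stabilizer G \<phi> x) G"
    and Est: "\<forall>e\<in>E0. infinite_cyclic_subgroup (stabilizer G (\<lambda>g. image (\<phi> g)) e) G"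
    using assms unfolding GBS_group_def by blast
  have ga: "group_action G V0 \<phi>" and tree: "is_tree V0 E0"
    and edges: "\<forall>g\<in>carrier G. \<forall>e\<in>E0. \<phi> g ` e \<in> E0"
    and noinv: "\<not> (\<exists>g\<in>carrier G. \<exists>x y. {x, y} \<in> E0 \<and> \<phi> g x = y \<and> \<phi> g y = x)"
    using act unfolding acts_on_tree_without_inversions_def by blast+
  have "tree_action G V0 E0 \<phi>"
  proof (intro tree_action.intro tree_action_axioms.intro)
    show "\<phi> \<one>\<^bsub>G\<^esub> x = x" if "x \<in> V0" for x
      using fun_cong[OF group_action.id_eq_one[OF ga], of x] that by simp
    show "\<phi> g x \<in> V0" if "g \<in> carrier G" "x \<in> V0" for g x
      by (rule group_action.element_image[OF ga that HOL.refl])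
    show "\<phi> (g \<otimes>\<^bsub>G\<^esub> h) x = \<phi> g (\<phi> h x)" if "g \<in> carrier G" "h \<in> carrier G" "x \<in> V0" for g h x
      by (rule group_action.composition_rule[OF ga that(3,1,2)])
    show "{\<phi> g x, \<phi> g y} \<in> E0" if g: "g \<in> carrier G" and e: "{x, y} \<in> E0" for g x y
      using bspec[OF bspec[OF edges g] e] by simp
    show "\<phi> g y \<noteq> x" if "g \<in> carrier G" "{x, y} \<in> E0" "\<phi> g x = y" for g x y
      using noinv that by blast
  qed (fact grp, fact tree)
  \<comment> \<open>Finite generation enters here: it replaces the given tree by an invariant
    subtree with finitely many vertex and edge orbits, with the same stabilizers.\<close>
  from tree_action.cofinite_subtree[OF this A] obtain V E W F where
    sub: "V \<subseteq> V0" "E \<subseteq> E0" and ta: "tree_action G V E \<phi>" and fin: "finite W" "finite F"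
    and W: "\<forall>x\<in>V. \<exists>w\<in>W. \<exists>g\<in>carrier G. x = \<phi> g w" "W \<subseteq> V"
    and F: "\<forall>e\<in>E. \<exists>f\<in>F. \<exists>g\<in>carrier G. e = \<phi> g ` f" "F \<subseteq> E" by iprover
  interpret T: tree_action G V E \<phi> by (rule ta)
  have "\<forall>x\<in>V. \<exists>c\<in>carrier G. (\<forall>g\<in>carrier G. \<phi> g x = x \<longleftrightarrow> (\<exists>k::int. g = c [^]\<^bsub>G\<^esub> k)) \<and>
    (\<forall>k::int. c [^]\<^bsub>G\<^esub> k = \<one>\<^bsub>G\<^esub> \<longrightarrow> k = 0)"
  proof
    fix x assume "x \<in> V"
    then have "infinite_cyclic_subgroup (stabilizer G \<phi> x) G" using Vst sub by blast
    from infinite_cyclic_generator[OF this]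
    show "\<exists>c\<in>carrier G. (\<forall>g\<in>carrier G. \<phi> g x = x \<longleftrightarrow> (\<exists>k::int. g = c [^]\<^bsub>G\<^esub> k)) \<and>
      (\<forall>k::int. c [^]\<^bsub>G\<^esub> k = \<one>\<^bsub>G\<^esub> \<longrightarrow> k = 0)"
      unfolding stabilizer_def by (elim bexE, intro bexI) auto
  qed
  then obtain a where "gbs_action G V E \<phi> a" using T.gbs_action_exists by blast
  then interpret B: gbs_action G V E \<phi> a .
  have lab: "\<forall>x y. {x, y} \<in> E \<longrightarrow> (\<exists>l m. l \<noteq> 0 \<and> m \<noteq> 0 \<and> B.edge_label x l y m)"
  proof (intro allI impI)
    fix x y assume e: "{x, y} \<in> E"
    then have "infinite_cyclic_subgroup (stabilizer G (\<lambda>g. image (\<phi> g)) {x, y}) G" using Est sub by blast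
    from infinite_cyclic_generator[OF this] obtain c where c: "c \<in> carrier G"
      "\<forall>g. g \<in> stabilizer G (\<lambda>g. image (\<phi> g)) {x, y} \<longleftrightarrow> (\<exists>k::int. g = c [^]\<^bsub>G\<^esub> k)"
      "\<forall>k::int. c [^]\<^bsub>G\<^esub> k = \<one>\<^bsub>G\<^esub> \<longrightarrow> k = 0" by blast
    show "\<exists>l m. l \<noteq> 0 \<and> m \<noteq> 0 \<and> B.edge_label x l y m"
    proof (rule B.edge_label_exists[OF e c(1)])
      show "\<phi> g ` {x, y} = {x, y} \<longleftrightarrow> (\<exists>k::int. g = c [^]\<^bsub>G\<^esub> k)" if "g \<in> carrier G" for g
        using c(2) that unfolding stabilizer_def by blast
      show "k = 0" if "c [^]\<^bsub>G\<^esub> k = \<one>\<^bsub>G\<^esub>" for k :: int using c(3) that by blast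
    qed
  qed
  have orb: "{y. T.same_orbit (\<phi> g x) y} = {y. T.same_orbit x y}" if "g \<in> carrier G" "x \<in> V" for g x
    using T.same_orbit_act[OF that] by blast
  have "(\<lambda>x. {y. T.same_orbit x y}) ` V \<subseteq> (\<lambda>x. {y. T.same_orbit x y}) ` W"
  proof (rule image_subsetI)
    fix x assume "x \<in> V"
    then obtain w g where "w \<in> W" "g \<in> carrier G" "x = \<phi> g w" using W(1) by blast
    then show "{y. T.same_orbit x y} \<in> (\<lambda>x. {y. T.same_orbit x y}) ` W" using orb W(2) by blast
  qed
  then have finV: "finite ((\<lambda>x. {y. T.same_orbit x y}) ` V)" using fin(1) by (rule finite_subset[OF _ finite_imageI])
  have "B.eorb ` E \<subseteq> B.eorb ` F"
  proof (rule image_subsetI)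
    fix e assume "e \<in> E"
    then obtain f g where fg: "f \<in> F" "g \<in> carrier G" "e = \<phi> g ` f" using F(1) by blast
    then have "B.eorb e = B.eorb f" using B.eorb_act[OF fg(2) T.edge_subset] F(2) by blast
    then show "B.eorb e \<in> B.eorb ` F" using fg(1) by blast
  qed
  then have finE: "finite (B.eorb ` E)" using fin(2) by (rule finite_subset[OF _ finite_imageI])
  have "\<not> large_group G" if mn: "coprime m n" and q: "is_quotient_of G (BS m n)" for m n :: int
  proof -
    obtain u t where "u \<in> carrier G" "t \<in> carrier G" "generate G {u, t} = carrier G"
      "t \<otimes>\<^bsub>G\<^esub> u [^]\<^bsub>G\<^esub> m \<otimes>\<^bsub>G\<^esub> inv\<^bsub>G\<^esub> t = u [^]\<^bsub>G\<^esub> n" using q unfolding quotient_of_BS_iff by blast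
    then show ?thesis using BS_quotient_not_large mn by blast
  qed
  then show ?thesis using B.quotient_of_BS_if_not_large[OF lab finV finE] by blast
qed

end
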